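(* Let $V$ be a complex vector space of dimension $4$ with basis $\{x,y,z,w\}$. Let $\mathbb{P}$ be the weighted projective space $\big((\mathrm{S}^2 V\oplus\Lambda^4 V)\setminus\{0\}\big)/\mathbb{C}^*$ for the action $t(q,p)=(tq,t^2p)$, and let $H\subset\mathbb{P}$ be the hypersurface given by the equation $\operatorname{res}(q)=p^2$. Then the map $$\eta\colon \mathrm{N}(V;2,2)\longrightarrow H,\qquad \eta(\langle\varphi\rangle)=\langle \det(\varphi),\,\mathrm{e}(\varphi)\rangle,$$ is an isomorphism of algebraic varieties.
   Context: Everything is over $\mathbb{C}$. Kronecker moduli space: for a finite-dimensional vector space $V$ and positive integers $m,n$, the group $G=(\mathrm{GL}(n,\mathbb{C})\times \mathrm{GL}(m,\mathbb{C}))/\mathbb{C}^*$ (with $\mathbb{C}^*$ embedded as pairs of equal scalars) acts on the space $\operatorname{Hom}(\mathbb{C}^n,\mathbb{C}^m\otimes V)$ of $m\times n$-matrices with entries in $V$ by $(g,h)\varphi=h\varphi g^{-1}$. An element $\varphi$ is semi-stable (resp. stable) if for all subspaces $A\subset\mathbb{C}^n$, $B\subset\mathbb{C}^m$ with $\varphi(A)\subset B\otimes V$ and $(A,B)\neq(0,0),(\mathbb{C}^n,\mathbb{C}^m)$, one has $m\dim A\le n\dim B$ (resp. $<$). $\mathrm{N}(V;m,n)=\operatorname{Hom}(\mathbb{C}^n,\mathbb{C}^m\otimes V)^{\mathrm{ss}}/\!\!/G$ is the good quotient of the semi-stable locus; $\langle\varphi\rangle$ denotes the point defined by $\varphi$.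 For $m=n=2$, $\varphi$ is semi-stable iff $\det(\varphi)\ne 0$. For $\varphi=(\varphi_{ij})\in\operatorname{Hom}(\mathbb{C}^2,\mathbb{C}^2\otimes V)$: $\det(\varphi)=\varphi_{11}\varphi_{22}-\varphi_{12}\varphi_{21}\in \mathrm{S}^2V$ and $\mathrm{e}(\varphi)=\varphi_{11}\wedge\varphi_{22}\wedge\varphi_{12}\wedge\varphi_{21}\in\Lambda^4V$. One has $\det((g,h)\varphi)=\det(g)^{-1}\det(h)\det(\varphi)$ and $\mathrm{e}((g,h)\varphi)=\det(g)^{-2}\det(h)^2\mathrm{e}(\varphi)$, so $\eta$ is well defined as a map to $\mathbb{P}$, and its image lies in $H$. In the equation of $H$, the element $p\in\Lambda^4V$ is identified with its coordinate relative to $x\wedge y\wedge z\wedge w$, and $\operatorname{res}(q)$ is the resultant of the quadratic form $q\in \mathrm{S}^2V$, viewed as a quadratic polynomial in $x,y,z,w$, i.e. the determinant of the $4\times4$ matrix of its second partial derivatives with respect to $x,y,z,w$. *)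

theory Defs
  imports "HOL-Analysis.Analysis" "HOL-Library.Function_Algebras"
begin

section \<open>Algebraic varieties as spaces with functions\<close>

text \<open>
  A (reduced) variety over the complex numbers is modelled classically: a topological space
  together with, for every open set \<open>U\<close>, the complex-valued functions that are regular on \<open>U\<close>.
  Functions are total in HOL; only their values on \<open>U\<close> matter for \<open>regular X U\<close>, and
  \<open>regular X U\<close> is only meaningful for open \<open>U\<close>.
\<close>

record 'a fun_space =
  zariski :: "'a topology"
  regular :: "'a set \<Rightarrow> ('a \<Rightarrow> complex) \<Rightarrow> bool"

abbreviation points :: "'a fun_space \<Rightarrow> 'a set" where
  "points X \<equiv> topspace (zariski X)"

definition morphism :: "'a fun_space \<Rightarrow> 'b fun_space \<Rightarrow> ('a \<Rightarrow> 'b) \<Rightarrow> bool" where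
  "morphism X Y f \<longleftrightarrow>
     continuous_map (zariski X) (zariski Y) f \<and>
     (\<forall>U g. openin (zariski Y) U \<and> regular Y U g \<longrightarrow>
            regular X {x \<in> points X. f x \<in> U} (\<lambda>x. g (f x)))"

definition isomorphism :: "'a fun_space \<Rightarrow> 'b fun_space \<Rightarrow> ('a \<Rightarrow> 'b) \<Rightarrow> bool" where
  "isomorphism X Y f \<longleftrightarrow>
     morphism X Y f \<and>
     (\<exists>g. morphism Y X g \<and> (\<forall>x\<in>points X. g (f x) = x) \<and> (\<forall>y\<in>points Y. f (g y) = y))"

text \<open>The structure induced on a subset (used for open subsets and, with the reduced structure,
  for closed subsets): regular functions are locally restrictions of regular functions.\<close>

definition induced :: "'a fun_space \<Rightarrow> 'a set \<Rightarrow> 'a fun_space" where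
  "induced X S = \<lparr>
     zariski = subtopology (zariski X) S,
     regular = (\<lambda>U f. \<forall>x\<in>U. \<exists>W g. openin (zariski X) W \<and> x \<in> W \<and> regular X W g \<and>
                                  (\<forall>y\<in>W \<inter> U. f y = g y)) \<rparr>"

text \<open>Polynomial functions on a complex vector space, given by its scalar multiplication \<open>s\<close>:
  the algebra generated by the linear functionals. The ambient spaces below may be
  infinite-dimensional, but only finite-dimensional subspaces of them are used, and every linear
  functional on a subspace extends.\<close>

definition dual :: "(complex \<Rightarrow> 'v \<Rightarrow> 'v) \<Rightarrow> ('v::ab_group_add \<Rightarrow> complex) set" where
  "dual s = {\<xi>. Vector_Spaces.linear s (*) \<xi>}"

inductive_set poly_funs :: "(complex \<Rightarrow> 'v \<Rightarrow> 'v) \<Rightarrow> ('v::ab_group_add \<Rightarrow> complex) set"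
  for s :: "complex \<Rightarrow> 'v \<Rightarrow> 'v" where
  const: "(\<lambda>_. c) \<in> poly_funs s"
| functional: "\<xi> \<in> dual s \<Longrightarrow> \<xi> \<in> poly_funs s"
| add: "f \<in> poly_funs s \<Longrightarrow> g \<in> poly_funs s \<Longrightarrow> (\<lambda>v. f v + g v) \<in> poly_funs s"
| mult: "f \<in> poly_funs s \<Longrightarrow> g \<in> poly_funs s \<Longrightarrow> (\<lambda>v. f v * g v) \<in> poly_funs s"

definition zariski_top :: "(complex \<Rightarrow> 'v \<Rightarrow> 'v) \<Rightarrow> 'v::ab_group_add set \<Rightarrow> 'v topology" where
  "zariski_top s S = topology_generated_by {{v \<in> S. p v \<noteq> 0} |p. p \<in> poly_funs s}"

definition zariski_space :: "(complex \<Rightarrow> 'v \<Rightarrow> 'v) \<Rightarrow> 'v::ab_group_add set \<Rightarrow> 'v fun_space" where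
  "zariski_space s S = \<lparr>
     zariski = zariski_top s S,
     regular = (\<lambda>U f. \<forall>v\<in>U. \<exists>W. \<exists>a\<in>poly_funs s. \<exists>b\<in>poly_funs s.
                        openin (zariski_top s S) W \<and> v \<in> W \<and>
                        (\<forall>u\<in>W \<inter> U. b u \<noteq> 0 \<and> f u = a u / b u)) \<rparr>"

lemma topspace_zariski_top [simp]: "topspace (zariski_top s S) = S"
proof -
  have "S \<subseteq> \<Union>{{v \<in> S. p v \<noteq> 0} |p. p \<in> poly_funs s}"
  proof
    fix v assume "v \<in> S"
    then have "v \<in> {v \<in> S. (\<lambda>_. 1::complex) v \<noteq> 0}" by simp
    with poly_funs.const[of 1 s] show "v \<in> \<Union>{{v \<in> S. p v \<noteq> 0} |p. p \<in> poly_funs s}" by blast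
  qed
  moreover have "\<Union>{{v \<in> S. p v \<noteq> 0} |p. p \<in> poly_funs s} \<subseteq> S" by blast
  ultimately show ?thesis
    unfolding zariski_top_def topology_generated_by_topspace by (rule equalityI[rotated])
qed

text \<open>Pointwise scalar multiplication on functions. The affine \<open>n\<close>-space is the space of sequences
  supported on the first \<open>n\<close> indices, so that \<open>n\<close> can be quantified.\<close>

definition fun_scale :: "complex \<Rightarrow> ('a \<Rightarrow> complex) \<Rightarrow> 'a \<Rightarrow> complex" where
  "fun_scale c f = (\<lambda>x. c * f x)"

definition affine_space :: "nat \<Rightarrow> (nat \<Rightarrow> complex) set" where
  "affine_space n = {v. \<forall>i\<ge>n. v i = 0}"

definition affine_algebraic_set :: "(nat \<Rightarrow> complex) set \<Rightarrow> bool" where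
  "affine_algebraic_set S \<longleftrightarrow> (\<exists>n. closedin (zariski_top fun_scale (affine_space n)) S)"

definition affine_variety :: "'a fun_space \<Rightarrow> bool" where
  "affine_variety X \<longleftrightarrow>
     (\<exists>S f. affine_algebraic_set S \<and> isomorphism X (zariski_space fun_scale S) f)"

definition function_sheaf :: "'a fun_space \<Rightarrow> bool" where
  "function_sheaf X \<longleftrightarrow>
     (\<forall>U f. openin (zariski X) U \<longrightarrow>
        (regular X U f \<longleftrightarrow>
          (\<forall>x\<in>U. \<exists>W g. openin (zariski X) W \<and> x \<in> W \<and> W \<subseteq> U \<and> regular X W g \<and>
                        (\<forall>y\<in>W. f y = g y))))"

text \<open>Separatedness is stated without products: two morphisms from an affine variety agree on a
  closed set. For a space with an affine open cover this is equivalent to closedness of the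
  diagonal.\<close>

definition separated :: "'a fun_space \<Rightarrow> bool" where
  "separated X \<longleftrightarrow>
     (\<forall>S f g. affine_algebraic_set S \<and>
        morphism (zariski_space fun_scale S) X f \<and> morphism (zariski_space fun_scale S) X g \<longrightarrow>
        closedin (zariski_top fun_scale S) {v \<in> S. f v = g v})"

definition variety :: "'a fun_space \<Rightarrow> bool" where
  "variety X \<longleftrightarrow>
     function_sheaf X \<and> separated X \<and>
     (\<exists>\<U>. finite \<U> \<and> \<Union>\<U> = points X \<and>
          (\<forall>U\<in>\<U>. openin (zariski X) U \<and> affine_variety (induced X U)))"

section \<open>Quotients\<close>

text \<open>A group acting on a space enters only through the set \<open>T\<close> of transformations by which its
  elements act.\<close>

definition invariant_set :: "('a \<Rightarrow> 'a) set \<Rightarrow> 'a set \<Rightarrow> bool" where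
  "invariant_set T Z \<longleftrightarrow> (\<forall>t\<in>T. \<forall>x\<in>Z. t x \<in> Z)"

text \<open>Good quotients in the sense of Seshadri: a surjective affine morphism \<open>\<pi>\<close>, constant on
  orbits, such that the regular functions on \<open>U\<close> are the invariant regular functions on the
  preimage of \<open>U\<close>, images of invariant closed sets are closed, and disjoint invariant closed sets
  have disjoint images.\<close>

definition good_quotient ::
  "('a \<Rightarrow> 'a) set \<Rightarrow> 'a fun_space \<Rightarrow> 'b fun_space \<Rightarrow> ('a \<Rightarrow> 'b) \<Rightarrow> bool" where
  "good_quotient T X Y \<pi> \<longleftrightarrow>
     variety Y \<and> morphism X Y \<pi> \<and> \<pi> ` points X = points Y \<and>
     (\<forall>W. openin (zariski Y) W \<and> affine_variety (induced Y W) \<longrightarrow>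
          affine_variety (induced X {x \<in> points X. \<pi> x \<in> W})) \<and>
     (\<forall>t\<in>T. \<forall>x\<in>points X. \<pi> (t x) = \<pi> x) \<and>
     (\<forall>U g. openin (zariski Y) U \<longrightarrow>
        (regular X {x \<in> points X. \<pi> x \<in> U} g \<and>
         (\<forall>t\<in>T. \<forall>x\<in>points X. \<pi> x \<in> U \<longrightarrow> g (t x) = g x)
         \<longleftrightarrow> (\<exists>f. regular Y U f \<and> (\<forall>x\<in>points X. \<pi> x \<in> U \<longrightarrow> g x = f (\<pi> x))))) \<and>
     (\<forall>Z. closedin (zariski X) Z \<and> invariant_set T Z \<longrightarrow> closedin (zariski Y) (\<pi> ` Z)) \<and>
     (\<forall>Z Z'. closedin (zariski X) Z \<and> closedin (zariski X) Z' \<and>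
             invariant_set T Z \<and> invariant_set T Z' \<and> Z \<inter> Z' = {} \<longrightarrow>
             \<pi> ` Z \<inter> \<pi> ` Z' = {})"

definition orbit_of :: "('a \<Rightarrow> 'a) set \<Rightarrow> 'a \<Rightarrow> 'a set" where
  "orbit_of T x = (\<lambda>t. t x) ` T"

definition orbit_space :: "('a \<Rightarrow> 'a) set \<Rightarrow> 'a fun_space \<Rightarrow> 'a set fun_space" where
  "orbit_space T X = \<lparr>
     zariski = topology (\<lambda>U. U \<subseteq> orbit_of T ` points X \<and>
                             openin (zariski X) {x \<in> points X. orbit_of T x \<in> U}),
     regular = (\<lambda>U f. regular X {x \<in> points X. orbit_of T x \<in> U} (\<lambda>x. f (orbit_of T x))) \<rparr>"

lemma openin_orbit_space:
  "openin (zariski (orbit_space T X)) U \<longleftrightarrow>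
     U \<subseteq> orbit_of T ` points X \<and> openin (zariski X) {x \<in> points X. orbit_of T x \<in> U}"
proof -
  have "istopology (\<lambda>U. U \<subseteq> orbit_of T ` points X \<and>
          openin (zariski X) {x \<in> points X. orbit_of T x \<in> U})"
    unfolding istopology_def
  proof (intro conjI allI impI)
    fix S S' assume *: "S \<subseteq> orbit_of T ` points X \<and> openin (zariski X) {x \<in> points X. orbit_of T x \<in> S}"
      "S' \<subseteq> orbit_of T ` points X \<and> openin (zariski X) {x \<in> points X. orbit_of T x \<in> S'}"
    then show "S \<inter> S' \<subseteq> orbit_of T ` points X" by blast
    have "{x \<in> points X. orbit_of T x \<in> S \<inter> S'} =
        {x \<in> points X. orbit_of T x \<in> S} \<inter> {x \<in> points X. orbit_of T x \<in> S'}" by blast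
    then show "openin (zariski X) {x \<in> points X. orbit_of T x \<in> S \<inter> S'}"
      using * by (simp add: openin_Int)
  next
    fix K assume *: "\<forall>S\<in>K. S \<subseteq> orbit_of T ` points X \<and>
        openin (zariski X) {x \<in> points X. orbit_of T x \<in> S}"
    then show "\<Union>K \<subseteq> orbit_of T ` points X" by blast
    have "openin (zariski X) (\<Union>S\<in>K. {x \<in> points X. orbit_of T x \<in> S})"
      using * by (intro openin_Union) blast
    moreover have "(\<Union>S\<in>K. {x \<in> points X. orbit_of T x \<in> S}) = {x \<in> points X. orbit_of T x \<in> \<Union>K}"
      by blast
    ultimately show "openin (zariski X) {x \<in> points X. orbit_of T x \<in> \<Union>K}" by metis
  qed
  then show ?thesis by (simp add: orbit_space_def topology_inverse')
qed

section \<open>Kronecker moduli spaces\<close>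

text \<open>Throughout, \<open>V\<close> is the vector space with underlying type \<open>'v\<close> and scalar multiplication
  \<open>s\<close>. The space of homomorphisms from \<open>\<complex>\<^sup>n\<close> to \<open>\<complex>\<^sup>m \<otimes> V\<close> is the space \<open>'v^'n^'m\<close> of
  matrices with \<open>m\<close> rows and \<open>n\<close> columns with entries in \<open>V\<close>, and \<open>\<complex>\<^sup>m \<otimes> V\<close> is \<open>'v^'m\<close>;
  \<open>kron_mult s h \<phi> k\<close> is the matrix product \<open>h \<phi> k\<close>.\<close>

definition vec_scale :: "(complex \<Rightarrow> 'v \<Rightarrow> 'v) \<Rightarrow> complex \<Rightarrow> 'v^'m \<Rightarrow> 'v^'m" where
  "vec_scale s c u = (\<chi> i. s c (u $ i))"

definition kron_apply ::
  "(complex \<Rightarrow> 'v \<Rightarrow> 'v) \<Rightarrow> 'v::ab_group_add^'n^'m \<Rightarrow> complex^'n \<Rightarrow> 'v^'m" where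
  "kron_apply s \<phi> a = (\<chi> i. \<Sum>j\<in>UNIV. s (a $ j) (\<phi> $ i $ j))"

definition tensor_subspace ::
  "(complex \<Rightarrow> 'v \<Rightarrow> 'v) \<Rightarrow> (complex^'m) set \<Rightarrow> ('v::ab_group_add^'m) set" where
  "tensor_subspace s B = module.span (vec_scale s) {\<chi> i. s (b $ i) v |b v. b \<in> B}"

definition semistable :: "(complex \<Rightarrow> 'v \<Rightarrow> 'v) \<Rightarrow> 'v::ab_group_add^'n^'m \<Rightarrow> bool" where
  "semistable s \<phi> \<longleftrightarrow>
     (\<forall>A B. vec.subspace A \<and> vec.subspace B \<and>
        kron_apply s \<phi> ` A \<subseteq> tensor_subspace s B \<and>
        (A, B) \<noteq> ({0}, {0}) \<and> (A, B) \<noteq> (UNIV, UNIV) \<longrightarrow>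
        CARD('m) * vec.dim A \<le> CARD('n) * vec.dim B)"

definition semistable_locus ::
  "(complex \<Rightarrow> 'v \<Rightarrow> 'v) \<Rightarrow> ('v::ab_group_add^'n^'m) fun_space" where
  "semistable_locus s = zariski_space (vec_scale (vec_scale s)) {\<phi>. semistable s \<phi>}"

definition kron_mult ::
  "(complex \<Rightarrow> 'v \<Rightarrow> 'v) \<Rightarrow> complex^'m^'m \<Rightarrow> 'v::ab_group_add^'n^'m \<Rightarrow> complex^'n^'n \<Rightarrow> 'v^'n^'m"
  where
  "kron_mult s h \<phi> k = (\<chi> i j. \<Sum>a\<in>UNIV. \<Sum>b\<in>UNIV. s (h $ i $ a * k $ b $ j) (\<phi> $ a $ b))"

text \<open>The group \<open>(GL(n) \<times> GL(m)) / \<complex>\<^sup>*\<close>, as a group of transformations: for \<open>V \<noteq> 0\<close> the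
  pairs of equal scalars are exactly the pairs \<open>(g, h)\<close> that act trivially.\<close>

definition kron_group ::
  "(complex \<Rightarrow> 'v \<Rightarrow> 'v) \<Rightarrow> ('v::ab_group_add^'n^'m \<Rightarrow> 'v^'n^'m) set" where
  "kron_group s =
     {\<lambda>\<phi>. kron_mult s h \<phi> (matrix_inv g) |(g :: complex^'n^'n) (h :: complex^'m^'m).
        invertible g \<and> invertible h}"

text \<open>\<open>N\<close> with the map \<open>\<phi> \<mapsto> \<langle>\<phi>\<rangle>\<close>, here \<open>\<pi>\<close>, is the moduli space \<open>N(V; m, n)\<close>. As usual, a good
  quotient is determined only up to (unique) isomorphism.\<close>

definition kronecker_moduli_space ::
  "(complex \<Rightarrow> 'v \<Rightarrow> 'v) \<Rightarrow> 'p fun_space \<Rightarrow> ('v::ab_group_add^'n^'m \<Rightarrow> 'p) \<Rightarrow> bool" where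
  "kronecker_moduli_space s N \<pi> \<longleftrightarrow> good_quotient (kron_group s) (semistable_locus s) N \<pi>"

section \<open>The hypersurface\<close>

text \<open>\<open>S\<^sup>2V\<close> is realised as the space of quadratic forms on the dual space, with \<open>u v\<close> the form
  \<open>\<xi> \<mapsto> \<xi>(u) \<xi>(v)\<close>, and \<open>\<Lambda>\<^sup>4V\<close> as the space of alternating 4-linear forms on the dual space, with
  \<open>u\<^sub>1 \<and> u\<^sub>2 \<and> u\<^sub>3 \<and> u\<^sub>4\<close> the form \<open>(\<xi>\<^sub>1, \<xi>\<^sub>2, \<xi>\<^sub>3, \<xi>\<^sub>4) \<mapsto> det(\<xi>\<^sub>i(u\<^sub>j))\<close>. The value 0 is used outside
  the dual space.\<close>

definition sym_mult ::
  "(complex \<Rightarrow> 'v \<Rightarrow> 'v) \<Rightarrow> 'v::ab_group_add \<Rightarrow> 'v \<Rightarrow> ('v \<Rightarrow> complex) \<Rightarrow> complex" where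
  "sym_mult s u v = (\<lambda>\<xi>. if \<xi> \<in> dual s then \<xi> u * \<xi> v else 0)"

definition wedge4 ::
  "(complex \<Rightarrow> 'v \<Rightarrow> 'v) \<Rightarrow> 'v::ab_group_add^4 \<Rightarrow> ('v \<Rightarrow> complex)^4 \<Rightarrow> complex" where
  "wedge4 s u = (\<lambda>\<xi>. if \<forall>i. \<xi> $ i \<in> dual s then det (\<chi> i j. (\<xi> $ i) (u $ j)) else 0)"

definition Sym2 :: "(complex \<Rightarrow> 'v \<Rightarrow> 'v) \<Rightarrow> (('v::ab_group_add \<Rightarrow> complex) \<Rightarrow> complex) set" where
  "Sym2 s = module.span fun_scale {sym_mult s u v |u v. True}"

definition Lambda4 :: "(complex \<Rightarrow> 'v \<Rightarrow> 'v) \<Rightarrow> (('v::ab_group_add \<Rightarrow> complex)^4 \<Rightarrow> complex) set" where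
  "Lambda4 s = module.span fun_scale (range (wedge4 s))"

definition kron_det ::
  "(complex \<Rightarrow> 'v \<Rightarrow> 'v) \<Rightarrow> 'v::ab_group_add^2^2 \<Rightarrow> ('v \<Rightarrow> complex) \<Rightarrow> complex" where
  "kron_det s \<phi> = sym_mult s (\<phi>$1$1) (\<phi>$2$2) - sym_mult s (\<phi>$1$2) (\<phi>$2$1)"

definition kron_e ::
  "(complex \<Rightarrow> 'v \<Rightarrow> 'v) \<Rightarrow> 'v::ab_group_add^2^2 \<Rightarrow> ('v \<Rightarrow> complex)^4 \<Rightarrow> complex" where
  "kron_e s \<phi> = wedge4 s (vector [\<phi>$1$1, \<phi>$2$2, \<phi>$1$2, \<phi>$2$1])"

text \<open>\<open>S\<^sup>2V \<oplus> \<Lambda>\<^sup>4V\<close> as a subset of a product type with componentwise operations.\<close>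

type_synonym 'v sym_wedge =
  "(('v \<Rightarrow> complex) \<Rightarrow> complex) \<times> (('v \<Rightarrow> complex)^4 \<Rightarrow> complex)"

definition pair_scale :: "complex \<Rightarrow> 'v sym_wedge \<Rightarrow> 'v sym_wedge" where
  "pair_scale c = (\<lambda>(q, p). (fun_scale c q, fun_scale c p))"

definition weighted_action :: "('v sym_wedge \<Rightarrow> 'v sym_wedge) set" where
  "weighted_action = {\<lambda>(q, p). (fun_scale t q, fun_scale (t\<^sup>2) p) |t. t \<noteq> 0}"

definition weighted_class :: "'v sym_wedge \<Rightarrow> 'v sym_wedge set" where
  "weighted_class = orbit_of weighted_action"

definition weighted_projective_space ::
  "(complex \<Rightarrow> 'v \<Rightarrow> 'v) \<Rightarrow> 'v::ab_group_add sym_wedge set fun_space" where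
  "weighted_projective_space s =
     orbit_space weighted_action (zariski_space pair_scale (Sym2 s \<times> Lambda4 s - {0}))"

text \<open>For a basis \<open>b\<close> of \<open>V\<close>, an element \<open>q\<close> of \<open>S\<^sup>2V\<close> becomes a polynomial function in the basis
  vectors as variables: its value at \<open>t\<close> is the value of \<open>q\<close> at the linear functional that maps
  \<open>b\<^sub>i\<close> to \<open>t\<^sub>i\<close>.\<close>

definition as_polynomial ::
  "(complex \<Rightarrow> 'v \<Rightarrow> 'v) \<Rightarrow> 'v::ab_group_add^4 \<Rightarrow> (('v \<Rightarrow> complex) \<Rightarrow> complex) \<Rightarrow> complex^4 \<Rightarrow> complex"
  where
  "as_polynomial s b q t = q (THE \<xi>. \<xi> \<in> dual s \<and> (\<forall>i. \<xi> (b $ i) = t $ i))"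

definition partial_deriv :: "'n \<Rightarrow> (complex^'n \<Rightarrow> complex) \<Rightarrow> complex^'n \<Rightarrow> complex" where
  "partial_deriv i F t = deriv (\<lambda>c. F (t + axis i c)) 0"

text \<open>The second partial derivatives of a quadratic form are constant, so they may be evaluated
  at 0.\<close>

definition res ::
  "(complex \<Rightarrow> 'v \<Rightarrow> 'v) \<Rightarrow> 'v::ab_group_add^4 \<Rightarrow> (('v \<Rightarrow> complex) \<Rightarrow> complex) \<Rightarrow> complex" where
  "res s b q = det (\<chi> i j. partial_deriv i (partial_deriv j (as_polynomial s b q)) 0)"

definition hypersurface ::
  "(complex \<Rightarrow> 'v \<Rightarrow> 'v) \<Rightarrow> 'v::ab_group_add^4 \<Rightarrow> 'v sym_wedge set fun_space" where
  "hypersurface s b =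
     induced (weighted_projective_space s)
       {weighted_class (q, p) |q p. (q, p) \<in> Sym2 s \<times> Lambda4 s - {0} \<and>
          (\<exists>c. p = fun_scale c (wedge4 s b) \<and> res s b q = c\<^sup>2)}"

end

theory Submission
  imports Defs
begin

text \<open>
  Write \<open>\<phi>\<^sub>1\<^sub>1 = m\<^sub>1 + i m\<^sub>2\<close>, \<open>\<phi>\<^sub>2\<^sub>2 = m\<^sub>1 - i m\<^sub>2\<close>, \<open>\<phi>\<^sub>1\<^sub>2 = m\<^sub>3 + i m\<^sub>4\<close>, \<open>\<phi>\<^sub>2\<^sub>1 = - m\<^sub>3 + i m\<^sub>4\<close>.
  In terms of the matrix \<open>M\<close> of coordinates of \<open>m\<^sub>1, \<dots>, m\<^sub>4 \<in> V\<close>, the determinant of \<open>\<phi>\<close> is the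
  Gram matrix \<open>M\<^sup>T M\<close> and \<open>e(\<phi>)\<close> is \<open>4 det M\<close>; the two special linear groups act as left and right
  multiplications by quaternions of norm one, that is, as the special orthogonal group.

  Invariant polynomials are polynomials in \<open>M\<^sup>T M\<close> and \<open>det M\<close>: if a real \<open>M\<close> is stretched by
  \<open>1 + c v v\<^sup>T\<close>, a reflection invariant polynomial is a polynomial in \<open>c\<close> that is symmetric under
  \<open>c \<mapsto> - 2 / (v \<bullet> v) - c\<close>, hence a polynomial in \<open>t = 2 c + (v \<bullet> v) c\<^sup>2\<close>, while the Gram matrix moves
  by \<open>t\<close> times a rank one matrix. So the invariant is a polynomial in the Gram matrix along enough
  directions, hence a polynomial.

  Every point of the hypersurface is the image of some \<open>M\<close> whose column space is stable under complex
  conjugation. For such \<open>M\<close>, a polynomial \<open>b\<close> with \<open>b(M) \<noteq> 0\<close> has a multiple whose average over the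
  unitary quaternions does not vanish at \<open>M\<close>. Applied to polynomials vanishing on a closed invariant
  set, this shows that invariant polynomials separate \<open>M\<close> from closed invariant sets, so \<open>\<eta>\<close> is injective
  and its inverse is continuous; applied to the numerator and the denominator of an invariant
  regular function, it shows that the inverse is a morphism.
\<close>

text \<open>Averaging and invariant theory see only the two special linear groups, in the form of
  unit quaternions. The rest of the group multiplies \<open>q = det(\<phi>)\<close> by a scalar and
  \<open>p = e(\<phi>)\<close> by its square, and it is handled algebraically: a quaternion
  invariant is a polynomial in \<open>(q, p)\<close>, and its components of fixed weight are
  compared one at a time. A component of the denominator that survives at the chosen point is
  weighted homogeneous, so it cuts out a basic open set of the weighted projective space.

  The moduli space is known only through the axioms of a good quotient. Points that it identifies
  have the same image under \<eta>, because distinct fibres over the hypersurface are disjoint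
  closed invariant sets. The converse uses that points of a variety are closed, together with the
  special matrices \<open>M\<close>. These play the part of the minimal vectors of Kempf and Ness,
  so no orbit closure has to be computed. Since there is one over every point of the hypersurface,
  they also give surjectivity.\<close>

section \<open>Algebras of polynomial functions\<close>

text \<open>One notion for all the polynomial rings that occur: polynomials in matrix entries, in
  finitely many parameters, and the \<open>poly_funs\<close> of the statement, with the linear
  functionals as generators.\<close>

inductive_set gen_algebra :: "('a \<Rightarrow> complex) set \<Rightarrow> ('a \<Rightarrow> complex) set"
  for G :: "('a \<Rightarrow> complex) set" where
  const: "(\<lambda>_. c) \<in> gen_algebra G"
| gen: "f \<in> G \<Longrightarrow> f \<in> gen_algebra G"
| add: "f \<in> gen_algebra G \<Longrightarrow> g \<in> gen_algebra G \<Longrightarrow> (\<lambda>v. f v + g v) \<in> gen_algebra G"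
| mult: "f \<in> gen_algebra G \<Longrightarrow> g \<in> gen_algebra G \<Longrightarrow> (\<lambda>v. f v * g v) \<in> gen_algebra G"

lemma poly_funs_eq_gen_algebra: "poly_funs s = gen_algebra (dual s)"
proof (intro equalityI subsetI)
  fix f assume "f \<in> poly_funs s" then show "f \<in> gen_algebra (dual s)"
    by (induction rule: poly_funs.induct) (auto intro: gen_algebra.intros)
next
  fix f assume "f \<in> gen_algebra (dual s)" then show "f \<in> poly_funs s"
    by (induction rule: gen_algebra.induct) (auto intro: poly_funs.intros)
qed

lemma gen_algebra_cmult: "f \<in> gen_algebra G \<Longrightarrow> (\<lambda>v. c * f v) \<in> gen_algebra G"
  by (rule gen_algebra.mult[OF gen_algebra.const])

lemma gen_algebra_diff:
  assumes "f \<in> gen_algebra G" "g \<in> gen_algebra G"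
  shows "(\<lambda>v. f v - g v) \<in> gen_algebra G"
  using gen_algebra.add[OF assms(1) gen_algebra_cmult[OF assms(2), of "-1"]] by simp

lemma gen_algebra_sum:
  "(\<And>i. i \<in> I \<Longrightarrow> f i \<in> gen_algebra G) \<Longrightarrow> (\<lambda>v. \<Sum>i\<in>I. f i v) \<in> gen_algebra G"
  by (induction I rule: infinite_finite_induct) (auto intro: gen_algebra.const gen_algebra.add)

lemma gen_algebra_prod:
  "(\<And>i. i \<in> I \<Longrightarrow> f i \<in> gen_algebra G) \<Longrightarrow> (\<lambda>v. \<Prod>i\<in>I. f i v) \<in> gen_algebra G"
  by (induction I rule: infinite_finite_induct) (auto intro: gen_algebra.const gen_algebra.mult)

lemma gen_algebra_power: "f \<in> gen_algebra G \<Longrightarrow> (\<lambda>v. f v ^ n) \<in> gen_algebra G"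
  by (induction n) (auto intro: gen_algebra.const gen_algebra.mult)

lemma gen_algebra_compose:
  assumes "f \<in> gen_algebra G" and "\<And>g. g \<in> G \<Longrightarrow> (\<lambda>x. g (h x)) \<in> gen_algebra G'"
  shows "(\<lambda>x. f (h x)) \<in> gen_algebra G'"
  using assms(1) by induction (auto intro: gen_algebra.intros assms(2))

definition entries :: "(complex^'n^'m \<Rightarrow> complex) set" where
  "entries = {\<lambda>M. M $ i $ j |i j. True}"

lemma entry_in_gen_algebra: "(\<lambda>M. M $ i $ j) \<in> gen_algebra entries"
  by (rule gen_algebra.gen) (auto simp: entries_def)

text \<open>The degree bound does not depend on the line. Interpolation at a fixed set of nodes
  relies on this later.\<close>

lemma gen_algebra_entries_affine_line:
  assumes "P \<in> gen_algebra entries"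
  obtains D where "\<And>A B. \<exists>p. degree p \<le> D \<and> (\<forall>c. P (\<chi> i j. A $ i $ j + c * B $ i $ j) = poly p c)"
proof -
  have "\<exists>D. \<forall>A B. \<exists>p. degree p \<le> D \<and> (\<forall>c. P (\<chi> i j. A $ i $ j + c * B $ i $ j) = poly p c)"
    using assms
  proof induction
    case (const a)
    show ?case by (rule exI[of _ 0], intro allI, rule exI[of _ "[:a:]"]) auto
  next
    case (gen f)
    then obtain i j where f: "f = (\<lambda>M. M $ i $ j)" by (auto simp: entries_def)
    show ?case
      by (rule exI[of _ 1], intro allI, rule_tac x = "[:A $ i $ j, B $ i $ j:]" in exI) (auto simp: f)
  next
    case (add f g)
    then obtain D E where D: "\<forall>A B. \<exists>p. degree p \<le> D \<and> (\<forall>c. f (\<chi> i j. A $ i $ j + c * B $ i $ j) = poly p c)"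
      and E: "\<forall>A B. \<exists>p. degree p \<le> E \<and> (\<forall>c. g (\<chi> i j. A $ i $ j + c * B $ i $ j) = poly p c)" by blast
    show ?case
    proof (intro exI[of _ "max D E"] allI)
      fix A B
      obtain p q where "degree p \<le> D" "\<forall>c. f (\<chi> i j. A $ i $ j + c * B $ i $ j) = poly p c"
        "degree q \<le> E" "\<forall>c. g (\<chi> i j. A $ i $ j + c * B $ i $ j) = poly q c" using D E by metis
      then show "\<exists>p. degree p \<le> max D E \<and>
          (\<forall>c. f (\<chi> i j. A $ i $ j + c * B $ i $ j) + g (\<chi> i j. A $ i $ j + c * B $ i $ j) = poly p c)"
        by (intro exI[of _ "p + q"]) (auto intro: degree_add_le)
    qed
  next
    case (mult f g)
    then obtain D E where D: "\<forall>A B. \<exists>p. degree p \<le> D \<and> (\<forall>c. f (\<chi> i j. A $ i $ j + c * B $ i $ j) = poly p c)"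
      and E: "\<forall>A B. \<exists>p. degree p \<le> E \<and> (\<forall>c. g (\<chi> i j. A $ i $ j + c * B $ i $ j) = poly p c)" by blast
    show ?case
    proof (intro exI[of _ "D + E"] allI)
      fix A B
      obtain p q where "degree p \<le> D" "\<forall>c. f (\<chi> i j. A $ i $ j + c * B $ i $ j) = poly p c"
        "degree q \<le> E" "\<forall>c. g (\<chi> i j. A $ i $ j + c * B $ i $ j) = poly q c" using D E by metis
      then show "\<exists>p. degree p \<le> D + E \<and>
          (\<forall>c. f (\<chi> i j. A $ i $ j + c * B $ i $ j) * g (\<chi> i j. A $ i $ j + c * B $ i $ j) = poly p c)"
        by (intro exI[of _ "p * q"]) (auto intro: order_trans[OF degree_mult_le])
    qed
  qed
  then show ?thesis using that by blast
qed

lemma poly_eq_0_if_vanishes_infinite: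
  fixes p :: "'a::idom poly"
  assumes "infinite S" "\<And>c. c \<in> S \<Longrightarrow> poly p c = 0"
  shows "p = 0"
proof (rule ccontr)
  assume "p \<noteq> 0"
  then have "finite {x. poly p x = 0}" by (rule poly_roots_finite)
  then show False using assms finite_subset[of S "{x. poly p x = 0}"] by blast
qed

lemma infinite_of_real_image:
  assumes "e > 0"
  shows "infinite ((of_real :: real \<Rightarrow> complex) ` {0<..<e})"
  using assms by (subst finite_image_iff) (auto simp: inj_on_def)

definition mat_of_real :: "real^'n^'m \<Rightarrow> complex^'n^'m" where
  "mat_of_real M = (\<chi> i j. of_real (M $ i $ j))"

lemma mat_of_real_nth [simp]: "mat_of_real M $ i $ j = of_real (M $ i $ j)"
  by (simp add: mat_of_real_def)

text \<open>Restricting to lines reduces the claim to one variable twice, from a neighbourhood to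
  all real matrices and from real to complex ones. The hypothesis concerns each direction separately
  and small positive \<open>t\<close> only, so no open set of matrices has to be exhibited.\<close>

lemma gen_algebra_eq_0_if_vanishes_near:
  fixes P :: "complex^'n^'m \<Rightarrow> complex"
  assumes P: "P \<in> gen_algebra entries"
    and near: "\<And>B. \<forall>\<^sub>F t in at_right 0. P (mat_of_real (M0 + t *\<^sub>R B)) = 0"
  shows "P N = 0"
proof -
  obtain D where D: "\<And>A B. \<exists>p. degree p \<le> D \<and> (\<forall>c. P (\<chi> i j. A $ i $ j + c * B $ i $ j) = poly p c)"
    by (rule gen_algebra_entries_affine_line[OF P]) blast
  have real: "P (mat_of_real N) = 0" for N
  proof -
    obtain p where p: "\<And>c. P (\<chi> i j. mat_of_real M0 $ i $ j + c * mat_of_real (N - M0) $ i $ j) = poly p c"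
      using D by metis
    have eq: "(\<chi> i j. mat_of_real M0 $ i $ j + of_real t * mat_of_real (N - M0) $ i $ j)
        = mat_of_real (M0 + t *\<^sub>R (N - M0))" for t
      by (simp add: vec_eq_iff)
    obtain e where "e > 0" "\<And>t. 0 < t \<Longrightarrow> t < e \<Longrightarrow> P (mat_of_real (M0 + t *\<^sub>R (N - M0))) = 0"
      using near[of "N - M0"] unfolding eventually_at_right[OF zero_less_one] by auto
    moreover have "poly p (of_real t) = P (mat_of_real (M0 + t *\<^sub>R (N - M0)))" for t
      by (simp only: p[symmetric] eq)
    ultimately have "poly p (of_real t) = 0" if "t \<in> {0<..<e}" for t
      using that by simp
    then have "p = 0"
      by (intro poly_eq_0_if_vanishes_infinite[OF infinite_of_real_image[OF \<open>e > 0\<close>]]) blast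
    then show ?thesis using p[of 1] by (simp add: mat_of_real_def)
  qed
  \<comment> \<open>A complex matrix lies on the complex line through real matrices \<open>A\<close>
    and \<open>A + B\<close>, at the parameter \<i>.\<close>
  define A B :: "real^'n^'m" where "A = (\<chi> i j. Re (N $ i $ j))" and "B = (\<chi> i j. Im (N $ i $ j))"
  obtain p where p: "\<And>c. P (\<chi> i j. mat_of_real A $ i $ j + c * mat_of_real B $ i $ j) = poly p c"
    using D by metis
  have eq: "(\<chi> i j. mat_of_real A $ i $ j + of_real t * mat_of_real B $ i $ j) = mat_of_real (A + t *\<^sub>R B)" for t
    by (simp add: vec_eq_iff)
  have "poly p (of_real t) = 0" for t by (simp only: p[symmetric] eq real)
  then have "p = 0"
    by (intro poly_eq_0_if_vanishes_infinite[OF infinite_of_real_image[OF zero_less_one]]) blast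
  moreover have "(\<chi> i j. mat_of_real A $ i $ j + \<i> * mat_of_real B $ i $ j) = N"
    by (simp add: vec_eq_iff A_def B_def complex_eq_iff)
  ultimately show ?thesis using p[of \<i>] by simp
qed

section \<open>Reflections and Gram matrices\<close>

text \<open>The reflection in the hyperplane orthogonal to \<open>w\<close>, applied to every
  column: a left multiplication by an orthogonal matrix.\<close>

definition reflect :: "real^'m \<Rightarrow> real^'n^'m \<Rightarrow> real^'n^'m" where
  "reflect w M = (\<chi> i j. M $ i $ j - 2 * (w \<bullet> column j M) / (w \<bullet> w) * w $ i)"

abbreviation gram :: "'a::comm_ring_1^'n^'m \<Rightarrow> 'a^'n^'n" where
  "gram M \<equiv> transpose M ** M"

lemma gram_nth_inner: "gram M $ a $ b = column a M \<bullet> column b M" for M :: "real^'n^'m"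
  by (simp add: matrix_matrix_mult_def transpose_def column_def inner_vec_def)

lemma gram_nth: "gram M $ a $ b = (\<Sum>i\<in>UNIV. M $ i $ a * M $ i $ b)"
  by (simp add: matrix_matrix_mult_def transpose_def)

lemma column_reflect:
  "column j (reflect w M) = column j M - (2 * (w \<bullet> column j M) / (w \<bullet> w)) *\<^sub>R w"
  by (simp add: vec_eq_iff column_def reflect_def)

lemma gram_reflect:
  assumes "w \<noteq> 0"
  shows "gram (reflect w M) = gram M"
proof -
  have "(x - (2 * (w \<bullet> x) / (w \<bullet> w)) *\<^sub>R w) \<bullet> (y - (2 * (w \<bullet> y) / (w \<bullet> w)) *\<^sub>R w) = x \<bullet> y" for x y
    using assms by (simp add: inner_diff_left inner_diff_right inner_commute[of x w])
  then show ?thesis by (simp add: vec_eq_iff gram_nth_inner column_reflect)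
qed

text \<open>The columns of the first matrix are moved onto those of the second one by one: the
  reflection in the difference of two columns fixes the columns that already agree.\<close>

lemma eq_if_gram_eq:
  fixes g :: "real^'n^'m \<Rightarrow> 'b"
  assumes inv: "\<And>w M. w \<noteq> 0 \<Longrightarrow> gram M = Q \<Longrightarrow> g (reflect w M) = g M"
    and "gram M = Q" "gram M' = Q"
  shows "g M = g M'"
proof -
  have "\<exists>M''. g M'' = g M \<and> gram M'' = Q \<and> (\<forall>j\<in>J. column j M'' = column j M')" if "finite J" for J
    using that
  proof (induction J)
    case empty then show ?case using assms(2) by auto
  next
    case (insert j J)
    then obtain N where N: "g N = g M" "gram N = Q" "\<And>k. k \<in> J \<Longrightarrow> column k N = column k M'" by blast
    show ?case
    proof (cases "column j N = column j M'")
      case True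
      with N(3) have "\<forall>k\<in>insert j J. column k N = column k M'" by blast
      with N(1,2) show ?thesis by blast
    next
      case False
      define w where "w = column j N - column j M'"
      have w: "w \<noteq> 0" using False by (simp add: w_def)
      have dot: "column a N \<bullet> column b N = column a M' \<bullet> column b M'" for a b
        unfolding gram_nth_inner[symmetric] N(2) assms(3) ..
      \<comment> \<open>Equal Gram matrices give columns of equal length, and the reflection in the
        difference of two such vectors takes one to the other.\<close>
      have "(x - y) \<bullet> (x - y) = 2 * ((x - y) \<bullet> x)" if "x \<bullet> x = y \<bullet> y" for x y :: "real^'m"
        using that inner_commute[of x y] by (simp add: inner_diff_left inner_diff_right)
      from this[OF dot] have ww: "w \<bullet> w = 2 * (w \<bullet> column j N)" unfolding w_def .
      have "w \<bullet> w \<noteq> 0" using w by simp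
      then have "2 * (w \<bullet> column j N) / (w \<bullet> w) = 1" unfolding ww[symmetric] by (rule divide_self)
      then have "column j (reflect w N) = column j M'"
        by (simp only: column_reflect) (simp add: w_def)
      moreover have "column k (reflect w N) = column k M'" if "k \<in> J" for k
      proof -
        have "w \<bullet> column k N = 0"
          using dot[of j k] by (simp only: w_def inner_diff_left N(3)[OF that])
        then show ?thesis by (simp add: column_reflect N(3)[OF that])
      qed
      moreover have "g (reflect w N) = g M" using inv[OF w N(2)] N(1) by (rule trans)
      moreover have "gram (reflect w N) = Q" using gram_reflect[OF w] N(2) by (rule trans)
      ultimately show ?thesis by blast
    qed
  qed
  from this[of UNIV] obtain M'' where M'': "g M'' = g M" "\<And>j. column j M'' = column j M'" by auto
  from M''(2) have "M'' = M'" by (simp add: vec_eq_iff column_def)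
  then show ?thesis using M''(1) by simp
qed

section \<open>Symmetric polynomials in one variable and interpolation\<close>

text \<open>The involution exchanges the roots 0 and \<open>- 2 / \<beta>\<close> of
  \<open>2 * c + \<beta> * c^2\<close>. So \<open>p - p(0)\<close> vanishes at both, and the
  quotient is again symmetric, of degree smaller by two. As
  \<open>1 + \<beta> * (2 * c + \<beta> * c^2)\<close> is the square of
  \<open>1 + \<beta> * c\<close>, whose sign the involution changes, this says that an even
  polynomial is a polynomial in the square.\<close>

lemma poly_of_shifted_square:
  fixes p :: "complex poly" and \<beta> :: complex
  assumes "\<beta> \<noteq> 0" and "\<And>c. poly p c = poly p (- 2 / \<beta> - c)"
  shows "\<exists>r. degree r \<le> degree p \<and> (\<forall>c. poly p c = poly r (2 * c + \<beta> * c^2))"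
  using assms(2)
proof (induction "degree p" arbitrary: p rule: less_induct)
  case less
  show ?case
  proof (cases "degree p = 0")
    case True
    then obtain a where "p = [:a:]" by (rule degree_eq_zeroE)
    then show ?thesis by (intro exI[of _ "[:a:]"]) auto
  next
    case False
    define p0 where "p0 = p + [:- poly p 0:]"
    have deg0: "degree p0 = degree p"
      unfolding p0_def using False by (intro degree_add_eq_left) simp
    have "poly p0 0 = 0" by (simp add: p0_def)
    then obtain p1 where p1: "p0 = [:0, 1:] * p1"
      using poly_eq_0_iff_dvd[of p0 0] by (auto elim: dvdE)
    have "poly p0 (- 2 / \<beta>) = 0" using less.prems[of 0] by (simp add: p0_def)
    then have "poly p1 (- 2 / \<beta>) = 0" using assms(1) by (simp add: p1)
    then obtain p2 where p2: "p1 = [:2 / \<beta>, 1:] * p2"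
      using poly_eq_0_iff_dvd[of p1 "- 2 / \<beta>"] by (auto elim: dvdE)
    define p3 where "p3 = smult (1 / \<beta>) p2"
    have p: "poly p c = poly p 0 + (2 * c + \<beta> * c^2) * poly p3 c" for c
    proof -
      have "poly p c = poly p 0 + poly p0 c" by (simp add: p0_def)
      also have "poly p0 c = (2 * c + \<beta> * c^2) * poly p3 c"
        using assms(1) by (simp add: p1 p2 p3_def field_simps power2_eq_square)
      finally show ?thesis .
    qed
    have p2nz: "p2 \<noteq> 0" using deg0 False by (auto simp: p1 p2)
    then have "p1 \<noteq> 0" unfolding p2 by (subst mult_eq_0_iff) simp
    then have "degree p0 = 1 + degree p1" unfolding p1 by (subst degree_mult_eq) simp_all
    moreover have "degree p1 = 1 + degree p2" unfolding p2 using p2nz by (subst degree_mult_eq) simp_all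
    ultimately have "degree p0 = degree p2 + 2" by simp
    then have deg3: "degree p3 + 2 \<le> degree p" using deg0 by (simp add: p3_def)
    \<comment> \<open>The factor can be cancelled only away from its two roots; infinitely many
      other points remain, and they decide the identity.\<close>
    have sym: "poly (p3 - p3 \<circ>\<^sub>p [:- 2 / \<beta>, - 1:]) c = 0" if "c \<notin> {0, - 2 / \<beta>}" for c
    proof -
      have "2 * c + \<beta> * c^2 = c * \<beta> * (c - (- 2 / \<beta>))"
        using assms(1) by (simp add: field_simps power2_eq_square)
      moreover have "c - (- 2 / \<beta>) \<noteq> 0" "c \<noteq> 0" using that by (simp_all only: right_minus_eq) auto
      ultimately have nz: "2 * c + \<beta> * c^2 \<noteq> 0" using assms(1) by simp
      have "2 * (- 2 / \<beta> - c) + \<beta> * (- 2 / \<beta> - c)^2 = 2 * c + \<beta> * c^2"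
        using assms(1) by (simp add: field_simps power2_eq_square)
      then have "(2 * c + \<beta> * c^2) * poly p3 c = (2 * c + \<beta> * c^2) * poly p3 (- 2 / \<beta> - c)"
        using less.prems[of c] p[of c] p[of "- 2 / \<beta> - c"] by simp
      then show ?thesis using nz by (simp add: poly_pcompose)
    qed
    have "infinite (- {0, - 2 / \<beta>})"
      by (metis Compl_eq_Diff_UNIV finite.emptyI finite_Diff2 finite_insert infinite_UNIV_char_0)
    then have "p3 - p3 \<circ>\<^sub>p [:- 2 / \<beta>, - 1:] = 0"
      by (rule poly_eq_0_if_vanishes_infinite) (rule sym, blast)
    then have sym3: "p3 = p3 \<circ>\<^sub>p [:- 2 / \<beta>, - 1:]" by simp
    have "poly p3 c = poly p3 (- 2 / \<beta> - c)" for c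
      by (subst (1) sym3) (simp add: poly_pcompose)
    moreover have "degree p3 < degree p" using deg3 by simp
    ultimately obtain r where r: "degree r \<le> degree p3" "\<And>c. poly p3 c = poly r (2 * c + \<beta> * c^2)"
      using less.hyps[of p3] by blast
    have "degree ([:poly p 0:] + [:0, 1:] * r) \<le> degree p"
    proof (intro degree_add_le)
      have "degree ([:0, 1:] * r) \<le> 1 + degree r" by (rule order_trans[OF degree_mult_le]) simp
      then show "degree ([:0, 1:] * r) \<le> degree p" using r(1) deg3 by simp
    qed auto
    moreover have "poly p c = poly ([:poly p 0:] + [:0, 1:] * r) (2 * c + \<beta> * c^2)" for c
      by (subst p) (simp add: r(2))
    ultimately show ?thesis by blast
  qed
qed

text \<open>The explicit formula shows that the coefficients are values at the nodes. For a function
  of several variables these values are functions of the remaining variables, to which induction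
  applies.\<close>

lemma lagrange_interpolation:
  fixes r :: "complex poly"
  assumes "degree r \<le> D"
  shows "poly r x = (\<Sum>i\<le>D. poly r (of_nat i) * (\<Prod>j\<in>{..D} - {i}. (x - of_nat j) / (of_nat i - of_nat j)))"
proof -
  define L where "L i = (\<Prod>j\<in>{..D} - {i}. [:- of_nat j / (of_nat i - of_nat j), 1 / (of_nat i - of_nat j) :: complex:])" for i
  define R where "R = (\<Sum>i\<le>D. smult (poly r (of_nat i)) (L i))"
  have polyL: "poly (L i) x = (\<Prod>j\<in>{..D} - {i}. (x - of_nat j) / (of_nat i - of_nat j))" for i x
    by (simp add: L_def poly_prod diff_divide_distrib)
  have "degree (L i) \<le> D" if "i \<le> D" for i
  proof -
    have "degree (L i) \<le> (\<Sum>j\<in>{..D} - {i}. 1)"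
      unfolding L_def by (rule order_trans[OF degree_prod_sum_le]) (auto intro!: sum_mono degree_pCons_le[THEN order_trans])
    then show ?thesis using that by simp
  qed
  then have degR: "degree R \<le> D"
    unfolding R_def by (intro degree_sum_le) (auto intro: order_trans[OF degree_smult_le])
  have L_node: "poly (L i) (of_nat k) = (if i = k then 1 else 0)" if "i \<le> D" "k \<le> D" for i k
    using that by (auto simp: polyL)
  have "poly R (of_nat k) = poly r (of_nat k)" if that: "k \<le> D" for k
  proof -
    have "poly R (of_nat k) = (\<Sum>i\<le>D. if i = k then poly r (of_nat k) else 0)"
      unfolding R_def poly_sum by (rule sum.cong) (auto simp: L_node that)
    then show ?thesis using that by simp
  qed
  then have "R - r = 0"
  proof -
    assume *: "\<And>k. k \<le> D \<Longrightarrow> poly R (of_nat k) = poly r (of_nat k)"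
    show ?thesis
    proof (rule ccontr)
      assume nz: "R - r \<noteq> 0"
      have "of_nat ` {..D} \<subseteq> {x. poly (R - r) x = 0}" using * by auto
      then have "card (of_nat ` {..D} :: complex set) \<le> card {x. poly (R - r) x = 0}"
        using poly_roots_finite[OF nz] by (rule card_mono[rotated])
      also have "\<dots> \<le> degree (R - r)" by (rule card_poly_roots_bound[OF nz])
      also have "\<dots> \<le> D" using degR assms by (rule degree_diff_le)
      finally show False by (simp add: card_image inj_on_def)
    qed
  qed
  then have "poly r x = poly R x" by simp
  then show ?thesis by (simp add: R_def poly_sum polyL)
qed

text \<open>Interpolation at the nodes \<open>0, \<dots>, D\<close> in one variable after the other.\<close>

lemma separately_polynomial:
  fixes f :: "('i \<Rightarrow> real) \<Rightarrow> complex"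
  assumes "finite J"
    and "\<And>t k. (\<And>i. t i \<ge> 0) \<Longrightarrow> \<exists>r. degree r \<le> D \<and> (\<forall>u\<ge>0. f (t(k := u)) = poly r (of_real u))"
  shows "\<exists>F\<in>gen_algebra (range (\<lambda>k t. t k)). \<forall>t. (\<forall>i. t i \<ge> 0) \<and> (\<forall>i. i \<notin> J \<longrightarrow> t i = 0) \<longrightarrow>
           f t = F (\<lambda>i. of_real (t i))"
  using assms
proof (induction J arbitrary: f)
  case empty
  have "t = (\<lambda>_. 0)" if "\<forall>i. i \<notin> {} \<longrightarrow> t i = 0" for t :: "'i \<Rightarrow> real" using that by auto
  then show ?case by (intro bexI[OF _ gen_algebra.const[of "f (\<lambda>_. 0)"]]) metis
next
  case (insert k J)
  define h where "h i t = f (t(k := real i))" for i t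
  have "\<exists>F\<in>gen_algebra (range (\<lambda>k t. t k)). \<forall>t. (\<forall>i. t i \<ge> 0) \<and> (\<forall>i. i \<notin> J \<longrightarrow> t i = 0) \<longrightarrow>
           h i t = F (\<lambda>i. of_real (t i))" for i
  proof (rule insert.IH)
    fix t :: "'i \<Rightarrow> real" and l assume t: "\<And>i. t i \<ge> 0"
    show "\<exists>r. degree r \<le> D \<and> (\<forall>u\<ge>0. h i (t(l := u)) = poly r (of_real u))"
    proof (cases "l = k")
      case True
      then show ?thesis by (intro exI[of _ "[:f (t(k := real i)):]"]) (auto simp: h_def)
    next
      case False
      have "(t(k := real i)) j \<ge> 0" for j using t by simp
      from insert.prems[of "t(k := real i)" l, OF this] obtain r where "degree r \<le> D"
        "\<And>u. u \<ge> 0 \<Longrightarrow> f ((t(k := real i))(l := u)) = poly r (of_real u)" by blast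
      then show ?thesis using False by (intro exI[of _ r]) (auto simp: h_def fun_upd_twist)
    qed
  qed
  then have "\<exists>F. \<forall>i. F i \<in> gen_algebra (range (\<lambda>k t. t k)) \<and>
      (\<forall>t. (\<forall>i. t i \<ge> 0) \<and> (\<forall>i. i \<notin> J \<longrightarrow> t i = 0) \<longrightarrow> h i t = F i (\<lambda>i. of_real (t i)))"
    by (intro choice) blast
  then obtain F where F: "\<And>i. F i \<in> gen_algebra (range (\<lambda>k t. t k))"
    "\<And>i t. (\<And>i. t i \<ge> 0) \<Longrightarrow> (\<And>i. i \<notin> J \<Longrightarrow> t i = 0) \<Longrightarrow> h i t = F i (\<lambda>i. of_real (t i))" by blast
  \<comment> \<open>Lagrange's formula in the variable \<open>k\<close>. The coefficients
    \<open>F i\<close> are evaluated with that variable reset to 0, because the induction hypothesis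
    describes \<open>h i\<close> only where \<open>t k = 0\<close>.\<close>
  define G where "G t = (\<Sum>i\<le>D. F i (t(k := 0)) *
      (\<Prod>j\<in>{..D} - {i}. (1 / (of_nat i - of_nat j)) * (t k - of_nat j)))" for t :: "'i \<Rightarrow> complex"
  show ?case
  proof (intro bexI[of _ G] allI impI)
    have coord: "(\<lambda>t :: 'i \<Rightarrow> complex. t l) \<in> gen_algebra (range (\<lambda>k t. t k))" for l
      by (rule gen_algebra.gen) auto
    have "(\<lambda>t. F i (t(k := 0))) \<in> gen_algebra (range (\<lambda>k t. t k))" for i
    proof (rule gen_algebra_compose[OF F(1)])
      fix g :: "('i \<Rightarrow> complex) \<Rightarrow> complex" assume "g \<in> range (\<lambda>k t. t k)"
      then obtain l where "g = (\<lambda>t. t l)" by auto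
      then show "(\<lambda>t. g (t(k := 0))) \<in> gen_algebra (range (\<lambda>k t. t k))"
        using coord gen_algebra.const[of 0] by (cases "l = k") auto
    qed
    then show "G \<in> gen_algebra (range (\<lambda>k t. t k))"
      unfolding G_def
      by (intro gen_algebra_sum gen_algebra.mult gen_algebra_prod gen_algebra_cmult gen_algebra_diff
          coord gen_algebra.const)
    fix t :: "'i \<Rightarrow> real" assume t: "(\<forall>i. t i \<ge> 0) \<and> (\<forall>i. i \<notin> insert k J \<longrightarrow> t i = 0)"
    obtain r where r: "degree r \<le> D" "\<And>u. u \<ge> 0 \<Longrightarrow> f (t(k := u)) = poly r (of_real u)"
      using insert.prems[of t k] t by blast
    have node: "poly r (of_nat i) = F i ((\<lambda>i. of_real (t i))(k := 0))" for i
    proof -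
      have "poly r (of_nat i) = h i (t(k := 0))" using r(2)[of "real i"] by (simp add: h_def)
      also have "\<dots> = F i (\<lambda>l. of_real ((t(k := 0)) l))" using t by (intro F(2)) auto
      also have "(\<lambda>l. of_real ((t(k := 0)) l)) = (\<lambda>i. of_real (t i) :: complex)(k := 0)" by auto
      finally show ?thesis .
    qed
    have "f t = poly r (of_real (t k))" using r(2)[of "t k"] t by simp
    also have "\<dots> = G (\<lambda>i. of_real (t i))"
      by (subst lagrange_interpolation[OF r(1)]) (simp add: G_def node)
    finally show "f t = G (\<lambda>i. of_real (t i))" .
  qed
qed

section \<open>Rank one deformations of real matrices\<close>

definition stretch :: "real \<Rightarrow> real^'m \<Rightarrow> real^'n^'m \<Rightarrow> real^'n^'m" where
  "stretch c v M = (\<chi> i j. M $ i $ j + c * (v $ i * (v \<bullet> column j M)))"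

lemma reflect_eq_stretch: "reflect w M = stretch (- 2 / (w \<bullet> w)) w M"
  by (simp add: reflect_def stretch_def vec_eq_iff)

lemma column_stretch: "column j (stretch c v M) = column j M + (c * (v \<bullet> column j M)) *\<^sub>R v"
  by (simp add: vec_eq_iff column_def stretch_def)

text \<open>The square of \<open>v v\<^sup>T\<close> is \<open>v \<bullet> v\<close> times itself,
  so the square of \<open>1 + c v v\<^sup>T\<close> is
  \<open>1 + (2 c + (v \<bullet> v) c\<^sup>2) v v\<^sup>T\<close>.\<close>

lemma gram_stretch:
  "gram (stretch c v M) $ a $ b =
     gram M $ a $ b + (2 * c + (v \<bullet> v) * c^2) * ((v \<bullet> column a M) * (v \<bullet> column b M))"
proof -
  have "(x + (c * (v \<bullet> x)) *\<^sub>R v) \<bullet> (y + (c * (v \<bullet> y)) *\<^sub>R v)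
      = x \<bullet> y + (2 * c + (v \<bullet> v) * c^2) * ((v \<bullet> x) * (v \<bullet> y))" for x y
    using inner_commute[of x v] by (simp add: inner_add_left inner_add_right algebra_simps power2_eq_square)
  then show ?thesis by (simp only: gram_nth_inner column_stretch)
qed

text \<open>Stretching multiplies the direction of \<open>v\<close> by
  \<open>1 + c * (v \<bullet> v)\<close> and fixes its orthogonal complement. The reflection changes
  the sign of this factor, which amounts to the stated change of \<open>c\<close>.\<close>

lemma reflect_stretch:
  assumes "v \<noteq> 0"
  shows "reflect v (stretch c v M) = stretch (- 2 / (v \<bullet> v) - c) v M"
proof -
  have "v \<bullet> column j (stretch c v M) = (1 + c * (v \<bullet> v)) * (v \<bullet> column j M)" for j
    by (simp add: column_stretch inner_add_right algebra_simps)
  then have "reflect v (stretch c v M) $ i $ j =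
      M $ i $ j + c * (v $ i * (v \<bullet> column j M)) - 2 * ((1 + c * (v \<bullet> v)) * (v \<bullet> column j M)) / (v \<bullet> v) * v $ i" for i j
    by (simp add: reflect_def) (simp add: stretch_def)
  moreover have "v \<bullet> v \<noteq> 0" using assms by simp
  ultimately show ?thesis by (simp add: vec_eq_iff stretch_def field_simps)
qed

lemma det_ne_0_iff_ker: "det M \<noteq> 0 \<longleftrightarrow> (\<forall>x. M *v x = 0 \<longrightarrow> x = 0)" for M :: "real^'n^'n"
  by (simp only: invertible_det_nz[symmetric] invertible_left_inverse matrix_left_invertible_ker)

text \<open>For nonnegative \<open>c\<close> the matrix \<open>1 + c v v\<^sup>T\<close> is positive
  definite, so multiplying by it creates no kernel.\<close>

lemma det_stretch_ne_0:
  fixes M :: "real^'n^'n"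
  assumes "det M \<noteq> 0" "c \<ge> 0"
  shows "det (stretch c v M) \<noteq> 0"
proof -
  have mult: "stretch c v M *v x = M *v x + (c * (v \<bullet> (M *v x))) *\<^sub>R v" for x
  proof -
    have "v \<bullet> (M *v x) = (\<Sum>j\<in>UNIV. (v \<bullet> column j M) * x $ j)"
      by (simp add: matrix_mult_sum[of M x] inner_sum_right mult.commute scalar_mult_eq_scaleR)
    then show ?thesis
      by (simp add: vec_eq_iff stretch_def matrix_vector_mult_def sum.distrib[symmetric] sum_distrib_left algebra_simps)
  qed
  have "x = 0" if "stretch c v M *v x = 0" for x
  proof -
    define y where "y = M *v x"
    have "y + (c * (v \<bullet> y)) *\<^sub>R v = 0" using that mult y_def by simp
    then have "y \<bullet> (y + (c * (v \<bullet> y)) *\<^sub>R v) = 0" by simp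
    then have "y \<bullet> y + c * (v \<bullet> y)^2 = 0"
      by (simp add: inner_add_right inner_commute[of y v] power2_eq_square)
    moreover have "c * (v \<bullet> y)^2 \<ge> 0" using assms(2) by simp
    ultimately have "y \<bullet> y \<le> 0" by linarith
    then have "y = 0" by (metis inner_gt_zero_iff not_le)
    then show "x = 0" using assms(1) unfolding det_ne_0_iff_ker y_def by blast
  qed
  then show ?thesis unfolding det_ne_0_iff_ker by blast
qed

lemma ex_transpose_mult_eq:
  fixes M :: "real^'n^'n"
  assumes "det M \<noteq> 0"
  obtains v where "\<And>j. v \<bullet> column j M = u $ j"
proof -
  have "det (transpose M) \<noteq> 0" using assms by simp
  then obtain B where "transpose M ** B = mat 1"
    using invertible_det_nz invertible_right_inverse by blast
  then have "transpose M *v (B *v u) = u" by (simp add: matrix_vector_mul_assoc)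
  then have "(B *v u) \<bullet> column j M = u $ j" for j
    by (metis (no_types, lifting) inner_commute matrix_vector_mul_component row_def row_transpose vec_lambda_eta)
  then show ?thesis using that by blast
qed

text \<open>Take \<open>v\<close> with \<open>transpose M *v v = u\<close>; then stretching along
  \<open>v\<close> adds a multiple of \<open>u u\<^sup>T\<close> to the Gram matrix. With
  \<open>\<beta> = v \<bullet> v\<close>, the multiple \<open>x\<close> is reached at the
  nonnegative root \<open>c = (sqrt (1 + \<beta> * x) - 1) / \<beta>\<close>. The vector
  \<open>v\<close> is chosen before \<open>x\<close>, so all updates in the direction
  \<open>u\<close> lie on a single line of stretchings.\<close>

lemma rank_one_update:
  fixes M :: "real^'n^'n"
  assumes M: "det M \<noteq> 0" and u: "u \<noteq> 0"
  obtains v where "v \<noteq> 0"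
    "\<And>x. x \<ge> 0 \<Longrightarrow> \<exists>c\<ge>0. 2 * c + (v \<bullet> v) * c^2 = x \<and> det (stretch c v M) \<noteq> 0 \<and>
        (\<forall>a b. gram (stretch c v M) $ a $ b = gram M $ a $ b + x * (u $ a * u $ b))"
proof -
  obtain v where v: "\<And>j. v \<bullet> column j M = u $ j" by (rule ex_transpose_mult_eq[OF M, of u]) blast
  have v0: "v \<noteq> 0" using u v by (metis inner_zero_left vec_eq_iff zero_index)
  have "\<exists>c\<ge>0. 2 * c + (v \<bullet> v) * c^2 = x" if "x \<ge> 0" for x
  proof -
    define \<beta> where "\<beta> = v \<bullet> v"
    have \<beta>: "\<beta> > 0" using v0 by (simp add: \<beta>_def)
    define r where "r = sqrt (1 + \<beta> * x)"
    have r: "r^2 = 1 + \<beta> * x" "r \<ge> 1" using \<beta> that by (simp_all add: r_def)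
    have "2 * ((r - 1) / \<beta>) + \<beta> * ((r - 1) / \<beta>)^2 = (r^2 - 1) / \<beta>"
      using \<beta> by (simp add: field_simps power2_eq_square)
    also have "\<dots> = x" using \<beta> r(1) by simp
    finally show ?thesis using \<beta> r(2) unfolding \<beta>_def[symmetric] by (intro exI[of _ "(r - 1) / \<beta>"]) auto
  qed
  then show ?thesis
    using that[OF v0] det_stretch_ne_0[OF M] gram_stretch[of _ v M] v by metis
qed

lemma det_gram: "det (gram M) = (det M)^2" for M :: "'a::comm_ring_1^'n^'n"
  by (simp add: det_mul power2_eq_square)

lemma mat_of_real_gram: "gram (mat_of_real M) = mat_of_real (gram M)"
  by (simp add: vec_eq_iff gram_nth)

lemma det_mat_of_real: "det (mat_of_real M) = of_real (det M)"
  by (simp add: det_def)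

text \<open>The rank one matrices \<open>u u\<^sup>T\<close>, for \<open>u\<close> a sum of two unit vectors, span the
  symmetric matrices, so their nonnegative combinations shifted by the identity contain an open
  set of symmetric matrices. Each summand is added to a Gram matrix by one stretching.\<close>

definition gram_dir :: "'n::finite \<times> 'n \<Rightarrow> real^'n" where
  "gram_dir k = (\<chi> c. of_bool (c = fst k) + of_bool (c = snd k))"

definition gram_comb :: "('n::finite \<times> 'n) set \<Rightarrow> ('n \<times> 'n \<Rightarrow> real) \<Rightarrow> real^'n^'n" where
  "gram_comb J t = (\<chi> c d. of_bool (c = d) + (\<Sum>k\<in>J. t k * (gram_dir k $ c * gram_dir k $ d)))"

lemma gram_dir_ne_0: "gram_dir k \<noteq> 0"
proof -
  have "gram_dir k $ fst k \<noteq> 0" by (simp add: gram_dir_def)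
  then show ?thesis by (metis zero_index)
qed

lemma ex_gram_comb:
  fixes t :: "'n::finite \<times> 'n \<Rightarrow> real"
  assumes "finite J" "\<And>k. t k \<ge> 0"
  shows "\<exists>M::real^'n^'n. det M \<noteq> 0 \<and> gram M = gram_comb J t"
  using assms(1)
proof induction
  case empty
  show ?case
  proof (intro exI conjI)
    show "gram (mat 1 :: real^'n^'n) = gram_comb {} t"
      by (simp add: transpose_mat) (simp add: gram_comb_def vec_eq_iff mat_def)
  qed simp
next
  case (insert k J)
  then obtain M :: "real^'n^'n" where M: "det M \<noteq> 0" "gram M = gram_comb J t" by blast
  obtain v where "\<And>x. x \<ge> 0 \<Longrightarrow> \<exists>c\<ge>0. 2 * c + (v \<bullet> v) * c^2 = x \<and> det (stretch c v M) \<noteq> 0 \<and>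
        (\<forall>a b. gram (stretch c v M) $ a $ b = gram M $ a $ b + x * (gram_dir k $ a * gram_dir k $ b))"
    using rank_one_update[OF M(1) gram_dir_ne_0] by metis
  from this[OF assms(2)[of k]] obtain c where c: "det (stretch c v M) \<noteq> 0"
    "\<And>a b. gram (stretch c v M) $ a $ b = gram M $ a $ b + t k * (gram_dir k $ a * gram_dir k $ b)" by blast
  have "gram (stretch c v M) = gram_comb (insert k J) t"
    unfolding vec_eq_iff c(2) M(2) using insert.hyps by (simp add: gram_comb_def)
  with c(1) show ?case by blast
qed

text \<open>Solves \<open>gram_comb UNIV t = Q\<close> for symmetric \<open>Q\<close>. An entry off
  the diagonal receives equal contributions from \<open>(a, b)\<close> and \<open>(b, a)\<close>,
  hence the half. A diagonal direction is twice a unit vector, hence the quarter, after removal of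
  the identity and of the contributions of the mixed directions.\<close>

definition gram_coord :: "'a::field^'n^'n::finite \<Rightarrow> 'n \<times> 'n \<Rightarrow> 'a" where
  "gram_coord Q = (\<lambda>(a, b). if a = b then (Q $ a $ a - 1 - (\<Sum>c\<in>UNIV - {a}. Q $ a $ c)) / 4 else Q $ a $ b / 2)"

lemma gram_comb_gram_coord:
  fixes Q :: "real^'n^'n"
  assumes "\<And>a b. Q $ a $ b = Q $ b $ a"
  shows "gram_comb UNIV (gram_coord Q) = Q"
proof -
  define t where "t a b = gram_coord Q (a, b)" for a b
  have t: "t a b = t b a" for a b using assms[of a b] by (simp add: t_def gram_coord_def)
  have pick: "(\<Sum>a\<in>UNIV. F a * (of_bool (c = a) * of_bool (d = a))) = of_bool (c = d) * F c" for F :: "'n \<Rightarrow> real" and c d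
  proof -
    have "(\<Sum>a\<in>UNIV. F a * (of_bool (c = a) * of_bool (d = a))) = (\<Sum>a\<in>UNIV. if a = c then of_bool (c = d) * F c else 0)"
      by (intro sum.cong) auto
    then show ?thesis by simp
  qed
  have pick2: "(\<Sum>a\<in>UNIV. \<Sum>b\<in>UNIV. t a b * (of_bool (c = a) * of_bool (d = b))) = t c d" for c d
  proof -
    have "(\<Sum>a\<in>UNIV. \<Sum>b\<in>UNIV. t a b * (of_bool (c = a) * of_bool (d = b)))
        = (\<Sum>a\<in>UNIV. if a = c then (\<Sum>b\<in>UNIV. if b = d then t c d else 0) else 0)"
      by (intro sum.cong refl) (auto intro!: sum.cong)
    then show ?thesis by simp
  qed
  have row: "(\<Sum>a\<in>UNIV. \<Sum>b\<in>UNIV. t a b * (of_bool (c = a) * of_bool (d = a))) = of_bool (c = d) * (\<Sum>b\<in>UNIV. t c b)" for c d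
    by (simp only: sum_distrib_right[symmetric] pick)
  have col: "(\<Sum>a\<in>UNIV. \<Sum>b\<in>UNIV. t a b * (of_bool (c = b) * of_bool (d = b))) = of_bool (c = d) * (\<Sum>b\<in>UNIV. t c b)" for c d
    by (subst sum.swap) (simp only: t[of _ c] sum_distrib_right[symmetric] pick)
  have rowsum: "(\<Sum>b\<in>UNIV. t c b) = t c c + (\<Sum>b\<in>UNIV - {c}. Q $ c $ b) / 2" for c
  proof -
    have "(\<Sum>b\<in>UNIV. t c b) = t c c + (\<Sum>b\<in>UNIV - {c}. t c b)" by (rule sum.remove) auto
    also have "(\<Sum>b\<in>UNIV - {c}. t c b) = (\<Sum>b\<in>UNIV - {c}. Q $ c $ b / 2)"
      by (rule sum.cong) (auto simp: t_def gram_coord_def)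
    finally show ?thesis by (simp add: sum_divide_distrib)
  qed
  have "gram_comb UNIV (gram_coord Q) $ c $ d = Q $ c $ d" for c d
  proof -
    have "(\<Sum>k\<in>UNIV. gram_coord Q k * (gram_dir k $ c * gram_dir k $ d))
        = (\<Sum>a\<in>UNIV. \<Sum>b\<in>UNIV. t a b * (gram_dir (a, b) $ c * gram_dir (a, b) $ d))"
      unfolding UNIV_Times_UNIV[symmetric] by (subst sum.cartesian_product) (simp add: case_prod_unfold t_def)
    also have "\<dots> = (\<Sum>a\<in>UNIV. \<Sum>b\<in>UNIV. t a b * (of_bool (c = a) * of_bool (d = a)) + t a b * (of_bool (c = a) * of_bool (d = b))
        + t a b * (of_bool (d = a) * of_bool (c = b)) + t a b * (of_bool (c = b) * of_bool (d = b)))"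
      by (simp add: gram_dir_def algebra_simps)
    also have "\<dots> = 2 * of_bool (c = d) * (\<Sum>b\<in>UNIV. t c b) + 2 * t c d"
      unfolding sum.distrib row col pick2 using t[of c d] by simp
    finally have "gram_comb UNIV (gram_coord Q) $ c $ d = of_bool (c = d) * (1 + 2 * (\<Sum>b\<in>UNIV. t c b)) + 2 * t c d"
      by (simp add: gram_comb_def)
    then show ?thesis unfolding rowsum by (cases "c = d") (simp_all add: t_def gram_coord_def field_simps)
  qed
  then show ?thesis by (simp add: vec_eq_iff)
qed

lemma gram_comb_gram_coord_gram: "gram_comb UNIV (gram_coord (gram M)) = gram M" for M :: "real^'n^'n"
  by (rule gram_comb_gram_coord) (simp add: gram_nth_inner inner_commute)

text \<open>Nonnegative coordinates are realised by a nonsingular matrix, and the Gram matrix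
  determines the square of the determinant.\<close>

lemma det_ne_0_if_gram_coord_nonneg:
  fixes M :: "real^'n^'n"
  assumes "\<And>k. gram_coord (gram M) k \<ge> 0"
  shows "det M \<noteq> 0"
proof -
  have "\<exists>M'::real^'n^'n. det M' \<noteq> 0 \<and> gram M' = gram_comb UNIV (gram_coord (gram M))"
    using ex_gram_comb[OF finite assms] .
  then obtain M' :: "real^'n^'n" where "det M' \<noteq> 0" "gram M' = gram M"
    unfolding gram_comb_gram_coord_gram by blast
  then show ?thesis using det_gram[of M] det_gram[of M'] by auto
qed

section \<open>Invariants of the orthogonal group\<close>

text \<open>The function \<open>g\<close> factors through the Gram matrix, and the factored function
  is a polynomial of bounded degree along each rank one direction. The hypotheses speak of
  nonsingular matrices so that \<open>g\<close> may also be the quotient of a polynomial by the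
  determinant.\<close>

lemma polynomial_in_gram:
  fixes g :: "real^'n^'n \<Rightarrow> complex"
  assumes refl: "\<And>w M. w \<noteq> 0 \<Longrightarrow> det M \<noteq> 0 \<Longrightarrow> g (reflect w M) = g M"
    and line: "\<And>M v. det M \<noteq> 0 \<Longrightarrow> v \<noteq> 0 \<Longrightarrow>
      \<exists>r. degree r \<le> D \<and> (\<forall>c\<ge>0. g (stretch c v M) = poly r (of_real (2 * c + (v \<bullet> v) * c^2)))"
  shows "\<exists>F\<in>gen_algebra entries. \<forall>M. (\<forall>k. gram_coord (gram M) k \<ge> 0) \<longrightarrow> g M = F (mat_of_real (gram M))"
proof -
  define f where "f t = g (SOME M. det M \<noteq> 0 \<and> gram M = gram_comb UNIV t)" for t
  \<comment> \<open>The choice hidden in \<open>f\<close> is harmless: all matrices with this Gram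
    matrix are nonsingular and are connected by reflections.\<close>
  have f: "f t = g M" if "\<And>k. t k \<ge> 0" "gram M = gram_comb UNIV t" for t M
  proof -
    have ex: "\<exists>M::real^'n^'n. det M \<noteq> 0 \<and> gram M = gram_comb UNIV t"
      using ex_gram_comb[OF finite that(1)] .
    define M1 :: "real^'n^'n" where "M1 = (SOME M. det M \<noteq> 0 \<and> gram M = gram_comb UNIV t)"
    have M1: "det M1 \<noteq> 0" "gram M1 = gram_comb UNIV t" using someI_ex[OF ex] by (auto simp: M1_def)
    have nz: "det M' \<noteq> 0" if "gram M' = gram_comb UNIV t" for M' :: "real^'n^'n"
      using det_gram[of M'] det_gram[of M1] M1 that by auto
    have "g M1 = g M"
      by (rule eq_if_gram_eq[where Q = "gram_comb UNIV t"]) (use refl nz M1 that in auto)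
    then show ?thesis by (simp add: f_def M1_def)
  qed
  have "\<exists>r. degree r \<le> D \<and> (\<forall>x\<ge>0. f (t(k := x)) = poly r (of_real x))" if t: "\<And>k. t k \<ge> 0" for t k
  proof -
    \<comment> \<open>From the value 0 of the coordinate \<open>k\<close>, every other admissible
      value is reached by a stretching with nonnegative factor.\<close>
    define t0 where "t0 = t(k := 0)"
    have t0: "t0 l \<ge> 0" for l using t by (simp add: t0_def)
    have "\<exists>M::real^'n^'n. det M \<noteq> 0 \<and> gram M = gram_comb UNIV t0"
      using ex_gram_comb[OF finite t0] .
    then obtain M :: "real^'n^'n" where M: "det M \<noteq> 0" "gram M = gram_comb UNIV t0" by auto
    obtain v where v: "v \<noteq> 0" "\<And>x. x \<ge> 0 \<Longrightarrow> \<exists>c\<ge>0. 2 * c + (v \<bullet> v) * c^2 = x \<and> det (stretch c v M) \<noteq> 0 \<and>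
        (\<forall>a b. gram (stretch c v M) $ a $ b = gram M $ a $ b + x * (gram_dir k $ a * gram_dir k $ b))"
      by (rule rank_one_update[OF M(1) gram_dir_ne_0[of k]]) (rule that, assumption, blast)
    obtain r where r: "degree r \<le> D" "\<And>c. c \<ge> 0 \<Longrightarrow> g (stretch c v M) = poly r (of_real (2 * c + (v \<bullet> v) * c^2))"
      using line[OF M(1) v(1)] by blast
    have "f (t(k := x)) = poly r (of_real x)" if x: "x \<ge> 0" for x
    proof -
      obtain c where c: "c \<ge> 0" "2 * c + (v \<bullet> v) * c^2 = x"
        "\<And>a b. gram (stretch c v M) $ a $ b = gram M $ a $ b + x * (gram_dir k $ a * gram_dir k $ b)"
        using v(2)[OF x] by blast
      have upd: "gram_comb UNIV (t(k := x)) $ a $ b = gram_comb UNIV t0 $ a $ b + x * (gram_dir k $ a * gram_dir k $ b)" for a b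
        by (simp add: gram_comb_def t0_def sum.remove[of UNIV k])
      have "gram (stretch c v M) = gram_comb UNIV (t(k := x))"
        unfolding vec_eq_iff c(3) upd M(2) by simp
      then have "f (t(k := x)) = g (stretch c v M)" by (rule f[rotated]) (use t x in auto)
      then show ?thesis using r(2)[OF c(1)] c(2) by simp
    qed
    then show ?thesis using r(1) by blast
  qed
  from separately_polynomial[OF finite this, of UNIV]
  obtain F0 where F0: "F0 \<in> gen_algebra (range (\<lambda>k t. t k))"
    "\<And>t. (\<And>k. t k \<ge> 0) \<Longrightarrow> f t = F0 (\<lambda>k. of_real (t k))" by auto
  define F where "F Q = F0 (gram_coord Q)" for Q
  have "F \<in> gen_algebra entries"
    unfolding F_def
  proof (rule gen_algebra_compose[OF F0(1)])
    fix p :: "('n \<times> 'n \<Rightarrow> complex) \<Rightarrow> complex" assume "p \<in> range (\<lambda>k t. t k)"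
    then obtain a b where p: "p = (\<lambda>t. t (a, b))" by auto
    show "(\<lambda>Q. p (gram_coord Q)) \<in> gen_algebra entries"
    proof (cases "a = b")
      case True
      have "(\<lambda>Q. (1 / 4) * (Q $ a $ a - 1 - (\<Sum>c\<in>UNIV - {a}. Q $ a $ c))) \<in> gen_algebra entries"
        by (intro gen_algebra_cmult gen_algebra_diff gen_algebra.const gen_algebra_sum entry_in_gen_algebra)
      then show ?thesis unfolding p gram_coord_def using True by simp
    next
      case False
      then show ?thesis unfolding p gram_coord_def
        using gen_algebra_cmult[OF entry_in_gen_algebra, of "1/2" a b] by simp
    qed
  qed
  moreover have "g M = F (mat_of_real (gram M))" if "\<And>k. gram_coord (gram M) k \<ge> 0" for M
  proof -
    have "g M = f (gram_coord (gram M))"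
      using f[OF that] gram_comb_gram_coord_gram[of M] by simp
    also have "\<dots> = F0 (\<lambda>k. of_real (gram_coord (gram M) k))" by (rule F0(2)[OF that])
    also have "(\<lambda>k. of_real (gram_coord (gram M) k) :: complex) = gram_coord (mat_of_real (gram M))"
      by (auto simp: gram_coord_def fun_eq_iff)
    finally show ?thesis by (simp add: F_def)
  qed
  ultimately show ?thesis by blast
qed

lemma eq_0_if_vanishes_for_large_gram:
  fixes P :: "complex^'n^'n \<Rightarrow> complex"
  assumes P: "P \<in> gen_algebra entries"
    and van: "\<And>M. (\<forall>k. gram_coord (gram M) k \<ge> 0) \<Longrightarrow> P (mat_of_real M) = 0"
  shows "P N = 0"
proof -
  define n where "n = real CARD('n)"
  have n: "n \<ge> 1" using card_gt_0_iff[of "UNIV :: 'n set"] by (simp add: n_def Suc_le_eq)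
  \<comment> \<open>Any interior point of the region would do. Here the Gram matrix is
    \<open>16 n\<^sup>2\<close> times the identity plus \<open>9 n\<close> times the all-one matrix:
    its entries off the diagonal are positive, and the diagonal outweighs their row sums.\<close>
  define M0 :: "real^'n^'n" where "M0 = (\<chi> i j. of_bool (i = j) * (4 * n) + 1)"
  have M0: "gram M0 $ a $ b = of_bool (a = b) * (16 * n^2) + 9 * n" for a b
  proof -
    have "gram M0 $ a $ b = (\<Sum>i\<in>UNIV. (if i = a then of_bool (a = b) * (16 * n^2) + 4 * n else 0) + (if i = b then 4 * n else 0) + 1)"
      unfolding gram_nth M0_def by (intro sum.cong) (auto simp: power2_eq_square algebra_simps)
    then show ?thesis unfolding sum.distrib by (simp add: n_def)
  qed
  have pos: "gram_coord (gram M0) k > 0" for k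
  proof (cases k)
    case (Pair a b)
    show ?thesis
    proof (cases "a = b")
      case True
      have "(\<Sum>c\<in>UNIV - {a}. gram M0 $ a $ c) = (\<Sum>c\<in>UNIV - {a}. 9 * n)"
        by (intro sum.cong) (auto simp: M0)
      also have "\<dots> = (n - 1) * (9 * n)" using n by (simp add: n_def card_Diff_singleton of_nat_diff)
      finally have "4 * gram_coord (gram M0) k = 16 * n^2 + 9 * n - 1 - (n - 1) * (9 * n)"
        using True Pair by (simp add: gram_coord_def M0)
      also have "\<dots> = 7 * n^2 + 18 * n - 1" by (simp add: algebra_simps power2_eq_square)
      finally show ?thesis using n zero_le_power2[of n] by linarith
    next
      case False
      then show ?thesis using n Pair by (simp add: gram_coord_def M0)
    qed
  qed
  have "\<forall>\<^sub>F t in at_right 0. P (mat_of_real (M0 + t *\<^sub>R B)) = 0" for B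
  proof -
    have entry: "((\<lambda>t. gram (M0 + t *\<^sub>R B) $ a $ b) \<longlongrightarrow> gram M0 $ a $ b) (at_right 0)" for a b
      unfolding gram_nth vector_add_component vector_scaleR_component
      by (rule tendsto_eq_intros refl | simp)+
    have lim: "((\<lambda>t. gram_coord (gram (M0 + t *\<^sub>R B)) k) \<longlongrightarrow> gram_coord (gram M0) k) (at_right 0)" for k
      unfolding gram_coord_def by (cases k) (auto intro!: tendsto_intros entry)
    have "\<forall>\<^sub>F t in at_right 0. \<forall>k. gram_coord (gram (M0 + t *\<^sub>R B)) k > 0"
      by (rule eventually_all_finite) (rule order_tendstoD(1)[OF lim pos])
    then show ?thesis by (rule eventually_mono) (auto intro!: van less_imp_le)
  qed
  then show ?thesis by (rule gen_algebra_eq_0_if_vanishes_near[OF P])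
qed

lemma stretch_line_poly:
  fixes P :: "complex^'n^'m \<Rightarrow> complex"
  assumes "P \<in> gen_algebra entries"
  obtains D where "\<And>M v. \<exists>p. degree p \<le> D \<and> (\<forall>c. P (mat_of_real (stretch c v M)) = poly p (of_real c))"
proof -
  obtain D where D: "\<And>A B. \<exists>p. degree p \<le> D \<and> (\<forall>c. P (\<chi> i j. A $ i $ j + c * B $ i $ j) = poly p c)"
    by (rule gen_algebra_entries_affine_line[OF assms]) blast
  have "\<exists>p. degree p \<le> D \<and> (\<forall>c. P (mat_of_real (stretch c v M)) = poly p (of_real c))" for M v
  proof -
    define B where "B = (\<chi> i j. v $ i * (v \<bullet> column j M))"
    obtain p where p: "degree p \<le> D" "\<And>c. P (\<chi> i j. mat_of_real M $ i $ j + c * mat_of_real B $ i $ j) = poly p c"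
      using D by metis
    have "(\<chi> i j. mat_of_real M $ i $ j + of_real c * mat_of_real B $ i $ j) = mat_of_real (stretch c v M)" for c
      by (simp add: vec_eq_iff stretch_def B_def)
    then show ?thesis using p(1) p(2)[of "of_real _"] by metis
  qed
  then show ?thesis using that by blast
qed

lemma poly_eq_if_eq_on_reals:
  fixes p q :: "complex poly"
  assumes "\<And>c. poly p (of_real c) = poly q (of_real c)"
  shows "p = q"
proof -
  have "p - q = 0"
    by (rule poly_eq_0_if_vanishes_infinite[OF infinite_of_real_image[OF zero_less_one]]) (use assms in auto)
  then show ?thesis by simp
qed

lemma det_in_gen_algebra: "det \<in> gen_algebra entries"
proof -
  have "(\<lambda>A. \<Sum>p\<in>{p. p permutes UNIV}. of_int (sign p) * (\<Prod>i\<in>UNIV. A $ i $ p i)) \<in> gen_algebra entries"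
    by (intro gen_algebra_sum gen_algebra_cmult gen_algebra_prod entry_in_gen_algebra)
  then show ?thesis by (simp add: det_def[abs_def])
qed

lemma gram_entry_in_gen_algebra:
  "(\<lambda>M. gram M $ a $ b) \<in> gen_algebra entries"
  unfolding gram_nth by (intro gen_algebra_sum gen_algebra.mult entry_in_gen_algebra)

lemma compose_gram_in_gen_algebra:
  assumes "F \<in> gen_algebra entries"
  shows "(\<lambda>M. F (gram M)) \<in> gen_algebra entries"
  using assms
proof (rule gen_algebra_compose)
  fix g :: "complex^'n^'n \<Rightarrow> complex" assume "g \<in> entries"
  then obtain a b where "g = (\<lambda>M. M $ a $ b)" by (auto simp: entries_def)
  then show "(\<lambda>M. g (gram M)) \<in> gen_algebra entries" by (simp only: gram_entry_in_gen_algebra)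
qed

lemma poly_reflection_invariant:
  fixes p :: "complex poly"
  assumes v: "v \<noteq> 0" and sym: "\<And>c. poly p (of_real c) = poly p (of_real (- 2 / (v \<bullet> v) - c))"
  shows "\<exists>r. degree r \<le> degree p \<and> (\<forall>c. poly p (of_real c) = poly r (of_real (2 * c + (v \<bullet> v) * c^2)))"
proof -
  define \<beta> :: complex where "\<beta> = of_real (v \<bullet> v)"
  have \<beta>: "\<beta> \<noteq> 0" using v by (simp add: \<beta>_def)
  have "poly p (of_real c) = poly (p \<circ>\<^sub>p [:- 2 / \<beta>, - 1:]) (of_real c)" for c
    unfolding sym[of c] by (simp add: poly_pcompose \<beta>_def)
  then have psym: "p = p \<circ>\<^sub>p [:- 2 / \<beta>, - 1:]" by (rule poly_eq_if_eq_on_reals)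
  have "poly p c = poly p (- 2 / \<beta> - c)" for c by (subst (1) psym) (simp add: poly_pcompose)
  from poly_of_shifted_square[OF \<beta> this] show ?thesis by (auto simp: \<beta>_def)
qed

text \<open>The first fundamental theorem for the orthogonal group acting on as many vectors as the
  dimension. The formula is found for real matrices with nonnegative Gram coordinates, and these are
  Zariski dense among the complex matrices.\<close>

theorem orthogonal_invariant_polynomial:
  fixes P :: "complex^'n^'n \<Rightarrow> complex"
  assumes P: "P \<in> gen_algebra entries"
    and inv: "\<And>w M. w \<noteq> 0 \<Longrightarrow> P (mat_of_real (reflect w M)) = P (mat_of_real M)"
  shows "\<exists>F\<in>gen_algebra entries. \<forall>M. P M = F (gram M)"
proof -
  obtain D where D: "\<And>M v. \<exists>p. degree p \<le> D \<and> (\<forall>c. P (mat_of_real (stretch c v M)) = poly p (of_real c))"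
    by (rule stretch_line_poly[OF P]) blast
  have "\<exists>r. degree r \<le> D \<and> (\<forall>c\<ge>0. P (mat_of_real (stretch c v M)) = poly r (of_real (2 * c + (v \<bullet> v) * c^2)))"
    if v: "v \<noteq> 0" for M v
  proof -
    obtain p where p: "degree p \<le> D" "\<And>c. P (mat_of_real (stretch c v M)) = poly p (of_real c)" using D by blast
    have "poly p (of_real c) = poly p (of_real (- 2 / (v \<bullet> v) - c))" for c
      unfolding p(2)[symmetric] reflect_stretch[OF v, symmetric] by (rule inv[OF v, symmetric])
    from poly_reflection_invariant[OF v this] obtain r where
      "degree r \<le> degree p" "\<And>c. poly p (of_real c) = poly r (of_real (2 * c + (v \<bullet> v) * c^2))" by blast
    then show ?thesis unfolding p(2) using p(1) order_trans by blast
  qed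
  then have "\<exists>F\<in>gen_algebra entries. \<forall>M. (\<forall>k. gram_coord (gram M) k \<ge> 0) \<longrightarrow> P (mat_of_real M) = F (mat_of_real (gram M))"
    by (intro polynomial_in_gram[where D = D]) (use inv in auto)
  then obtain F where F: "F \<in> gen_algebra entries"
    "\<And>M. (\<And>k. gram_coord (gram M) k \<ge> 0) \<Longrightarrow> P (mat_of_real M) = F (mat_of_real (gram M))" by blast
  have "P M - F (gram M) = 0" for M
  proof (rule eq_0_if_vanishes_for_large_gram[of "\<lambda>M. P M - F (gram M)"])
    show "(\<lambda>M. P M - F (gram M)) \<in> gen_algebra entries"
      by (intro gen_algebra_diff P compose_gram_in_gen_algebra F(1))
    fix M :: "real^'n^'n" assume "\<forall>k. gram_coord (gram M) k \<ge> 0"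
    then have "P (mat_of_real M) = F (gram (mat_of_real M))" unfolding mat_of_real_gram by (intro F(2)) blast
    then show "P (mat_of_real M) - F (gram (mat_of_real M)) = 0" by simp
  qed
  then have "P M = F (gram M)" for M by (metis eq_iff_diff_eq_0)
  then show ?thesis using F(1) by blast
qed

section \<open>Polynomials that change sign under reflections\<close>

lemma det_4:
  "det (A::'a::comm_ring_1^4^4) =
    A$1$1 * A$2$2 * A$3$3 * A$4$4 - A$1$1 * A$2$2 * A$3$4 * A$4$3 - A$1$1 * A$2$3 * A$3$2 * A$4$4
    + A$1$1 * A$2$3 * A$3$4 * A$4$2 + A$1$1 * A$2$4 * A$3$2 * A$4$3 - A$1$1 * A$2$4 * A$3$3 * A$4$2
    - A$1$2 * A$2$1 * A$3$3 * A$4$4 + A$1$2 * A$2$1 * A$3$4 * A$4$3 + A$1$2 * A$2$3 * A$3$1 * A$4$4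
    - A$1$2 * A$2$3 * A$3$4 * A$4$1 - A$1$2 * A$2$4 * A$3$1 * A$4$3 + A$1$2 * A$2$4 * A$3$3 * A$4$1
    + A$1$3 * A$2$1 * A$3$2 * A$4$4 - A$1$3 * A$2$1 * A$3$4 * A$4$2 - A$1$3 * A$2$2 * A$3$1 * A$4$4
    + A$1$3 * A$2$2 * A$3$4 * A$4$1 + A$1$3 * A$2$4 * A$3$1 * A$4$2 - A$1$3 * A$2$4 * A$3$2 * A$4$1
    - A$1$4 * A$2$1 * A$3$2 * A$4$3 + A$1$4 * A$2$1 * A$3$3 * A$4$2 + A$1$4 * A$2$2 * A$3$1 * A$4$3
    - A$1$4 * A$2$2 * A$3$3 * A$4$1 - A$1$4 * A$2$3 * A$3$1 * A$4$2 + A$1$4 * A$2$3 * A$3$2 * A$4$1"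
proof -
  have f1234: "finite {2::4, 3, 4}" "1 \<notin> {2::4, 3, 4}" by auto
  have f234: "finite {3::4, 4}" "2 \<notin> {3::4, 4}" by auto
  have f34: "finite {4::4}" "3 \<notin> {4::4}" by auto
  show ?thesis
    unfolding det_def UNIV_4
    unfolding sum_over_permutations_insert[OF f1234]
    unfolding sum_over_permutations_insert[OF f234]
    unfolding sum_over_permutations_insert[OF f34]
    unfolding permutes_sing
    by (simp add: sign_swap_id permutation_swap_id permutation_compose sign_compose sign_id swap_id_eq)
qed

text \<open>The matrix determinant lemma for \<open>1 + c v v\<^sup>T\<close>, checked by expansion
  in dimension four.\<close>

lemma det_stretch:
  fixes M :: "real^4^4"
  shows "det (stretch c v M) = (1 + c * (v \<bullet> v)) * det M"
proof -
  have "stretch c v M = (\<chi> i j. (if i = j then 1 else 0) + c * (v $ i * v $ j)) ** M"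
  proof -
    have "(\<Sum>k\<in>UNIV. ((if i = k then 1 else 0) + c * (v $ i * v $ k)) * M $ k $ j)
        = (\<Sum>k\<in>UNIV. (if i = k then M $ k $ j else 0) + c * (v $ i * (v $ k * M $ k $ j)))" for i j
      by (intro sum.cong) (auto simp: algebra_simps)
    then show ?thesis
      by (simp add: vec_eq_iff stretch_def matrix_matrix_mult_def sum.distrib inner_vec_def column_def sum_distrib_left)
  qed
  moreover have "det (\<chi> i j. (if i = j then 1 else 0) + c * (v $ i * v $ j)) = 1 + c * (v \<bullet> v)"
    unfolding det_4 by (simp add: inner_vec_def sum_4 algebra_simps)
  ultimately show ?thesis by (simp add: det_mul)
qed

text \<open>The quotient \<open>g\<close> of \<open>P\<close> by the determinant is invariant under
  reflections. Along a line of stretchings the determinant grows by the factor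
  \<open>1 + c * (v \<bullet> v)\<close>, and \<open>P\<close> is divisible by this factor, so
  \<open>g\<close> is still a polynomial on the line.\<close>

theorem sign_orthogonal_invariant_polynomial:
  fixes P :: "complex^4^4 \<Rightarrow> complex"
  assumes P: "P \<in> gen_algebra entries"
    and inv: "\<And>w M. w \<noteq> 0 \<Longrightarrow> P (mat_of_real (reflect w M)) = - P (mat_of_real M)"
  shows "\<exists>F\<in>gen_algebra entries. \<forall>M. P M = det M * F (gram M)"
proof -
  define g where "g M = P (mat_of_real M) / of_real (det M)" for M
  obtain D where D: "\<And>M v. \<exists>p. degree p \<le> D \<and> (\<forall>c. P (mat_of_real (stretch c v M)) = poly p (of_real c))"
    by (rule stretch_line_poly[OF P]) blast
  have "\<exists>r. degree r \<le> D \<and> (\<forall>c\<ge>0. g (stretch c v M) = poly r (of_real (2 * c + (v \<bullet> v) * c^2)))"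
    if M: "det M \<noteq> 0" and v: "v \<noteq> 0" for M v
  proof -
    obtain p where p: "degree p \<le> D" "\<And>c. P (mat_of_real (stretch c v M)) = poly p (of_real c)" using D by blast
    define \<beta> where "\<beta> = v \<bullet> v"
    have \<beta>: "\<beta> > 0" using v by (simp add: \<beta>_def)
    have sym: "poly p (of_real (- 2 / \<beta> - c)) = - poly p (of_real c)" for c
      unfolding p(2)[symmetric] \<beta>_def reflect_stretch[OF v, symmetric] by (rule inv[OF v])
    \<comment> \<open>The parameter \<open>- 1 / \<beta>\<close> is fixed by the involution, and a
      function that changes sign vanishes at a fixed point.\<close>
    have "poly p (of_real (- 1 / \<beta>)) = 0" using sym[of "- 1 / \<beta>"] by simp
    then obtain p0 where p0: "p = [:of_real (1 / \<beta>), 1:] * p0"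
      using poly_eq_0_iff_dvd[of p "of_real (- 1 / \<beta>)"] by (auto simp: dvd_def)
    define p1 where "p1 = smult (of_real (1 / \<beta>)) p0"
    have p1: "poly p (of_real c) = of_real (1 + c * \<beta>) * poly p1 (of_real c)" for c
      using \<beta> by (simp add: p0 p1_def field_simps)
    have deg1: "degree p1 \<le> degree p"
    proof (cases "p0 = 0")
      case False
      then have "degree p = 1 + degree p0" unfolding p0 by (subst degree_mult_eq) simp_all
      then show ?thesis by (simp add: p1_def)
    qed (simp add: p1_def)
    have "poly p1 (of_real c) = poly p1 (of_real (- 2 / (v \<bullet> v) - c))" for c
      unfolding \<beta>_def[symmetric]
    proof (cases "1 + c * \<beta> = 0")
      case True
      then have "c = - 1 / \<beta>" using \<beta> by (simp add: field_simps)
      then show "poly p1 (of_real c) = poly p1 (of_real (- 2 / \<beta> - c))" by simp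
    next
      case False
      have eq: "1 + (- 2 / \<beta> - c) * \<beta> = - (1 + c * \<beta>)" using \<beta> by (simp add: field_simps)
      have "of_real (1 + c * \<beta>) * poly p1 (of_real (- 2 / \<beta> - c)) = of_real (1 + c * \<beta>) * poly p1 (of_real c)"
        using sym[of c] unfolding p1 eq by (simp only: of_real_minus mult_minus_left neg_equal_iff_equal)
      moreover have "of_real (1 + c * \<beta>) \<noteq> (0 :: complex)" using False by (simp only: of_real_eq_0_iff not_False_eq_True)
      ultimately show "poly p1 (of_real c) = poly p1 (of_real (- 2 / \<beta> - c))" by (metis mult_cancel_left)
    qed
    from poly_reflection_invariant[OF v this] obtain r where
      r: "degree r \<le> degree p1" "\<And>c. poly p1 (of_real c) = poly r (of_real (2 * c + (v \<bullet> v) * c^2))" by blast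
    define r' where "r' = smult (1 / of_real (det M)) r"
    have "g (stretch c v M) = poly r' (of_real (2 * c + (v \<bullet> v) * c^2))" if "c \<ge> 0" for c
    proof -
      have "1 + c * \<beta> \<noteq> 0" using that \<beta> by (simp add: add_pos_nonneg less_imp_neq[symmetric] add_nonneg_eq_0_iff)
      then have "of_real (1 + c * \<beta>) \<noteq> (0 :: complex)" by (simp only: of_real_eq_0_iff not_False_eq_True)
      then have "g (stretch c v M) = poly p1 (of_real c) / of_real (det M)"
        unfolding g_def p(2) p1 det_stretch \<beta>_def[symmetric] of_real_mult by simp
      then show ?thesis unfolding r(2) by (simp add: r'_def)
    qed
    moreover have "degree r' \<le> D"
      using degree_smult_le[of "1 / of_real (det M)" r] r(1) deg1 p(1) unfolding r'_def by linarith
    ultimately show ?thesis by blast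
  qed
  moreover have "g (reflect w M) = g M" if "w \<noteq> 0" for w M
  proof -
    have "det (reflect w M) = - det M" using that by (simp add: reflect_eq_stretch det_stretch)
    then show ?thesis using inv[OF that] by (simp add: g_def)
  qed
  ultimately have "\<exists>F\<in>gen_algebra entries. \<forall>M. (\<forall>k. gram_coord (gram M) k \<ge> 0) \<longrightarrow> g M = F (mat_of_real (gram M))"
    by (intro polynomial_in_gram[where D = D]) auto
  then obtain F where F: "F \<in> gen_algebra entries"
    "\<And>M. (\<And>k. gram_coord (gram M) k \<ge> 0) \<Longrightarrow> g M = F (mat_of_real (gram M))" by blast
  have "P M - det M * F (gram M) = 0" for M
  proof (rule eq_0_if_vanishes_for_large_gram[of "\<lambda>M. P M - det M * F (gram M)"])
    show "(\<lambda>M. P M - det M * F (gram M)) \<in> gen_algebra entries"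
      by (intro gen_algebra_diff P gen_algebra.mult det_in_gen_algebra compose_gram_in_gen_algebra F(1))
    fix M :: "real^4^4" assume M: "\<forall>k. gram_coord (gram M) k \<ge> 0"
    then have "g M = F (gram (mat_of_real M))" unfolding mat_of_real_gram by (intro F(2)) blast
    then show "P (mat_of_real M) - det (mat_of_real M) * F (gram (mat_of_real M)) = 0"
      using det_ne_0_if_gram_coord_nonneg[of M] M by (simp add: g_def det_mat_of_real field_simps)
  qed
  then have "P M = det M * F (gram M)" for M by (metis eq_iff_diff_eq_0)
  then show ?thesis using F(1) by blast
qed

section \<open>Integration over balls\<close>

lemma continuous_integrable_on_cball:
  fixes f :: "'a::euclidean_space \<Rightarrow> 'b::euclidean_space"
  assumes "continuous_on UNIV f"
  shows "f integrable_on cball a r"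
proof -
  have "set_integrable lborel (cball a r) f"
    unfolding set_integrable_def
    by (rule borel_integrable_compact) (use assms continuous_on_subset in auto)
  then show ?thesis by (rule set_borel_integral_eq_integral(1))
qed

lemma integral_cball_orthogonal_real:
  fixes f :: "real^'n::{finite,wellorder} \<Rightarrow> real" and T :: "real^'n::_ \<Rightarrow> real^'n::_"
  assumes T: "orthogonal_transformation T" and f: "continuous_on UNIV f"
  shows "integral (cball 0 r) (\<lambda>x. f (T x)) = integral (cball 0 r) f"
proof -
  \<comment> \<open>The linear change of variables used below is about vector valued functions, so
    \<open>f\<close> is wrapped into \<open>real^1\<close>.\<close>
  define F :: "_ \<Rightarrow> real^1" where "F x = (\<chi> i. f x)" for x
  have F: "continuous_on UNIV F" unfolding F_def by (intro continuous_intros f)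
  have TF: "continuous_on UNIV (F \<circ> T)"
    using F linear_continuous_on[OF orthogonal_transformation_linear[OF T, unfolded linear_conv_bounded_linear]]
    by (intro continuous_on_compose) (auto intro: continuous_on_subset)
  have img: "T ` cball 0 r = cball 0 r"
    using image_orthogonal_transformation_cball[OF T, of 0 r] orthogonal_transformation_linear[OF T] linear_0
    by metis
  have "F absolutely_integrable_on cball 0 r"
    by (rule absolutely_integrable_onI) (auto intro!: continuous_integrable_on_cball F continuous_intros)
  then have "integral (T ` cball 0 r) F = \<bar>det (matrix T)\<bar> *\<^sub>R integral (cball 0 r) (F \<circ> T)"
    by (intro integral_change_of_variables_linear orthogonal_transformation_linear T) (simp add: img)
  then have "integral (cball 0 r) F = integral (cball 0 r) (F \<circ> T)"
    using T by (simp add: img)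
  moreover have "integral (cball 0 r) F \<bullet> axis 1 1 = integral (cball 0 r) f"
    using integral_component_eq[OF continuous_integrable_on_cball[OF F], of 0 r "axis 1 1"]
    by (simp add: F_def inner_axis)
  moreover have "integral (cball 0 r) (F \<circ> T) \<bullet> axis 1 1 = integral (cball 0 r) (\<lambda>x. f (T x))"
    using integral_component_eq[OF continuous_integrable_on_cball[OF TF], of 0 r "axis 1 1"]
    by (simp add: F_def inner_axis)
  ultimately show ?thesis by simp
qed

lemma integral_cball_orthogonal:
  fixes f :: "real^'n::{finite,wellorder} \<Rightarrow> complex" and T :: "real^'n::_ \<Rightarrow> real^'n::_"
  assumes T: "orthogonal_transformation T" and f: "continuous_on UNIV f"
  shows "integral (cball 0 r) (\<lambda>x. f (T x)) = integral (cball 0 r) f"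
proof -
  have fT: "continuous_on UNIV (\<lambda>x. f (T x))"
    using linear_continuous_on[OF orthogonal_transformation_linear[OF T, unfolded linear_conv_bounded_linear]]
    by (intro continuous_on_compose2[OF f]) auto
  have comp: "integral (cball 0 r) (\<lambda>x. f (T x)) \<bullet> b = integral (cball 0 r) f \<bullet> b" for b
  proof -
    have "integral (cball 0 r) (\<lambda>x. f (T x)) \<bullet> b = integral (cball 0 r) (\<lambda>x. f (T x) \<bullet> b)"
      by (rule integral_component_eq[OF continuous_integrable_on_cball[OF fT], symmetric])
    also have "\<dots> = integral (cball 0 r) (\<lambda>x. f x \<bullet> b)"
      by (rule integral_cball_orthogonal_real[OF T]) (intro continuous_intros f)
    also have "\<dots> = integral (cball 0 r) f \<bullet> b"
      by (rule integral_component_eq[OF continuous_integrable_on_cball[OF f]])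
    finally show ?thesis .
  qed
  show ?thesis by (rule euclidean_eqI) (rule comp)
qed

lemma integral_cball_pos:
  fixes f :: "'a::euclidean_space \<Rightarrow> real"
  assumes f: "continuous_on UNIV f" and nonneg: "\<And>x. f x \<ge> 0" and x0: "x0 \<in> ball a r" "f x0 > 0"
  shows "integral (cball a r) f > 0"
proof -
  obtain c d where cd: "x0 \<in> box c d" "cbox c d \<subseteq> ball a r"
    by (rule open_contains_cbox[of "ball a r" x0]) (use x0(1) in auto)
  have int: "f integrable_on cbox c d" by (intro integrable_continuous continuous_on_subset[OF f]) auto
  have "integral (cbox c d) f \<noteq> 0"
    using integral_cbox_eq_0_iff[of c d f] cd(1) x0(2) nonneg continuous_on_subset[OF f]
      box_subset_cbox by (metis empty_iff less_irrefl subsetD subset_UNIV)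
  moreover have "integral (cbox c d) f \<ge> 0" using nonneg by (intro integral_nonneg int)
  moreover have "integral (cbox c d) f \<le> integral (cball a r) f"
    using cd(2) ball_subset_cball[of a r] nonneg
    by (intro integral_subset_le int continuous_integrable_on_cball f) auto
  ultimately show ?thesis by linarith
qed

section \<open>Averaging polynomials\<close>

text \<open>Finite sums of products of a continuous function of the parameter and a polynomial in
  the matrix. Integration over the parameter touches only the first factor, which is why averages of
  polynomials are polynomials.\<close>

inductive_set separated_sums :: "('b::topological_space \<Rightarrow> complex^'n^'m \<Rightarrow> complex) set" where
  summand: "continuous_on UNIV g \<Longrightarrow> h \<in> gen_algebra entries \<Longrightarrow> (\<lambda>x M. g x * h M) \<in> separated_sums"
| add: "f \<in> separated_sums \<Longrightarrow> g \<in> separated_sums \<Longrightarrow> (\<lambda>x M. f x M + g x M) \<in> separated_sums"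

lemma separated_sums_sum:
  "finite I \<Longrightarrow> (\<And>i. i \<in> I \<Longrightarrow> f i \<in> separated_sums) \<Longrightarrow> (\<lambda>x M. \<Sum>i\<in>I. f i x M) \<in> separated_sums"
proof (induction I rule: finite_induct)
  case empty
  show ?case using separated_sums.summand[of "\<lambda>_. 0", OF continuous_on_const gen_algebra.const[of 0]] by simp
next
  case (insert i I)
  then show ?case using separated_sums.add[of "f i"] by simp
qed

lemma separated_sums_mult:
  assumes "f \<in> separated_sums" "g \<in> separated_sums"
  shows "(\<lambda>x M. f x M * g x M) \<in> separated_sums"
  using assms(1)
proof induction
  case (summand g1 h1)
  show ?case using assms(2)
  proof induction
    case (summand g2 h2)
    have "(\<lambda>x M. (g1 x * g2 x) * (h1 M * h2 M)) \<in> separated_sums"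
      using summand \<open>continuous_on UNIV g1\<close> \<open>h1 \<in> _\<close>
      by (intro separated_sums.summand continuous_on_mult gen_algebra.mult)
    then show ?case by (simp add: ac_simps)
  next
    case (add f g)
    then show ?case using separated_sums.add[OF add.IH] by (simp add: distrib_left)
  qed
next
  case (add f1 f2)
  then show ?case using separated_sums.add[OF add.IH] by (simp add: distrib_right)
qed

lemma separated_sums_continuous: "f \<in> separated_sums \<Longrightarrow> continuous_on UNIV (\<lambda>x. f x M)"
  by (induction rule: separated_sums.induct) (auto intro: continuous_intros)

lemma integral_separated_sums:
  fixes f :: "'b::euclidean_space \<Rightarrow> complex^'n^'m \<Rightarrow> complex"
  assumes "f \<in> separated_sums"
  shows "(\<lambda>M. integral (cball a r) (\<lambda>x. f x M)) \<in> gen_algebra entries"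
  using assms
proof induction
  case (summand g h)
  have "integral (cball a r) (\<lambda>x. g x * h M) = integral (cball a r) g * h M" for M
    using has_integral_mult_left[OF integrable_integral[OF continuous_integrable_on_cball[OF summand(1)]]]
    by (rule integral_unique)
  then show ?case using gen_algebra_cmult[OF summand(2)] by simp
next
  case (add f g)
  have "integral (cball a r) (\<lambda>x. f x M + g x M) =
      integral (cball a r) (\<lambda>x. f x M) + integral (cball a r) (\<lambda>x. g x M)" for M
    using add.hyps by (intro integral_add continuous_integrable_on_cball separated_sums_continuous)
  then show ?case using gen_algebra.add[OF add.IH] by simp
qed

lemma mat_of_real_mult: "mat_of_real (A ** B) = mat_of_real A ** mat_of_real B"
  by (simp add: vec_eq_iff matrix_matrix_mult_def)

lemma mat_of_real_mat_1: "mat_of_real (mat 1) = mat 1"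
  by (simp add: vec_eq_iff mat_def)

text \<open>Averages are taken over a ball in the space of quaternions instead of the unit sphere. They
  need not fix invariant polynomials; it suffices that they are invariant, preserve the ideals of
  stable cones, and are positive. The radius 2 makes the identity an interior point.\<close>

definition average :: "(real^4 \<Rightarrow> real^'m^'m) \<Rightarrow> (complex^'n^'m \<Rightarrow> complex) \<Rightarrow> complex^'n^'m \<Rightarrow> complex" where
  "average \<kappa> a M = integral (cball 0 2) (\<lambda>x. a (mat_of_real (\<kappa> x) ** M))"

lemma translate_in_separated_sums:
  fixes \<kappa> :: "'b::topological_space \<Rightarrow> real^'m^'m"
  assumes \<kappa>: "continuous_on UNIV \<kappa>" and a: "a \<in> gen_algebra entries"
  shows "(\<lambda>x M. a (mat_of_real (\<kappa> x) ** M)) \<in> separated_sums"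
  using a
proof induction
  case (const c)
  show ?case using separated_sums.summand[OF continuous_on_const[of _ c] gen_algebra.const[of 1]] by simp
next
  case (gen f)
  then obtain i j where f: "f = (\<lambda>M. M $ i $ j)" by (auto simp: entries_def)
  have "(\<lambda>x M. \<Sum>k\<in>UNIV. of_real (\<kappa> x $ i $ k) * M $ k $ j) \<in> separated_sums"
    by (intro separated_sums_sum separated_sums.summand entry_in_gen_algebra continuous_intros \<kappa>) simp
  then show ?case by (simp add: f matrix_matrix_mult_def)
next
  case (add f g) show ?case by (rule separated_sums.add[OF add.IH])
next
  case (mult f g) show ?case by (rule separated_sums_mult[OF mult.IH])
qed

lemma average_in_gen_algebra:
  "continuous_on UNIV \<kappa> \<Longrightarrow> a \<in> gen_algebra entries \<Longrightarrow> average \<kappa> a \<in> gen_algebra entries"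
  unfolding average_def[abs_def] by (intro integral_separated_sums translate_in_separated_sums)

lemma continuous_translate:
  fixes \<kappa> :: "'b::topological_space \<Rightarrow> real^'m^'m"
  assumes "continuous_on UNIV \<kappa>" "a \<in> gen_algebra entries"
  shows "continuous_on UNIV (\<lambda>x. a (mat_of_real (\<kappa> x) ** M))"
  using separated_sums_continuous[OF translate_in_separated_sums[OF assms], of M] .

lemma average_translate:
  assumes \<kappa>: "continuous_on UNIV \<kappa>" and a: "a \<in> gen_algebra entries"
    and T: "orthogonal_transformation T" "\<And>x. \<kappa> x ** k = \<kappa> (T x)"
  shows "average \<kappa> a (mat_of_real k ** M) = average \<kappa> a M"
proof -
  have "average \<kappa> a (mat_of_real k ** M) = integral (cball 0 2) (\<lambda>x. a (mat_of_real (\<kappa> (T x)) ** M))"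
    unfolding average_def by (simp add: matrix_mul_assoc mat_of_real_mult[symmetric] T(2))
  also have "\<dots> = average \<kappa> a M"
    unfolding average_def by (rule integral_cball_orthogonal[OF T(1) continuous_translate[OF \<kappa> a]])
  finally show ?thesis .
qed

text \<open>The relation is required only along the translates of one matrix \<open>M\<close>, so
  \<open>c\<close> may be the value at \<open>M\<close> of an invariant function that is not a
  polynomial.\<close>

lemma average_eq_cmult:
  assumes \<kappa>: "continuous_on UNIV \<kappa>" and b: "b \<in> gen_algebra entries"
    and eq: "\<And>x. a (mat_of_real (\<kappa> x) ** M) = c * b (mat_of_real (\<kappa> x) ** M)"
  shows "average \<kappa> a M = c * average \<kappa> b M"
proof -
  have "average \<kappa> a M = integral (cball 0 2) (\<lambda>x. c * b (mat_of_real (\<kappa> x) ** M))"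
    unfolding average_def eq ..
  also have "\<dots> = c * average \<kappa> b M"
    unfolding average_def
    using has_integral_mult_right[OF integrable_integral[OF continuous_integrable_on_cball[OF continuous_translate[OF \<kappa> b]]]]
    by (rule integral_unique)
  finally show ?thesis .
qed

section \<open>Quaternions\<close>

text \<open>Hamilton's product over any commutative ring. The real quaternions supply the compact
  group to average over; the complex ones are the algebra of 2 by 2 matrices. The matrices
  \<open>lmat a\<close> and \<open>rmat b\<close> describe multiplication by \<open>a\<close> from
  the left and by \<open>b\<close> from the right.\<close>

definition qmul :: "'a::comm_ring_1^4 \<Rightarrow> 'a^4 \<Rightarrow> 'a^4" where
  "qmul a b = vector
     [a$1 * b$1 - a$2 * b$2 - a$3 * b$3 - a$4 * b$4,
      a$1 * b$2 + a$2 * b$1 + a$3 * b$4 - a$4 * b$3,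
      a$1 * b$3 - a$2 * b$4 + a$3 * b$1 + a$4 * b$2,
      a$1 * b$4 + a$2 * b$3 - a$3 * b$2 + a$4 * b$1]"

definition lmat :: "'a::comm_ring_1^4 \<Rightarrow> 'a^4^4" where
  "lmat a = vector
     [vector [a$1, - a$2, - a$3, - a$4],
      vector [a$2, a$1, - a$4, a$3],
      vector [a$3, a$4, a$1, - a$2],
      vector [a$4, - a$3, a$2, a$1]]"

definition rmat :: "'a::comm_ring_1^4 \<Rightarrow> 'a^4^4" where
  "rmat b = vector
     [vector [b$1, - b$2, - b$3, - b$4],
      vector [b$2, b$1, b$4, - b$3],
      vector [b$3, - b$4, b$1, b$2],
      vector [b$4, b$3, - b$2, b$1]]"

lemma vector_4:
  "(vector [p, q, r, t] :: 'a::zero^4) $ 1 = p"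
  "(vector [p, q, r, t] :: 'a::zero^4) $ 2 = q"
  "(vector [p, q, r, t] :: 'a::zero^4) $ 3 = r"
  "(vector [p, q, r, t] :: 'a::zero^4) $ 4 = t"
  unfolding vector_def by simp_all

lemmas quat_simps = qmul_def lmat_def rmat_def vector_4 forall_4 sum_4 vec_eq_iff matrix_matrix_mult_def
  matrix_vector_mult_def inner_vec_def

lemma lmat_qmul: "lmat (qmul a b) = lmat a ** lmat b" for a b :: "real^4"
  by (simp add: quat_simps algebra_simps)

lemma rmat_qmul: "rmat (qmul a b) = rmat b ** rmat a" for a b :: "real^4"
  by (simp add: quat_simps algebra_simps)

lemma lmat_rmat_commute: "lmat a ** rmat b = rmat b ** lmat a" for a b :: "real^4"
  by (simp add: quat_simps algebra_simps)

text \<open>Euler's four square identity.\<close>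

lemma inner_qmul: "qmul a b \<bullet> qmul a b = (a \<bullet> a) * (b \<bullet> b)" for a b :: "real^4"
  by (simp add: quat_simps algebra_simps)

lemma linear_qmul_left: "linear (\<lambda>x::real^4. qmul x u)"
  by (rule linearI) (simp_all add: quat_simps algebra_simps)

lemma linear_qmul_right: "linear (\<lambda>x::real^4. qmul u x)"
  by (rule linearI) (simp_all add: quat_simps algebra_simps)

lemma orthogonal_transformation_qmul:
  fixes u :: "real^4"
  assumes "norm u = 1"
  shows "orthogonal_transformation (\<lambda>x. qmul x u)" "orthogonal_transformation (\<lambda>x. qmul u x)"
proof -
  have "u \<bullet> u = 1" using assms by (simp add: norm_eq_1)
  then have "norm (qmul x u) = norm x" "norm (qmul u x) = norm x" for x
    by (simp_all add: norm_eq_sqrt_inner inner_qmul)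
  then show "orthogonal_transformation (\<lambda>x. qmul x u)" "orthogonal_transformation (\<lambda>x. qmul u x)"
    using linear_qmul_left linear_qmul_right by (auto simp: orthogonal_transformation)
qed

lemma continuous_lmat: "continuous_on UNIV (lmat :: real^4 \<Rightarrow> _)"
proof -
  have "linear (lmat :: real^4 \<Rightarrow> _)" by (rule linearI) (simp_all add: quat_simps)
  then show ?thesis by (simp add: linear_continuous_on linear_conv_bounded_linear)
qed

lemma continuous_rmat: "continuous_on UNIV (rmat :: real^4 \<Rightarrow> _)"
proof -
  have "linear (rmat :: real^4 \<Rightarrow> _)" by (rule linearI) (simp_all add: quat_simps)
  then show ?thesis by (simp add: linear_continuous_on linear_conv_bounded_linear)
qed

text \<open>Only real unit quaternions are used: this is the invariance that averaging produces, and
  together with conjugation they generate the reflections.\<close>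

definition quat_invariant :: "(complex^'n^4 \<Rightarrow> complex) \<Rightarrow> bool" where
  "quat_invariant P \<longleftrightarrow> (\<forall>u M. norm u = 1 \<longrightarrow>
     P (mat_of_real (lmat u) ** M) = P M \<and> P (mat_of_real (rmat u) ** M) = P M)"

definition quat_average :: "(complex^'n^4 \<Rightarrow> complex) \<Rightarrow> complex^'n^4 \<Rightarrow> complex" where
  "quat_average a = average lmat (average rmat a)"

lemma quat_average_in_gen_algebra: "a \<in> gen_algebra entries \<Longrightarrow> quat_average a \<in> gen_algebra entries"
  unfolding quat_average_def by (intro average_in_gen_algebra continuous_lmat continuous_rmat)

text \<open>Left and right multiplications commute, so the outer average preserves the invariance
  gained by the inner one.\<close>

lemma quat_invariant_quat_average:
  fixes a :: "complex^'n^4 \<Rightarrow> complex"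
  assumes a: "a \<in> gen_algebra entries"
  shows "quat_invariant (quat_average a)"
  unfolding quat_invariant_def
proof (intro allI impI conjI)
  fix u :: "real^4" and M :: "complex^'n^4" assume u: "norm u = 1"
  show "quat_average a (mat_of_real (lmat u) ** M) = quat_average a M"
    unfolding quat_average_def
    by (intro average_translate[where T = "\<lambda>x. qmul x u"] continuous_lmat continuous_rmat
        average_in_gen_algebra a orthogonal_transformation_qmul u lmat_qmul[symmetric])
  have "average rmat a (mat_of_real (rmat u) ** N) = average rmat a N" for N
    by (intro average_translate[where T = "\<lambda>x. qmul u x"] continuous_rmat a
        orthogonal_transformation_qmul u rmat_qmul[symmetric])
  then show "quat_average a (mat_of_real (rmat u) ** M) = quat_average a M"
    unfolding quat_average_def average_def[of lmat]
    by (simp add: matrix_mul_assoc mat_of_real_mult[symmetric] lmat_rmat_commute)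
      (simp add: matrix_mul_assoc[symmetric] mat_of_real_mult)
qed

lemma quat_average_eq_cmult:
  assumes b: "b \<in> gen_algebra entries"
    and eq: "\<And>x y. a (mat_of_real (rmat y ** lmat x) ** M) = c * b (mat_of_real (rmat y ** lmat x) ** M)"
  shows "quat_average a M = c * quat_average b M"
  unfolding quat_average_def
  by (intro average_eq_cmult continuous_lmat continuous_rmat average_in_gen_algebra b)
    (use eq in \<open>simp add: matrix_mul_assoc mat_of_real_mult\<close>)

text \<open>The integrand is nonnegative along the real translates of \<open>M\<close>, and it is
  positive where both quaternions are 1, an interior point of the balls. The positivity of such an
  integral is used once for each of the two averages.\<close>

lemma quat_average_ne_0:
  fixes a :: "complex^'n^4 \<Rightarrow> complex"
  assumes a: "a \<in> gen_algebra entries" and nz: "a M \<noteq> 0"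
    and nonneg: "\<And>k. a (mat_of_real k ** M) = of_real (f k)" "\<And>k. f k \<ge> 0"
  shows "quat_average a M \<noteq> 0"
proof -
  have e1: "axis 1 1 \<in> ball (0::real^4) 2" by (simp add: norm_axis_1)
  have one: "mat_of_real (lmat (axis 1 1)) = (mat 1 :: complex^4^4)"
    "mat_of_real (rmat (axis 1 1)) = (mat 1 :: complex^4^4)"
    by (simp_all add: quat_simps mat_def axis_def)
  define g where "g k = integral (cball 0 2) (\<lambda>y. f (rmat y ** k))" for k
  have cont: "continuous_on UNIV (\<lambda>y. f (rmat y ** k))" for k
  proof -
    have "continuous_on UNIV (\<lambda>y. Re (a (mat_of_real (rmat y) ** (mat_of_real k ** M))))"
      by (intro continuous_intros continuous_translate continuous_rmat a)
    then show ?thesis by (simp add: matrix_mul_assoc mat_of_real_mult[symmetric] nonneg(1))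
  qed
  have av: "average rmat a (mat_of_real k ** M) = of_real (g k)" for k
  proof -
    have "average rmat a (mat_of_real k ** M) = integral (cball 0 2) (\<lambda>y. of_real (f (rmat y ** k)))"
      unfolding average_def by (simp add: matrix_mul_assoc mat_of_real_mult[symmetric] nonneg(1))
    also have "\<dots> = of_real (g k)"
      unfolding g_def
      using has_integral_linear[OF integrable_integral[OF continuous_integrable_on_cball[OF cont]] bounded_linear_of_real]
      by (intro integral_unique) (simp add: o_def)
    finally show ?thesis .
  qed
  have g: "g k \<ge> 0" for k unfolding g_def by (intro integral_nonneg continuous_integrable_on_cball cont nonneg(2))
  have fpos: "f (mat 1) > 0"
    using nz nonneg(1)[of "mat 1"] nonneg(2)[of "mat 1"] by (auto simp: less_le mat_of_real_mat_1)
  have mat1: "rmat (axis 1 1) = (mat 1 :: real^4^4)" "lmat (axis 1 1) = (mat 1 :: real^4^4)"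
    by (simp_all add: quat_simps mat_def axis_def)
  have gpos: "g (mat 1) > 0"
    unfolding g_def by (rule integral_cball_pos[OF cont nonneg(2) e1]) (simp add: mat1 fpos)
  have contg: "continuous_on UNIV (\<lambda>x. g (lmat x))"
  proof -
    have "continuous_on UNIV (\<lambda>x. Re (average rmat a (mat_of_real (lmat x) ** M)))"
      by (intro continuous_intros continuous_translate continuous_lmat average_in_gen_algebra continuous_rmat a)
    then show ?thesis by (simp add: av)
  qed
  have "quat_average a M = integral (cball 0 2) (\<lambda>x. of_real (g (lmat x)))"
    unfolding quat_average_def average_def[of lmat] av ..
  also have "\<dots> = of_real (integral (cball 0 2) (\<lambda>x. g (lmat x)))"
    using has_integral_linear[OF integrable_integral[OF continuous_integrable_on_cball[OF contg]] bounded_linear_of_real]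
    by (intro integral_unique) (simp add: o_def)
  finally show ?thesis
    using integral_cball_pos[OF contg g e1] gpos by (simp add: mat1)
qed

lemma compose_mult_left_in_gen_algebra:
  fixes P :: "complex^'n^'m \<Rightarrow> complex" and A :: "complex^'l^'m"
  assumes "P \<in> gen_algebra entries"
  shows "(\<lambda>M. P (A ** M)) \<in> gen_algebra entries"
  using assms
proof (rule gen_algebra_compose)
  fix g :: "complex^'n^'m \<Rightarrow> complex" assume "g \<in> entries"
  then obtain i j where g: "g = (\<lambda>M. M $ i $ j)" by (auto simp: entries_def)
  have "(\<lambda>M. \<Sum>k\<in>UNIV. A $ i $ k * M $ k $ j) \<in> gen_algebra entries"
    by (intro gen_algebra_sum gen_algebra_cmult entry_in_gen_algebra)
  then show "(\<lambda>M. g (A ** M)) \<in> gen_algebra entries" by (simp add: g matrix_matrix_mult_def)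
qed

lemma compose_mult_right_in_gen_algebra:
  fixes P :: "complex^'n^'m \<Rightarrow> complex" and A :: "complex^'n^'l"
  assumes "P \<in> gen_algebra entries"
  shows "(\<lambda>M. P (M ** A)) \<in> gen_algebra entries"
  using assms
proof (rule gen_algebra_compose)
  fix g :: "complex^'n^'m \<Rightarrow> complex" assume "g \<in> entries"
  then obtain i j where g: "g = (\<lambda>M. M $ i $ j)" by (auto simp: entries_def)
  have "(\<lambda>M. \<Sum>k\<in>UNIV. A $ k $ j * M $ i $ k) \<in> gen_algebra entries"
    by (intro gen_algebra_sum gen_algebra_cmult entry_in_gen_algebra)
  then show "(\<lambda>M. g (M ** A)) \<in> gen_algebra entries" by (simp add: g matrix_matrix_mult_def mult.commute)
qed

text \<open>Conjugation of quaternions, an orthogonal matrix of determinant -1.\<close>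

definition qconj_mat :: "real^4^4" where
  "qconj_mat = vector [vector [1, 0, 0, 0], vector [0, -1, 0, 0], vector [0, 0, -1, 0], vector [0, 0, 0, -1]]"

lemma qconj_mat_squared: "qconj_mat ** qconj_mat = mat 1"
  by (simp add: qconj_mat_def quat_simps mat_def)

text \<open>The reflection in a unit quaternion \<open>u\<close> is \<open>m \<mapsto> - u m\<^sup>* u\<close>.\<close>

lemma reflect_eq_quat:
  assumes "norm u = 1"
  shows "reflect u M = lmat (- u) ** (rmat u ** (qconj_mat ** M))"
proof -
  have uu: "u $ 1 * u $ 1 + u $ 2 * u $ 2 + u $ 3 * u $ 3 + u $ 4 * u $ 4 = 1"
    using assms by (simp add: norm_eq_1 inner_vec_def sum_4)
  have "u \<bullet> u = 1" using assms by (simp add: norm_eq_1)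
  then have r: "reflect u M = (\<chi> i j. M $ i $ j - 2 * (u \<bullet> column j M) * u $ i)"
    by (simp add: reflect_def)
  have "(lmat (- u) ** (rmat u ** qconj_mat)) $ i $ k = of_bool (i = k) - 2 * u $ i * u $ k" for i k
  proof -
    \<comment> \<open>For arbitrary \<open>u\<close> the identity matrix appears with the squared
      norm of \<open>u\<close> as coefficient, which makes this a polynomial identity.\<close>
    have "\<forall>i k. (lmat (- u) ** (rmat u ** qconj_mat)) $ i $ k = of_bool (i = k) * (u $ 1 * u $ 1 + u $ 2 * u $ 2 + u $ 3 * u $ 3 + u $ 4 * u $ 4) - 2 * u $ i * u $ k"
      by (simp add: qconj_mat_def quat_simps algebra_simps)
    then show ?thesis by (simp add: uu)
  qed
  then have eq: "lmat (- u) ** (rmat u ** qconj_mat) = (\<chi> i k. of_bool (i = k) - 2 * u $ i * u $ k)"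
    by (simp add: vec_eq_iff)
  have "(\<chi> i k. of_bool (i = k) - 2 * u $ i * u $ k) ** M = reflect u M"
  proof -
    have "(\<Sum>k\<in>UNIV. (of_bool (i = k) - 2 * u $ i * u $ k) * M $ k $ j)
        = (\<Sum>k\<in>UNIV. (if i = k then M $ k $ j else 0) - 2 * u $ i * (u $ k * M $ k $ j))" for i j
      by (intro sum.cong) (auto simp: algebra_simps)
    then show ?thesis
      by (simp add: r vec_eq_iff matrix_matrix_mult_def sum_subtractf inner_vec_def column_def sum_distrib_left[symmetric])
  qed
  then show ?thesis unfolding eq[symmetric] by (simp add: matrix_mul_assoc)
qed

lemma reflect_scaleR: "c \<noteq> 0 \<Longrightarrow> reflect (c *\<^sub>R w) M = reflect w M"
  by (simp add: reflect_def vec_eq_iff)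

lemma qconj_mat_reflect: "qconj_mat ** reflect w M = reflect (qconj_mat *v w) (qconj_mat ** M)"
proof -
  have inner: "(qconj_mat *v v) \<bullet> (qconj_mat *v w) = v \<bullet> w" for v w
    by (simp add: qconj_mat_def quat_simps)
  have col: "column j (qconj_mat ** M) = qconj_mat *v column j M" for j
    by (simp add: column_def matrix_matrix_mult_def matrix_vector_mult_def vec_eq_iff)
  have "column j (qconj_mat ** reflect w M) = column j (reflect (qconj_mat *v w) (qconj_mat ** M))" for j
  proof -
    have "column j (qconj_mat ** reflect w M) = qconj_mat *v column j (reflect w M)"
      by (simp add: column_def matrix_matrix_mult_def matrix_vector_mult_def vec_eq_iff)
    then show ?thesis
      unfolding column_reflect col inner
      by (simp add: matrix_vector_mult_diff_distrib matrix_vector_mult_scaleR)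
  qed
  then show ?thesis by (simp add: column_def vec_eq_iff)
qed

text \<open>The first fundamental theorem for the special orthogonal group in dimension four. Since
  a reflection is conjugation followed by multiplications by units, reflections exchange
  \<open>P\<close> with its composite \<open>P'\<close> with conjugation. So \<open>P + P'\<close>
  is invariant, \<open>P - P'\<close> changes sign, and \<open>P\<close> is half of their
  sum.\<close>

theorem quat_invariant_polynomial:
  fixes P :: "complex^4^4 \<Rightarrow> complex"
  assumes P: "P \<in> gen_algebra entries" and inv: "quat_invariant P"
  shows "\<exists>F\<in>gen_algebra entries. \<exists>G\<in>gen_algebra entries. \<forall>M. P M = F (gram M) + det M * G (gram M)"
proof -
  define P' where "P' M = P (mat_of_real qconj_mat ** M)" for M
  have P': "P' \<in> gen_algebra entries"
    unfolding P'_def by (rule compose_mult_left_in_gen_algebra[OF P])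
  have unit: "P (mat_of_real (reflect w M)) = P' (mat_of_real M)" if "w \<noteq> 0" for w M
  proof -
    define u where "u = (1 / norm w) *\<^sub>R w"
    have u: "norm u = 1" "norm (- u) = 1" using that by (simp_all add: u_def)
    have "reflect w M = reflect u M" using that by (simp add: u_def reflect_scaleR)
    also have "\<dots> = lmat (- u) ** (rmat u ** (qconj_mat ** M))" by (rule reflect_eq_quat[OF u(1)])
    finally show ?thesis
      using inv u unfolding quat_invariant_def P'_def by (simp add: mat_of_real_mult)
  qed
  have unit': "P' (mat_of_real (reflect w M)) = P (mat_of_real M)" if "w \<noteq> 0" for w M
  proof -
    have "qconj_mat *v w \<noteq> 0"
    proof
      assume "qconj_mat *v w = 0"
      then have "qconj_mat *v (qconj_mat *v w) = 0" by simp
      then show False using that by (simp add: matrix_vector_mul_assoc qconj_mat_squared)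
    qed
    from unit[OF this, of "qconj_mat ** M"] show ?thesis
      unfolding P'_def mat_of_real_mult[symmetric] qconj_mat_reflect
      by (simp add: matrix_mul_assoc mat_of_real_mult[symmetric] qconj_mat_squared) 
  qed
  have "(\<lambda>M. P M + P' M) \<in> gen_algebra entries" by (intro gen_algebra.add P P')
  from orthogonal_invariant_polynomial[OF this]
  obtain F where F: "F \<in> gen_algebra entries" "\<And>M. P M + P' M = F (gram M)"
    using unit unit' by (metis add.commute)
  have "(\<lambda>M. P M - P' M) \<in> gen_algebra entries" by (intro gen_algebra_diff P P')
  from sign_orthogonal_invariant_polynomial[OF this]
  obtain G where G: "G \<in> gen_algebra entries" "\<And>M. P M - P' M = det M * G (gram M)"
    using unit unit' by (metis minus_diff_eq)
  have eq: "P M = (1 / 2) * F (gram M) + det M * ((1 / 2) * G (gram M))" for M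
    by (simp only: mult.left_commute[of "det M"] F(2)[symmetric] G(2)[symmetric]) (simp add: field_simps)
  show ?thesis
    by (rule bexI[OF _ gen_algebra_cmult[OF F(1), of "1/2"]], rule bexI[OF _ gen_algebra_cmult[OF G(1), of "1/2"]])
      (use eq in blast)
qed

section \<open>Minimal vectors\<close>

definition cnj_mat :: "complex^'n^'m \<Rightarrow> complex^'n^'m" where
  "cnj_mat M = (\<chi> i j. cnj (M $ i $ j))"

lemma cnj_mat_cnj_mat [simp]: "cnj_mat (cnj_mat M) = M"
  by (simp add: cnj_mat_def vec_eq_iff)

lemma cnj_mat_mult: "cnj_mat (A ** B) = cnj_mat A ** cnj_mat B"
  by (simp add: cnj_mat_def vec_eq_iff matrix_matrix_mult_def)

lemma cnj_mat_of_real [simp]: "cnj_mat (mat_of_real A) = mat_of_real A"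
  by (simp add: cnj_mat_def vec_eq_iff)

text \<open>Conjugating both argument and value only conjugates the coefficients.\<close>

lemma cnj_conjugate_in_gen_algebra:
  assumes "a \<in> gen_algebra entries"
  shows "(\<lambda>M. cnj (a (cnj_mat M))) \<in> gen_algebra entries"
  using assms
proof induction
  case (const c) show ?case by (rule gen_algebra.const)
next
  case (gen f)
  then obtain i j where "f = (\<lambda>M. M $ i $ j)" by (auto simp: entries_def)
  then show ?case using entry_in_gen_algebra[of i j] by (simp add: cnj_mat_def)
next
  case (add f g) show ?case using gen_algebra.add[OF add.IH] by simp
next
  case (mult f g) show ?case using gen_algebra.mult[OF mult.IH] by simp
qed

definition bil :: "complex^'n^'n \<Rightarrow> complex^'n \<Rightarrow> complex^'n \<Rightarrow> complex" where
  "bil Q x y = (\<Sum>i\<in>UNIV. \<Sum>j\<in>UNIV. x $ i * Q $ i $ j * y $ j)"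

lemma bil_simps:
  "bil Q (x + y) z = bil Q x z + bil Q y z" "bil Q z (x + y) = bil Q z x + bil Q z y"
  "bil Q (c *s x) z = c * bil Q x z" "bil Q z (c *s x) = c * bil Q z x"
  "bil Q (x - y) z = bil Q x z - bil Q y z" "bil Q z (x - y) = bil Q z x - bil Q z y"
  by (simp_all add: bil_def algebra_simps sum.distrib sum_subtractf sum_distrib_left)

lemma bil_sum: "bil Q (\<Sum>i\<in>I. f i) z = (\<Sum>i\<in>I. bil Q (f i) z)"
  by (induction I rule: infinite_finite_induct) (simp_all add: bil_simps, simp_all add: bil_def)

lemma bil_axis_left: "bil Q (axis a 1) y = (\<Sum>j\<in>UNIV. Q $ a $ j * y $ j)"
proof -
  have "bil Q (axis a 1) y = (\<Sum>i\<in>UNIV. if i = a then (\<Sum>j\<in>UNIV. Q $ a $ j * y $ j) else 0)"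
    unfolding bil_def by (intro sum.cong) (auto simp: axis_def)
  then show ?thesis by simp
qed

lemma bil_axis: "bil Q (axis a 1) (axis b 1) = Q $ a $ b"
  unfolding bil_axis_left by (simp add: axis_def if_distrib cong: if_cong)

lemma bil_commute:
  assumes "\<And>a b. Q $ a $ b = Q $ b $ a"
  shows "bil Q x y = bil Q y x"
  unfolding bil_def by (subst sum.swap) (simp add: assms ac_simps)

text \<open>Orthonormality refers to the complex bilinear form, without conjugation. If
  \<open>w\<close> were orthogonal to a maximal family and not isotropic, dividing it by a complex
  square root of \<open>bil Q w w\<close> would enlarge the family.\<close>

lemma ex_maximal_orthonormal:
  fixes Q :: "complex^'n^'n"
  assumes sym: "\<And>a b. Q $ a $ b = Q $ b $ a"
  shows "\<exists>(I :: 'n set) v. (\<forall>i\<in>I. \<forall>j\<in>I. bil Q (v i) (v j) = of_bool (i = j)) \<and>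
    (\<forall>w. (\<forall>i\<in>I. bil Q w (v i) = 0) \<longrightarrow> bil Q w w = 0)"
proof -
  define ok where "ok I v \<longleftrightarrow> (\<forall>i\<in>I. \<forall>j\<in>I. bil Q (v i) (v j) = of_bool (i = j))"
    for I :: "'n set" and v :: "'n \<Rightarrow> complex^'n"
  define S where "S = {I. \<exists>v. ok I v}"
  have "{} \<in> S" by (simp add: ok_def S_def)
  moreover have "finite S" by simp
  ultimately obtain I where I: "I \<in> S" "\<And>J. J \<in> S \<Longrightarrow> I \<le> J \<Longrightarrow> I = J"
    using finite_has_maximal2[of S "{}"] by metis
  from I(1) obtain v where v: "ok I v" unfolding S_def by blast
  have "bil Q w w = 0" if w: "\<And>i. i \<in> I \<Longrightarrow> bil Q w (v i) = 0" for w
  proof (cases "I = UNIV")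
    case True
    \<comment> \<open>No index is left for enlarging the family, but then it is a basis and
      \<open>w\<close> is 0.\<close>
    define V where "V = (\<chi> i j. v j $ i)"
    have bilV: "(transpose V ** (Q ** V)) $ i $ j = bil Q (v i) (v j)" for i j
      by (simp add: matrix_matrix_mult_def transpose_def V_def bil_def sum_distrib_left ac_simps)
    have "transpose V ** (Q ** V) = mat 1"
      using v True by (simp add: vec_eq_iff bilV ok_def mat_def)
    then have "(Q ** V) ** transpose V = mat 1" by (rule matrix_left_right_inverse[THEN iffD1])
    then have inv: "V ** transpose (Q ** V) = mat 1"
      by (metis matrix_transpose_mul transpose_mat transpose_transpose)
    have "transpose (Q ** V) *v w = 0"
    proof -
      have "(transpose (Q ** V) *v w) $ i = bil Q w (v i)" for i
        unfolding bil_def matrix_vector_mult_def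
        by (simp add: matrix_matrix_mult_def transpose_def V_def sum_distrib_right sum_distrib_left ac_simps)
      then show ?thesis using w True by (simp add: vec_eq_iff)
    qed
    then have "V *v (transpose (Q ** V) *v w) = 0" by (simp only: matrix_vector_mult_0_right)
    then have "w = 0" by (simp only: matrix_vector_mul_assoc inv matrix_vector_mul_lid)
    then show ?thesis by (simp add: bil_def)
  next
    case False
    then obtain k where k: "k \<notin> I" by blast
    show ?thesis
    proof (rule ccontr)
      assume nz: "bil Q w w \<noteq> 0"
      define r where "r = csqrt (bil Q w w)"
      have r: "r * r = bil Q w w" "r \<noteq> 0" using nz by (auto simp: r_def power2_eq_square[symmetric])
      define v' where "v' = v(k := (1 / r) *s w)"
      have wk: "bil Q (v i) w = 0" if "i \<in> I" for i using w[OF that] bil_commute[OF sym] by simp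
      have "ok (insert k I) v'"
        unfolding ok_def
      proof (intro ballI)
        fix i j assume ij: "i \<in> insert k I" "j \<in> insert k I"
        show "bil Q (v' i) (v' j) = of_bool (i = j)"
        proof (cases "i = k"; cases "j = k")
          assume "i = k" "j = k"
          then show ?thesis using r by (simp add: v'_def bil_simps r(1)[symmetric])
        next
          assume "i = k" "j \<noteq> k"
          then show ?thesis using ij w by (auto simp: v'_def bil_simps)
        next
          assume "i \<noteq> k" "j = k"
          then show ?thesis using ij wk by (auto simp: v'_def bil_simps)
        next
          assume "i \<noteq> k" "j \<noteq> k"
          then show ?thesis using ij v by (auto simp: v'_def ok_def)
        qed
      qed
      then have "I = insert k I" using I(2)[of "insert k I"] unfolding S_def by blast
      then show False using k by blast
    qed
  qed
  then have "\<forall>w. (\<forall>i\<in>I. bil Q w (v i) = 0) \<longrightarrow> bil Q w w = 0" by blast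
  with v show ?thesis unfolding ok_def by blast
qed

text \<open>The form vanishes identically on the orthogonal complement of a maximal orthonormal
  family, so \<open>Q\<close> is the sum of the squares of the functionals
  \<open>bil Q _ (v i)\<close>, which are dual to the \<open>v i\<close>. With these functionals as
  rows and zeros elsewhere, the column space of \<open>M\<close> is a coordinate subspace and thus
  stable under conjugation.\<close>

theorem ex_minimal_gram:
  fixes Q :: "complex^'n^'n"
  assumes sym: "\<And>a b. Q $ a $ b = Q $ b $ a"
  obtains M :: "complex^'n^'n" and B :: "complex^'n^'n" where "gram M = Q" "cnj_mat M = M ** B"
proof -
  from ex_maximal_orthonormal[OF sym] obtain I :: "'n set" and v :: "'n \<Rightarrow> complex^'n"
    where on': "\<forall>i\<in>I. \<forall>j\<in>I. bil Q (v i) (v j) = of_bool (i = j)"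
      and max': "\<forall>w. (\<forall>i\<in>I. bil Q w (v i) = 0) \<longrightarrow> bil Q w w = 0" by (elim exE conjE)
  have on: "bil Q (v i) (v j) = of_bool (i = j)" if "i \<in> I" "j \<in> I" for i j
    using on' that by simp
  have max: "bil Q w w = 0" if "\<And>i. i \<in> I \<Longrightarrow> bil Q w (v i) = 0" for w
    using max'[rule_format, of w] that by simp
  have comm: "bil Q x y = bil Q y x" for x y by (rule bil_commute[OF sym])
  define rest where "rest x = x - (\<Sum>i\<in>I. bil Q x (v i) *s v i)" for x
  have rest: "bil Q (rest x) (v i) = 0" if "i \<in> I" for x i
  proof -
    have "bil Q (\<Sum>j\<in>I. bil Q x (v j) *s v j) (v i) = (\<Sum>j\<in>I. if j = i then bil Q x (v i) else 0)"
      unfolding bil_sum by (intro sum.cong) (auto simp: bil_simps on that)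
    also have "\<dots> = bil Q x (v i)" using that by simp
    finally show ?thesis by (simp add: rest_def bil_simps)
  qed
  have rest0: "bil Q (rest x) (rest y) = 0" for x y
  proof -
    \<comment> \<open>Polarization: maximality makes both vectors and their sum isotropic.\<close>
    have "bil Q (rest x) (rest x) = 0" "bil Q (rest y) (rest y) = 0"
      "bil Q (rest x + rest y) (rest x + rest y) = 0"
      by (intro max; simp add: rest bil_simps)+
    then show ?thesis using comm[of "rest y" "rest x"] by (simp add: bil_simps)
  qed
  have expand: "bil Q x y = (\<Sum>i\<in>I. bil Q x (v i) * bil Q y (v i))" for x y
  proof -
    have dec: "x = rest x + (\<Sum>i\<in>I. bil Q x (v i) *s v i)" for x by (simp add: rest_def)
    have vr: "bil Q (v i) (rest y) = 0" if "i \<in> I" for i using rest[OF that] comm by metis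
    have "bil Q x (rest y) = 0"
      by (subst dec[of x]) (simp add: bil_simps rest0 bil_sum vr)
    moreover have "bil Q (\<Sum>i\<in>I. bil Q y (v i) *s v i) x = (\<Sum>i\<in>I. bil Q y (v i) * bil Q x (v i))"
      unfolding bil_sum by (simp add: bil_simps comm[of "v _" x])
    ultimately have "bil Q x (rest y + (\<Sum>i\<in>I. bil Q y (v i) *s v i)) = (\<Sum>i\<in>I. bil Q y (v i) * bil Q x (v i))"
      by (simp add: bil_simps comm[of x])
    then show ?thesis using dec[of y] by (simp add: mult.commute)
  qed
  define M :: "complex^'n^'n" where "M = (\<chi> i a. if i \<in> I then bil Q (axis a 1) (v i) else 0)"
  have "gram M $ a $ b = Q $ a $ b" for a b
  proof -
    have "gram M $ a $ b = (\<Sum>i\<in>UNIV. if i \<in> I then bil Q (axis a 1) (v i) * bil Q (axis b 1) (v i) else 0)"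
      unfolding gram_nth M_def by (intro sum.cong) auto
    also have "\<dots> = (\<Sum>i\<in>I. bil Q (axis a 1) (v i) * bil Q (axis b 1) (v i))" by (simp add: sum.If_cases)
    also have "\<dots> = bil Q (axis a 1) (axis b 1)" by (rule expand[symmetric])
    finally show ?thesis by (simp add: bil_axis)
  qed
  then have "gram M = Q" by (simp add: vec_eq_iff)
  \<comment> \<open>For \<open>j\<close> in \<open>I\<close>, \<open>M *v v j\<close> is the unit
    vector with index \<open>j\<close>, so suitable combinations of the \<open>v j\<close> are
    preimages of the conjugated columns.\<close>
  moreover have "cnj_mat M = M ** (\<chi> a b. \<Sum>j\<in>I. v j $ a * cnj (M $ j $ b))"
  proof -
    have Mv: "(\<Sum>a\<in>UNIV. M $ i $ a * x $ a) = (if i \<in> I then bil Q x (v i) else 0)" for i x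
    proof -
      have "bil Q x (v i) = (\<Sum>a\<in>UNIV. bil Q (axis a 1) (v i) * x $ a)"
        unfolding bil_axis_left by (simp add: bil_def sum_distrib_left sum_distrib_right ac_simps)
      then show ?thesis by (simp add: M_def)
    qed
    have "(M ** (\<chi> a b. \<Sum>j\<in>I. v j $ a * cnj (M $ j $ b))) $ i $ b = cnj (M $ i $ b)" for i b
    proof -
      have "(M ** (\<chi> a b. \<Sum>j\<in>I. v j $ a * cnj (M $ j $ b))) $ i $ b
          = (\<Sum>j\<in>I. (\<Sum>a\<in>UNIV. M $ i $ a * v j $ a) * cnj (M $ j $ b))"
        unfolding matrix_matrix_mult_def
        by (simp add: sum_distrib_left sum_distrib_right mult.assoc) (rule sum.swap)
      also have "\<dots> = (\<Sum>j\<in>I. if j = i then cnj (M $ i $ b) else 0)"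
        unfolding Mv by (intro sum.cong) (auto simp: on)
      also have "\<dots> = cnj (M $ i $ b)" by (simp add: M_def)
      finally show ?thesis .
    qed
    then show ?thesis by (simp add: vec_eq_iff cnj_mat_def)
  qed
  ultimately show ?thesis by (rule that)
qed

section \<open>Zariski topologies\<close>

lemma openin_zariski_top_principal: "p \<in> poly_funs s \<Longrightarrow> openin (zariski_top s S) {v \<in> S. p v \<noteq> 0}"
  unfolding zariski_top_def by (rule topology_generated_by_Basis) blast

text \<open>The product of two polynomials defines the intersection of their principal open sets, so
  these sets form a base and not only a subbase.\<close>

lemma openin_zariski_top_iff:
  "openin (zariski_top s S) U \<longleftrightarrow>
     U \<subseteq> S \<and> (\<forall>x\<in>U. \<exists>p\<in>poly_funs s. p x \<noteq> 0 \<and> {v \<in> S. p v \<noteq> 0} \<subseteq> U)"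
proof
  assume U: "openin (zariski_top s S) U"
  have "\<forall>x\<in>U. \<exists>p\<in>poly_funs s. p x \<noteq> 0 \<and> {v \<in> S. p v \<noteq> 0} \<subseteq> U"
    using U unfolding zariski_top_def openin_topology_generated_by_iff
  proof induction
    case Empty show ?case by simp
  next
    case (Int A B)
    show ?case
    proof
      fix x assume "x \<in> A \<inter> B"
      then obtain p q where "p \<in> poly_funs s" "p x \<noteq> 0" "{v \<in> S. p v \<noteq> 0} \<subseteq> A"
        "q \<in> poly_funs s" "q x \<noteq> 0" "{v \<in> S. q v \<noteq> 0} \<subseteq> B" using Int.IH by blast
      then show "\<exists>p\<in>poly_funs s. p x \<noteq> 0 \<and> {v \<in> S. p v \<noteq> 0} \<subseteq> A \<inter> B"
        by (intro bexI[OF _ poly_funs.mult[of p _ q]]) auto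
    qed
  next
    case (UN K)
    then show ?case by (meson UnionE Union_upper order_trans)
  next
    case (Basis A)
    then show ?case by auto
  qed
  then show "U \<subseteq> S \<and> (\<forall>x\<in>U. \<exists>p\<in>poly_funs s. p x \<noteq> 0 \<and> {v \<in> S. p v \<noteq> 0} \<subseteq> U)"
    using openin_subset[OF U] by simp
next
  assume U: "U \<subseteq> S \<and> (\<forall>x\<in>U. \<exists>p\<in>poly_funs s. p x \<noteq> 0 \<and> {v \<in> S. p v \<noteq> 0} \<subseteq> U)"
  show "openin (zariski_top s S) U"
  proof (subst openin_subopen, intro ballI)
    fix x assume x: "x \<in> U"
    then obtain p where p: "p \<in> poly_funs s" "p x \<noteq> 0" "{v \<in> S. p v \<noteq> 0} \<subseteq> U" using U by blast
    show "\<exists>T. openin (zariski_top s S) T \<and> x \<in> T \<and> T \<subseteq> U"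
      using openin_zariski_top_principal[OF p(1), of S] p x U by (intro exI[of _ "{v \<in> S. p v \<noteq> 0}"]) auto
  qed
qed

lemma closedin_zariski_top_eqs:
  assumes "\<And>i. i \<in> I \<Longrightarrow> p i \<in> poly_funs s"
  shows "closedin (zariski_top s S) {v \<in> S. \<forall>i\<in>I. p i v = 0}"
proof -
  have "S - {v \<in> S. \<forall>i\<in>I. p i v = 0} = (\<Union>i\<in>I. {v \<in> S. p i v \<noteq> 0})" by auto
  then show ?thesis
    unfolding closedin_def using assms by (auto intro!: openin_Union openin_zariski_top_principal)
qed

lemma dual_iff:
  "\<xi> \<in> dual s \<longleftrightarrow> vector_space s \<and> (\<forall>u v. \<xi> (u + v) = \<xi> u + \<xi> v) \<and> (\<forall>c v. \<xi> (s c v) = c * \<xi> v)"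
  unfolding dual_def mem_Collect_eq Vector_Spaces.linear_def module_hom_def module_hom_axioms_def
  using vector_space_over_itself.vector_space_axioms[where 'a = complex]
    vector_space_over_itself.module_axioms[where 'a = complex] module_iff_vector_space[of s] by blast

lemma fun_scale_0 [simp]: "fun_scale c 0 = 0"
  by (simp add: fun_scale_def fun_eq_iff)

lemma vector_space_fun_scale: "vector_space fun_scale"
  by standard (simp_all add: fun_scale_def fun_eq_iff algebra_simps)

lemma t1_space_affine: "t1_space (zariski_top fun_scale (S :: (nat \<Rightarrow> complex) set))"
  unfolding t1_space_def topspace_zariski_top
proof (intro ballI impI)
  fix x y assume xy: "x \<in> S" "y \<in> S" "x \<noteq> y"
  then obtain i where i: "x i \<noteq> y i" by auto
  have "(\<lambda>v::nat \<Rightarrow> complex. v i) \<in> dual fun_scale"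
    by (simp add: dual_iff vector_space_fun_scale) (simp add: fun_scale_def)
  then have p: "(\<lambda>v. v i + (- y i)) \<in> poly_funs fun_scale"
    by (intro poly_funs.add poly_funs.const poly_funs.functional)
  show "\<exists>U. openin (zariski_top fun_scale S) U \<and> x \<in> U \<and> y \<notin> U"
    using openin_zariski_top_principal[OF p, of S] xy i
    by (intro exI[of _ "{v \<in> S. v i + - y i \<noteq> 0}"]) auto
qed

text \<open>An affine chart around \<open>n\<close> either misses \<open>m\<close> and separates
  them itself, or contains both points, which are then separated by a coordinate function.\<close>

lemma t1_space_variety:
  assumes "variety N"
  shows "t1_space (zariski N)"
  unfolding t1_space_def
proof (intro ballI impI)
  fix n m assume nm: "n \<in> points N" "m \<in> points N" "n \<noteq> m"
  obtain C where C: "\<Union>C = points N" "\<And>U. U \<in> C \<Longrightarrow> openin (zariski N) U \<and> affine_variety (induced N U)"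
    using assms unfolding variety_def by blast
  obtain U where U: "n \<in> U" "openin (zariski N) U" "affine_variety (induced N U)" using C nm by blast
  show "\<exists>U. openin (zariski N) U \<and> n \<in> U \<and> m \<notin> U"
  proof (cases "m \<in> U")
    case True
    obtain S :: "(nat \<Rightarrow> complex) set" and f where f: "isomorphism (induced N U) (zariski_space fun_scale S) f"
      using U(3) unfolding affine_variety_def by blast
    have pts: "points (induced N U) = U"
      using openin_subset[OF U(2)] by (auto simp: induced_def)
    have "f n \<noteq> f m" using f nm(3) U(1) True unfolding isomorphism_def pts by metis
    have cont: "continuous_map (subtopology (zariski N) U) (zariski_top fun_scale S) f"
      using f by (simp add: isomorphism_def morphism_def induced_def zariski_space_def)
    have "f n \<in> S" "f m \<in> S"
      using continuous_map_image_subset_topspace[OF cont] U(1) True pts by (auto simp: induced_def)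
    then obtain W where W: "openin (zariski_top fun_scale S) W" "f n \<in> W" "f m \<notin> W"
      using t1_space_affine[of S] \<open>f n \<noteq> f m\<close> unfolding t1_space_def topspace_zariski_top by blast
    have "openin (subtopology (zariski N) U) {x \<in> topspace (subtopology (zariski N) U). f x \<in> W}"
      by (rule openin_continuous_map_preimage[OF cont W(1)])
    moreover have top: "topspace (subtopology (zariski N) U) = U" using openin_subset[OF U(2)] by auto
    ultimately have "openin (zariski N) {x \<in> U. f x \<in> W}"
      unfolding top openin_open_subtopology[OF U(2)] by blast
    then show ?thesis using W U(1) by (intro exI[of _ "{x \<in> U. f x \<in> W}"]) auto
  qed (use U in blast)
qed

lemma zariski_zariski_space [simp]: "zariski (zariski_space s S) = zariski_top s S"
  by (simp add: zariski_space_def)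

lemma regular_zariski_space:
  "regular (zariski_space s S) U f \<longleftrightarrow>
     (\<forall>v\<in>U. \<exists>W. \<exists>a\<in>poly_funs s. \<exists>b\<in>poly_funs s. openin (zariski_top s S) W \<and> v \<in> W \<and>
                 (\<forall>u\<in>W \<inter> U. b u \<noteq> 0 \<and> f u = a u / b u))"
  by (simp add: zariski_space_def)

lemma points_orbit_space: "points (orbit_space T X) = orbit_of T ` points X"
proof -
  have "{x \<in> points X. orbit_of T x \<in> orbit_of T ` points X} = points X" by auto
  then have "openin (zariski (orbit_space T X)) (orbit_of T ` points X)"
    by (simp add: openin_orbit_space)
  moreover have "\<And>U. openin (zariski (orbit_space T X)) U \<Longrightarrow> U \<subseteq> orbit_of T ` points X"
    by (simp add: openin_orbit_space)
  ultimately show ?thesis unfolding topspace_def by blast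
qed

section \<open>Weights\<close>

text \<open>The value \<open>t = 0\<close> is allowed here, so that weight expansions are identities
  of polynomials in \<open>t\<close>.\<close>

definition wt :: "complex \<Rightarrow> 'v sym_wedge \<Rightarrow> 'v sym_wedge" where
  "wt t y = (fun_scale t (fst y), fun_scale (t\<^sup>2) (snd y))"

lemma wt_wt: "wt u (wt t y) = wt (u * t) y"
  by (simp add: wt_def fun_scale_def fun_eq_iff power_mult_distrib)

lemma wt_1 [simp]: "wt 1 y = y"
  by (simp add: wt_def fun_scale_def)

lemma weighted_class_eq: "weighted_class y = {wt t y |t. t \<noteq> 0}"
  by (auto simp: weighted_class_def orbit_of_def weighted_action_def wt_def case_prod_unfold image_iff)

lemma weighted_class_eq_iff: "weighted_class y = weighted_class y' \<longleftrightarrow> (\<exists>t. t \<noteq> 0 \<and> y' = wt t y)"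
proof
  assume "weighted_class y = weighted_class y'"
  moreover have "y' \<in> weighted_class y'"
    unfolding weighted_class_eq mem_Collect_eq by (intro exI[of _ 1]) simp
  ultimately show "\<exists>t. t \<noteq> 0 \<and> y' = wt t y" unfolding weighted_class_eq by blast
next
  assume "\<exists>t. t \<noteq> 0 \<and> y' = wt t y"
  then obtain t where t: "t \<noteq> 0" "y' = wt t y" by blast
  show "weighted_class y = weighted_class y'"
  proof (intro equalityI subsetI)
    fix z assume "z \<in> weighted_class y"
    then obtain u where u: "u \<noteq> 0" "z = wt u y" unfolding weighted_class_eq by blast
    then have "z = wt (u / t) y'" "u / t \<noteq> 0" using t by (simp_all add: wt_wt)
    then show "z \<in> weighted_class y'" unfolding weighted_class_eq by blast
  next
    fix z assume "z \<in> weighted_class y'"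
    then obtain u where u: "u \<noteq> 0" "z = wt u y'" unfolding weighted_class_eq by blast
    then have "z = wt (u * t) y" "u * t \<noteq> 0" using t by (simp_all add: wt_wt)
    then show "z \<in> weighted_class y" unfolding weighted_class_eq by blast
  qed
qed

lemma coeff_0_in_poly_funs: "(\<lambda>y. coeff 0 i) \<in> poly_funs s"
  by (simp add: poly_funs.const)

lemma coeff_pCons_in_poly_funs:
  assumes "h \<in> poly_funs s" "\<And>i. (\<lambda>y. coeff (C y) i) \<in> poly_funs s"
  shows "(\<lambda>y. coeff (pCons (h y) (C y)) i) \<in> poly_funs s"
  using assms by (cases i) simp_all

text \<open>The expansion of a polynomial on pairs by weight. A linear functional is the sum of its
  parts on the two summands, which have weights 1 and 2; sums and products of functions expand
  accordingly.\<close>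

lemma weight_polynomial:
  assumes "f \<in> poly_funs pair_scale"
  obtains C where "\<And>i. (\<lambda>y. coeff (C y) i) \<in> poly_funs pair_scale"
    "\<And>t y. f (wt t y) = poly (C y) t" "\<And>i t y. coeff (C (wt t y)) i = t ^ i * coeff (C y) i"
proof -
  have "\<exists>C. (\<forall>i. (\<lambda>y. coeff (C y) i) \<in> poly_funs pair_scale) \<and> (\<forall>t y. f (wt t y) = poly (C y) t)"
    using assms
  proof induction
    case (const c)
    show ?case
      by (rule exI[of _ "\<lambda>_. [:c:]"]) (simp add: coeff_pCons_in_poly_funs coeff_0_in_poly_funs poly_funs.const)
  next
    case (functional \<xi>)
    then have vs: "vector_space (pair_scale :: complex \<Rightarrow> 'a sym_wedge \<Rightarrow> _)" and
      add: "\<And>u v. \<xi> (u + v) = \<xi> u + \<xi> v" and scale: "\<And>c v. \<xi> (pair_scale c v) = c * \<xi> v"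
      unfolding dual_iff by blast+
    have "\<xi> (fst (u + v), 0) = \<xi> (fst u, 0) + \<xi> (fst v, 0)" "\<xi> (0, snd (u + v)) = \<xi> (0, snd u) + \<xi> (0, snd v)" for u v
      using add[of "(fst u, 0)" "(fst v, 0)"] add[of "(0, snd u)" "(0, snd v)"] by simp_all
    moreover have "\<xi> (fst (pair_scale c v), 0) = c * \<xi> (fst v, 0)" "\<xi> (0, snd (pair_scale c v)) = c * \<xi> (0, snd v)" for c v
      using scale[of c "(fst v, 0)"] scale[of c "(0, snd v)"]
      by (simp_all add: pair_scale_def case_prod_unfold fun_scale_0)
    ultimately have part: "(\<lambda>y. \<xi> (fst y, 0)) \<in> dual pair_scale" "(\<lambda>y. \<xi> (0, snd y)) \<in> dual pair_scale"
      using vs unfolding dual_iff by blast+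
    have split: "\<xi> (wt t y) = t * \<xi> (fst y, 0) + t\<^sup>2 * \<xi> (0, snd y)" for t y
    proof -
      have "wt t y = pair_scale t (fst y, 0) + pair_scale (t\<^sup>2) (0, snd y)"
        by (simp add: wt_def pair_scale_def fun_scale_0)
      then show ?thesis by (simp add: add scale)
    qed
    show ?case
    proof (rule exI[of _ "\<lambda>y. [:0, \<xi> (fst y, 0), \<xi> (0, snd y):]"], intro conjI allI)
      fix i
      show "(\<lambda>y. coeff [:0, \<xi> (fst y, 0), \<xi> (0, snd y):] i) \<in> poly_funs pair_scale"
        by (intro coeff_pCons_in_poly_funs poly_funs.functional part coeff_0_in_poly_funs poly_funs.const)
    qed (simp add: split power2_eq_square algebra_simps)
  next
    case (add f g)
    then obtain C D where
      "\<And>i. (\<lambda>y. coeff (C y) i) \<in> poly_funs pair_scale" "\<And>t y. f (wt t y) = poly (C y) t"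
      "\<And>i. (\<lambda>y. coeff (D y) i) \<in> poly_funs pair_scale" "\<And>t y. g (wt t y) = poly (D y) t" by blast
    then show ?case by (intro exI[of _ "\<lambda>y. C y + D y"]) (auto intro: poly_funs.add)
  next
    case (mult f g)
    then obtain C D where CD:
      "\<And>i. (\<lambda>y. coeff (C y) i) \<in> poly_funs pair_scale" "\<And>t y. f (wt t y) = poly (C y) t"
      "\<And>i. (\<lambda>y. coeff (D y) i) \<in> poly_funs pair_scale" "\<And>t y. g (wt t y) = poly (D y) t" by blast
    have "(\<lambda>y. coeff (C y * D y) i) \<in> poly_funs pair_scale" for i
      using CD(1,3) unfolding coeff_mult poly_funs_eq_gen_algebra by (intro gen_algebra_sum gen_algebra.mult)
    then show ?case using CD(2,4) by (intro exI[of _ "\<lambda>y. C y * D y"]) auto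
  qed
  then obtain C where C: "\<And>i. (\<lambda>y. coeff (C y) i) \<in> poly_funs pair_scale" "\<And>t y. f (wt t y) = poly (C y) t"
    by blast
  \<comment> \<open>Homogeneity follows from \<open>wt\<close> being an action: both sides are
    compared as polynomials in a second parameter \<open>u\<close>.\<close>
  have "C (wt t y) = C y \<circ>\<^sub>p [:0, t:]" for t y
    unfolding poly_eq_poly_eq_iff[symmetric]
  proof
    fix u
    have "poly (C (wt t y)) u = f (wt u (wt t y))" by (rule C(2)[symmetric])
    also have "\<dots> = poly (C y) (u * t)" unfolding wt_wt by (rule C(2))
    finally show "poly (C (wt t y)) u = poly (C y \<circ>\<^sub>p [:0, t:]) u" by (simp add: poly_pcompose)
  qed
  then have "coeff (C (wt t y)) i = t ^ i * coeff (C y) i" for i t y by (simp add: coeff_pcompose_linear)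
  with C show ?thesis by (rule that)
qed

lemma vector_space_vec_scale:
  assumes "vector_space s"
  shows "vector_space (vec_scale s)"
proof -
  interpret vector_space s by fact
  show ?thesis
    by standard (simp_all add: vec_scale_def vec_eq_iff scale_right_distrib scale_left_distrib)
qed

lemma bil_gram: "bil (gram M) t t = (\<Sum>i\<in>UNIV. ((M *v t) $ i)\<^sup>2)"
proof -
  have "bil (gram M) t t = (\<Sum>a\<in>UNIV. \<Sum>c\<in>UNIV. \<Sum>i\<in>UNIV. (M $ i $ a * t $ a) * (M $ i $ c * t $ c))"
    by (simp add: bil_def gram_nth sum_distrib_left sum_distrib_right ac_simps)
  also have "\<dots> = (\<Sum>a\<in>UNIV. \<Sum>i\<in>UNIV. \<Sum>c\<in>UNIV. (M $ i $ a * t $ a) * (M $ i $ c * t $ c))"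
    by (intro sum.cong refl sum.swap)
  also have "\<dots> = (\<Sum>i\<in>UNIV. \<Sum>a\<in>UNIV. \<Sum>c\<in>UNIV. (M $ i $ a * t $ a) * (M $ i $ c * t $ c))"
    by (rule sum.swap)
  also have "\<dots> = (\<Sum>i\<in>UNIV. ((M *v t) $ i)\<^sup>2)"
    by (simp add: matrix_vector_mult_def power2_eq_square sum_product)
  finally show ?thesis .
qed

section \<open>Matrices over V in quaternion coordinates\<close>

text \<open>The algebra isomorphism from the complexified quaternions to the 2 by 2 matrices. It
  turns the sum of squares into the determinant, and products of matrices into products of
  quaternions.\<close>

definition pack :: "complex^4 \<Rightarrow> complex^2^2" where
  "pack m = vector [vector [m$1 + \<i> * m$2, m$3 + \<i> * m$4], vector [- m$3 + \<i> * m$4, m$1 - \<i> * m$2]]"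

definition unpack :: "complex^2^2 \<Rightarrow> complex^4" where
  "unpack A = vector [(A$1$1 + A$2$2) / 2, - \<i> * (A$1$1 - A$2$2) / 2, (A$1$2 - A$2$1) / 2, - \<i> * (A$1$2 + A$2$1) / 2]"

lemma pack_nth:
  "pack m $ 1 $ 1 = m$1 + \<i> * m$2" "pack m $ 1 $ 2 = m$3 + \<i> * m$4"
  "pack m $ 2 $ 1 = - m$3 + \<i> * m$4" "pack m $ 2 $ 2 = m$1 - \<i> * m$2"
  by (simp_all add: pack_def)

lemma pack_unpack: "pack (unpack A) = A"
  by (simp add: vec_eq_iff forall_2 pack_nth unpack_def vector_4 field_simps)

lemma pack_add: "pack (m + n) = pack m + pack n"
  by (simp add: vec_eq_iff forall_2 pack_nth algebra_simps)

lemma pack_smult: "pack (c *s m) $ i $ j = c * pack m $ i $ j"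
proof -
  have "\<forall>i j. pack (c *s m) $ i $ j = c * pack m $ i $ j"
    by (simp add: forall_2 pack_nth algebra_simps)
  then show ?thesis by blast
qed

lemma pack_sum: "pack (\<Sum>k\<in>K. f k) = (\<Sum>k\<in>K. pack (f k))"
  by (induction K rule: infinite_finite_induct) (simp_all add: pack_add, simp_all add: vec_eq_iff forall_2 pack_nth)

lemma pack_qmul: "pack (qmul m n) = pack m ** pack n"
proof -
  have ii: "\<i> * (\<i> * z) = - z" for z by (simp add: mult.assoc[symmetric])
  show ?thesis
    by (simp add: vec_eq_iff forall_2 pack_nth qmul_def vector_4 matrix_matrix_mult_def sum_2 algebra_simps ii)
qed

lemma det_pack: "det (pack m) = (\<Sum>i\<in>UNIV. (m $ i)\<^sup>2)"
proof -
  have ii: "\<i> * (\<i> * z) = - z" for z by (simp add: mult.assoc[symmetric])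
  show ?thesis by (simp add: det_2 pack_nth sum_4 power2_eq_square algebra_simps ii)
qed

text \<open>A basis of \<open>V\<close> with its coordinate functionals. Indexing both by the type
  \<open>4\<close> makes coordinates into vectors and matrices.\<close>

locale frame = vector_space s for s :: "complex \<Rightarrow> 'v::ab_group_add \<Rightarrow> 'v" +
  fixes b :: "'v^4" and crd :: "4 \<Rightarrow> 'v \<Rightarrow> complex"
  assumes crd_dual: "crd a \<in> dual s"
    and crd_basis: "crd a (b $ c) = of_bool (a = c)"
    and crd_expand: "(\<Sum>a\<in>UNIV. s (crd a v) (b $ a)) = v"
begin

abbreviation mat_scale :: "complex \<Rightarrow> 'v^2^2 \<Rightarrow> 'v^2^2" where
  "mat_scale \<equiv> vec_scale (vec_scale s)"

lemma vector_space_s: "vector_space s" by (rule vector_space_axioms)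

lemma vector_space_mat_scale: "vector_space mat_scale"
  by (intro vector_space_vec_scale vector_space_s)

lemma dual_simps:
  assumes "\<xi> \<in> dual s"
  shows "\<xi> (u + v) = \<xi> u + \<xi> v" "\<xi> (s c v) = c * \<xi> v" "\<xi> 0 = 0" "\<xi> (\<Sum>i\<in>I. f i) = (\<Sum>i\<in>I. \<xi> (f i))"
proof -
  show add: "\<xi> (u + v) = \<xi> u + \<xi> v" for u v using assms by (simp add: dual_iff)
  show "\<xi> (s c v) = c * \<xi> v" for c v using assms by (simp add: dual_iff)
  show 0: "\<xi> 0 = 0" using add[of 0 0] by simp
  show "\<xi> (\<Sum>i\<in>I. f i) = (\<Sum>i\<in>I. \<xi> (f i))"
    by (induction I rule: infinite_finite_induct) (simp_all add: 0 add)
qed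

lemma dual_expand:
  assumes "\<xi> \<in> dual s"
  shows "\<xi> v = (\<Sum>a\<in>UNIV. crd a v * \<xi> (b $ a))"
proof -
  have "\<xi> v = \<xi> (\<Sum>a\<in>UNIV. s (crd a v) (b $ a))" by (simp only: crd_expand)
  then show ?thesis by (simp only: dual_simps[OF assms])
qed

lemma dual_combination:
  assumes "\<And>i. i \<in> I \<Longrightarrow> \<xi> i \<in> dual s"
  shows "(\<lambda>v. \<Sum>i\<in>I. c i * \<xi> i v) \<in> dual s"
proof -
  have "\<xi> i (u + v) = \<xi> i u + \<xi> i v" "\<xi> i (s d v) = d * \<xi> i v" if "i \<in> I" for i u v d
    using assms[OF that] by (simp_all add: dual_simps)
  then show ?thesis
    by (simp add: dual_iff vector_space_s distrib_left sum.distrib sum_distrib_left mult.left_commute)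
qed

definition functional :: "complex^4 \<Rightarrow> 'v \<Rightarrow> complex" where
  "functional t = (\<lambda>v. \<Sum>a\<in>UNIV. t $ a * crd a v)"

definition vals :: "('v \<Rightarrow> complex) \<Rightarrow> complex^4" where
  "vals \<xi> = (\<chi> a. \<xi> (b $ a))"

lemma functional_dual: "functional t \<in> dual s"
  unfolding functional_def by (intro dual_combination crd_dual)

lemma functional_basis: "functional t (b $ a) = t $ a"
  by (simp add: functional_def crd_basis of_bool_def if_distrib cong: if_cong)

lemma functional_vals:
  assumes "\<xi> \<in> dual s"
  shows "functional (vals \<xi>) = \<xi>"
proof
  fix v
  have "\<xi> v = (\<Sum>a\<in>UNIV. crd a v * \<xi> (b $ a))" by (rule dual_expand[OF assms])
  then show "functional (vals \<xi>) v = \<xi> v" by (simp only: functional_def vals_def vec_lambda_beta mult.commute)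
qed

lemma vals_functional: "vals (functional t) = t"
  by (simp add: vals_def functional_basis vec_eq_iff)

lemma vals_crd: "vals (crd a) = axis a 1"
  by (auto simp: vals_def crd_basis vec_eq_iff axis_def)

lemma vals_add: "vals (\<xi> + \<zeta>) = vals \<xi> + vals \<zeta>"
  by (simp add: vals_def vec_eq_iff)

lemma dual_add: "\<xi> \<in> dual s \<Longrightarrow> \<zeta> \<in> dual s \<Longrightarrow> \<xi> + \<zeta> \<in> dual s"
  by (simp add: dual_iff algebra_simps)

text \<open>Column \<open>a\<close> of \<open>M\<close> is the quaternion that represents the 2 by 2
  matrix of the coefficients of \<open>b $ a\<close>; the rows of \<open>M\<close> are the
  coordinates of the four vectors \<open>m\<close>.\<close>

definition phi :: "complex^4^4 \<Rightarrow> 'v^2^2" where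
  "phi M = (\<chi> i j. \<Sum>a\<in>UNIV. s (pack (column a M) $ i $ j) (b $ a))"

definition phi_inv :: "'v^2^2 \<Rightarrow> complex^4^4" where
  "phi_inv \<phi> = (\<chi> k a. unpack (\<chi> i j. crd a (\<phi> $ i $ j)) $ k)"

lemma phi_phi_inv: "phi (phi_inv \<phi>) = \<phi>"
proof -
  have "column a (phi_inv \<phi>) = unpack (\<chi> i j. crd a (\<phi> $ i $ j))" for a
    by (simp add: column_def phi_inv_def)
  then show ?thesis by (simp add: phi_def pack_unpack crd_expand)
qed

text \<open>Applying a functional to all entries turns questions about matrices over
  \<open>V\<close> into questions about complex 2 by 2 matrices, and the functionals together
  determine the entries.\<close>

lemma dual_phi:
  assumes "\<xi> \<in> dual s"
  shows "\<xi> (phi M $ i $ j) = pack (M *v vals \<xi>) $ i $ j"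
proof -
  have "pack (M *v vals \<xi>) $ i $ j = pack (\<Sum>a\<in>UNIV. vals \<xi> $ a *s column a M) $ i $ j"
    by (simp add: matrix_mult_sum[of M "vals \<xi>"])
  also have "\<dots> = (\<Sum>a\<in>UNIV. vals \<xi> $ a * pack (column a M) $ i $ j)"
    by (simp add: pack_sum pack_smult)
  finally show ?thesis
    by (simp add: phi_def dual_simps[OF assms] vals_def mult.commute)
qed

lemma crd_phi: "crd a (phi M $ i $ j) = pack (column a M) $ i $ j"
proof -
  have "M *v axis a 1 = column a M"
    by (simp add: vec_eq_iff matrix_vector_mult_def column_def axis_def if_distrib cong: if_cong)
  then show ?thesis using dual_phi[OF crd_dual, of a M i j] by (simp add: vals_crd)
qed

definition quad :: "complex^4^4 \<Rightarrow> ('v \<Rightarrow> complex) \<Rightarrow> complex" where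
  "quad Q = (\<lambda>\<xi>. if \<xi> \<in> dual s then bil Q (vals \<xi>) (vals \<xi>) else 0)"

lemma kron_det_apply:
  "\<xi> \<in> dual s \<Longrightarrow> kron_det s \<phi> \<xi> = det (\<chi> i j. \<xi> (\<phi> $ i $ j))"
  "\<xi> \<notin> dual s \<Longrightarrow> kron_det s \<phi> \<xi> = 0"
  by (simp_all add: kron_det_def sym_mult_def det_2 fun_diff_def)

lemma kron_det_phi: "kron_det s (phi M) = quad (gram M)"
proof
  fix \<xi>
  show "kron_det s (phi M) \<xi> = quad (gram M) \<xi>"
  proof (cases "\<xi> \<in> dual s")
    case True
    have "(\<chi> i j. \<xi> (phi M $ i $ j)) = pack (M *v vals \<xi>)"
      by (simp add: vec_eq_iff dual_phi[OF True])
    then show ?thesis using True by (simp add: kron_det_apply(1) det_pack quad_def bil_gram)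
  qed (simp add: kron_det_apply(2) quad_def)
qed

lemma wedge4_expand: "wedge4 s u = fun_scale (det (\<chi> a j. crd a (u $ j))) (wedge4 s b)"
proof
  fix \<xi> :: "('v \<Rightarrow> complex)^4"
  show "wedge4 s u \<xi> = fun_scale (det (\<chi> a j. crd a (u $ j))) (wedge4 s b) \<xi>"
  proof (cases "\<forall>i. \<xi> $ i \<in> dual s")
    case True
    have "(\<chi> i j. (\<xi> $ i) (u $ j)) = (\<chi> i a. (\<xi> $ i) (b $ a)) ** (\<chi> a j. crd a (u $ j))"
    proof -
      have "(\<xi> $ i) (u $ j) = (\<Sum>a\<in>UNIV. (\<xi> $ i) (b $ a) * crd a (u $ j))" for i j
        by (subst dual_expand[of "\<xi> $ i" "u $ j"]) (use True in \<open>simp_all add: mult.commute\<close>)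
      then show ?thesis by (simp only: vec_eq_iff matrix_matrix_mult_def vec_lambda_beta simp_thms)
    qed
    then show ?thesis using True by (simp add: wedge4_def fun_scale_def det_mul)
  next
    case False
    then show ?thesis by (simp only: wedge4_def fun_scale_def if_not_P) simp
  qed
qed

lemma wedge4_basis: "wedge4 s b (\<chi> a. crd a) = 1"
proof -
  have "(\<chi> i j. crd i (b $ j)) = (mat 1 :: complex^4^4)" by (simp add: vec_eq_iff mat_def crd_basis)
  then show ?thesis by (simp add: wedge4_def crd_dual)
qed

lemma kron_e_phi: "kron_e s (phi M) = fun_scale (4 * det M) (wedge4 s b)"
proof -
  \<comment> \<open>The columns of \<open>T\<close> express the entries 11, 22, 12 and 21, in the
    order used by \<open>kron_e\<close>, through the four vectors \<open>m\<close>. Its determinant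
    is the origin of the factor 4.\<close>
  define T :: "complex^4^4" where
    "T = vector [vector [1, 1, 0, 0], vector [\<i>, - \<i>, 0, 0], vector [0, 0, 1, -1], vector [0, 0, \<i>, \<i>]]"
  have "(\<chi> a j. crd a (vector [phi M $ 1 $ 1, phi M $ 2 $ 2, phi M $ 1 $ 2, phi M $ 2 $ 1] $ j)) = transpose M ** T"
    by (simp add: vec_eq_iff forall_4 vector_4 crd_phi pack_nth T_def matrix_matrix_mult_def transpose_def sum_4 column_def)
  moreover have "det T = 4"
    by (simp add: det_4 T_def vector_4)
  ultimately show ?thesis
    unfolding kron_e_def by (subst wedge4_expand) (simp add: det_mul mult.commute)
qed

definition mu :: "'v^2^2 \<Rightarrow> 'v sym_wedge" where
  "mu \<phi> = (kron_det s \<phi>, kron_e s \<phi>)"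

lemma mu_phi: "mu (phi M) = (quad (gram M), fun_scale (4 * det M) (wedge4 s b))"
  by (simp add: mu_def kron_det_phi kron_e_phi)

lemma vector_space_pair_scale: "vector_space (pair_scale :: complex \<Rightarrow> 'v sym_wedge \<Rightarrow> _)"
  by standard (auto simp: pair_scale_def fun_scale_def fun_eq_iff algebra_simps)

lemma sum_fun_apply: "(\<Sum>i\<in>I. f i) x = (\<Sum>i\<in>I. f i x)" for f :: "'i \<Rightarrow> 'b \<Rightarrow> complex"
  by (induction I rule: infinite_finite_induct) auto

lemma quad_expand:
  "quad Q = (\<Sum>a\<in>UNIV. \<Sum>c\<in>UNIV. fun_scale (Q $ a $ c) (sym_mult s (b $ a) (b $ c)))"
  by (auto simp: quad_def sum_fun_apply fun_scale_def sym_mult_def bil_def vals_def ac_simps intro!: ext)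

lemma pair_functional_quad_wedge:
  assumes "\<xi> \<in> dual pair_scale"
  shows "\<xi> (quad Q, fun_scale c (wedge4 s b)) =
    (\<Sum>a\<in>UNIV. \<Sum>d\<in>UNIV. Q $ a $ d * \<xi> (sym_mult s (b $ a) (b $ d), 0)) + c * \<xi> (0, wedge4 s b)"
proof -
  have add: "\<xi> (u + v) = \<xi> u + \<xi> v" and scale: "\<xi> (pair_scale c v) = c * \<xi> v" for u v c
    using assms unfolding dual_iff by blast+
  have 0: "\<xi> 0 = 0" using add[of 0 0] by simp
  have sum: "\<xi> (\<Sum>i\<in>I. f i) = (\<Sum>i\<in>I. \<xi> (f i))" for I :: "4 set" and f
    by (induction I rule: infinite_finite_induct) (simp_all add: 0 add)
  have fstsum: "(\<Sum>i\<in>I. f i, 0) = (\<Sum>i\<in>I. (f i, 0))" for I :: "4 set" and f :: "4 \<Rightarrow> ('v \<Rightarrow> complex) \<Rightarrow> complex"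
    by (simp only: sum_prod sum.neutral_const)
  have q: "(quad Q, 0) = (\<Sum>a\<in>UNIV. \<Sum>d\<in>UNIV. pair_scale (Q $ a $ d) (sym_mult s (b $ a) (b $ d), 0))"
    by (simp add: quad_expand fstsum pair_scale_def)
  have "(quad Q, fun_scale c (wedge4 s b)) = (quad Q, 0) + pair_scale c (0, wedge4 s b)"
    by (simp add: pair_scale_def)
  then show ?thesis by (simp only: add scale q sum)
qed

lemma phi_inv_entry: "(\<lambda>\<phi>. phi_inv \<phi> $ k $ a) \<in> poly_funs mat_scale"
proof -
  have "(\<lambda>\<phi>. crd a (\<phi> $ i $ j)) \<in> dual mat_scale" for i j
    by (simp add: dual_iff vector_space_mat_scale vec_scale_def dual_simps[OF crd_dual])
  then have c: "(\<lambda>\<phi>. crd a (\<phi> $ i $ j)) \<in> gen_algebra (dual mat_scale)" for i j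
    by (rule gen_algebra.gen)
  have "\<forall>k. (\<lambda>\<phi>. unpack (\<chi> i j. crd a (\<phi> $ i $ j)) $ k) \<in> gen_algebra (dual mat_scale)"
    unfolding forall_4 unpack_def vector_4
    using gen_algebra_cmult[OF gen_algebra.add[OF c[of 1 1] c[of 2 2]], of "1/2"]
      gen_algebra_cmult[OF gen_algebra_diff[OF c[of 1 1] c[of 2 2]], of "- \<i>/2"]
      gen_algebra_cmult[OF gen_algebra_diff[OF c[of 1 2] c[of 2 1]], of "1/2"]
      gen_algebra_cmult[OF gen_algebra.add[OF c[of 1 2] c[of 2 1]], of "- \<i>/2"]
    by simp
  then show ?thesis unfolding poly_funs_eq_gen_algebra phi_inv_def by simp
qed

lemma compose_phi_inv:
  assumes "f \<in> gen_algebra entries"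
  shows "(\<lambda>\<phi>. f (phi_inv \<phi>)) \<in> poly_funs mat_scale"
  unfolding poly_funs_eq_gen_algebra using assms
  by (rule gen_algebra_compose) (auto simp: entries_def phi_inv_entry[unfolded poly_funs_eq_gen_algebra])

lemma mu_poly:
  assumes "F \<in> poly_funs pair_scale"
  shows "(\<lambda>\<phi>. F (mu \<phi>)) \<in> poly_funs mat_scale"
proof -
  have "(\<lambda>M. F (mu (phi M))) \<in> gen_algebra entries"
    using assms unfolding poly_funs_eq_gen_algebra
  proof (rule gen_algebra_compose)
    fix \<xi> :: "'v sym_wedge \<Rightarrow> complex" assume \<xi>: "\<xi> \<in> dual pair_scale"
    have "(\<lambda>M. (\<Sum>a\<in>UNIV. \<Sum>d\<in>UNIV. gram M $ a $ d * \<xi> (sym_mult s (b $ a) (b $ d), 0))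
        + 4 * det M * \<xi> (0, wedge4 s b)) \<in> gen_algebra entries"
      by (intro gen_algebra.add gen_algebra_sum gen_algebra.mult gram_entry_in_gen_algebra gen_algebra.const
          det_in_gen_algebra)
    then show "(\<lambda>M. \<xi> (mu (phi M))) \<in> gen_algebra entries"
      unfolding mu_phi pair_functional_quad_wedge[OF \<xi>] .
  qed
  from compose_phi_inv[OF this] show ?thesis by (simp add: phi_phi_inv)
qed

lemma phi_poly:
  assumes "f \<in> poly_funs mat_scale"
  shows "(\<lambda>M. f (phi M)) \<in> gen_algebra entries"
  using assms unfolding poly_funs_eq_gen_algebra
proof (rule gen_algebra_compose)
  fix \<xi> assume "\<xi> \<in> dual mat_scale"
  then have add: "\<xi> (u + v) = \<xi> u + \<xi> v" and scale: "\<xi> (mat_scale c v) = c * \<xi> v" for u v c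
    by (simp_all add: dual_iff)
  have 0: "\<xi> 0 = 0" using add[of 0 0] by simp
  have sum: "\<xi> (\<Sum>i\<in>I. f i) = (\<Sum>i\<in>I. \<xi> (f i))" for I :: "4 set" and f
    by (induction I rule: infinite_finite_induct) (simp_all add: 0 add)
  define E where "E k a = phi (\<chi> i j. of_bool (i = k) * of_bool (j = a))" for k a
  have phi_add: "phi (M + N) = phi M + phi N" for M N
  proof -
    have col: "column a (M + N) = column a M + column a N" for a by (simp add: column_def vec_eq_iff)
    show ?thesis
      by (simp only: phi_def col pack_add) (simp add: vec_eq_iff scale_left_distrib sum.distrib)
  qed
  have phi_0: "phi 0 = 0" using phi_add[of 0 0] by simp
  have phi_scale: "phi (\<chi> i j. c * M $ i $ j) = mat_scale c (phi M)" for c M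
  proof -
    have col: "column a (\<chi> i j. c * M $ i $ j) = c *s column a M" for a by (simp add: column_def vec_eq_iff)
    show ?thesis
      by (simp only: phi_def col pack_smult) (simp add: vec_eq_iff vec_scale_def scale_sum_right)
  qed
  have phi_sum: "phi (\<Sum>i\<in>I. f i) = (\<Sum>i\<in>I. phi (f i))" for I :: "4 set" and f
    by (induction I rule: infinite_finite_induct) (simp_all add: phi_0 phi_add)
  have "\<xi> (phi M) = (\<Sum>k\<in>UNIV. \<Sum>a\<in>UNIV. M $ k $ a * \<xi> (E k a))" for M
  proof -
    have "M = (\<Sum>k\<in>UNIV. \<Sum>a\<in>UNIV. (\<chi> i j. M $ k $ a * (\<chi> i j. of_bool (i = k) * of_bool (j = a)) $ i $ j))"
    proof -
      have "(\<Sum>k\<in>UNIV. \<Sum>a\<in>UNIV. M $ k $ a * (of_bool (i = k) * of_bool (j = a))) = M $ i $ j" for i j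
      proof -
        have "(\<Sum>k\<in>UNIV. \<Sum>a\<in>UNIV. M $ k $ a * (of_bool (i = k) * of_bool (j = a)))
            = (\<Sum>k\<in>UNIV. if k = i then (\<Sum>a\<in>UNIV. if a = j then M $ i $ j else 0) else 0)"
          by (intro sum.cong refl) (auto intro!: sum.cong)
        then show ?thesis by simp
      qed
      then show ?thesis by (simp only: vec_eq_iff sum_component vec_lambda_beta simp_thms)
    qed
    then have "phi M = phi (\<Sum>k\<in>UNIV. \<Sum>a\<in>UNIV. (\<chi> i j. M $ k $ a * (\<chi> i j. of_bool (i = k) * of_bool (j = a)) $ i $ j))"
      by (rule arg_cong)
    also have "\<dots> = (\<Sum>k\<in>UNIV. \<Sum>a\<in>UNIV. mat_scale (M $ k $ a) (E k a))"
      by (simp only: phi_sum phi_scale E_def)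
    finally show ?thesis by (simp only: sum scale)
  qed
  then show "(\<lambda>M. \<xi> (phi M)) \<in> gen_algebra entries"
    by (simp only:) (intro gen_algebra_sum gen_algebra.mult entry_in_gen_algebra gen_algebra.const)
qed

text \<open>Polarization recovers the symmetric matrix of a quadratic form from its values. The
  result is linear in \<open>y\<close>, so composing with it keeps polynomials polynomial.\<close>

definition kap :: "'v sym_wedge \<Rightarrow> complex^4^4" where
  "kap y = (\<chi> a c. (fst y (crd a + crd c) - fst y (crd a) - fst y (crd c)) / 2)"

lemma kap_quad:
  assumes "\<And>a c. Q $ a $ c = Q $ c $ a"
  shows "kap (quad Q, p) = Q"
  by (simp add: vec_eq_iff kap_def quad_def dual_add crd_dual vals_add vals_crd bil_simps bil_axis assms[of _ _])

lemma gram_sym: "gram M $ a $ c = gram M $ c $ a" for M :: "complex^4^4"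
  by (simp add: gram_nth mult.commute)

text \<open>The Gram matrix is read off from \<open>q\<close> by \<open>kap\<close>, and the
  determinant from the value of \<open>p\<close> at the coordinate functionals; the factor 1/4
  undoes the 4 in \<open>kron_e_phi\<close>.\<close>

lemma lift_invariant:
  assumes F: "F \<in> gen_algebra entries" and G: "G \<in> gen_algebra entries"
  shows "\<exists>H\<in>poly_funs pair_scale. \<forall>M. F (gram M) + det M * G (gram M) = H (mu (phi M))"
proof -
  have ev: "(\<lambda>y::'v sym_wedge. fst y \<xi>) \<in> gen_algebra (dual pair_scale)" for \<xi>
    by (rule gen_algebra.gen)
      (simp add: dual_iff vector_space_pair_scale, simp add: pair_scale_def case_prod_unfold fun_scale_def)
  have ev': "(\<lambda>y::'v sym_wedge. snd y \<xi>) \<in> gen_algebra (dual pair_scale)" for \<xi>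
    by (rule gen_algebra.gen)
      (simp add: dual_iff vector_space_pair_scale, simp add: pair_scale_def case_prod_unfold fun_scale_def)
  have kap: "(\<lambda>y. kap y $ a $ c) \<in> gen_algebra (dual pair_scale)" for a c
    using gen_algebra_cmult[OF gen_algebra_diff[OF gen_algebra_diff[OF ev ev] ev], of "1/2" "crd a + crd c" "crd a" "crd c"]
    by (simp add: kap_def)
  have comp: "(\<lambda>y. f (kap y)) \<in> gen_algebra (dual pair_scale)" if "f \<in> gen_algebra entries" for f
    using that by (rule gen_algebra_compose) (auto simp: entries_def kap)
  define H where "H y = F (kap y) + (1 / 4) * snd y (\<chi> a. crd a) * G (kap y)" for y
  have "H \<in> poly_funs pair_scale"
    unfolding H_def poly_funs_eq_gen_algebra
    by (intro gen_algebra.add gen_algebra.mult comp F G ev' gen_algebra.const)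
  moreover have "F (gram M) + det M * G (gram M) = H (mu (phi M))" for M
    unfolding H_def mu_phi kap_quad[OF gram_sym] by (simp add: fun_scale_def wedge4_basis)
  ultimately show ?thesis by blast
qed

end

section \<open>Semistability and the determinant\<close>

lemma det_add_2:
  "det (A + B) = det A + det B + (A$1$1 * B$2$2 + B$1$1 * A$2$2 - A$1$2 * B$2$1 - B$1$2 * A$2$1)"
  for A B :: "complex^2^2"
  by (simp add: det_2 algebra_simps)

lemma ex_ker_2:
  fixes A :: "complex^2^2"
  assumes "det A = 0"
  obtains a where "a \<noteq> 0" "A *v a = 0"
proof -
  have "\<not> invertible A" using assms by (simp add: invertible_det_nz)
  then have "\<not> (\<forall>x. A *v x = 0 \<longrightarrow> x = 0)"
    unfolding invertible_left_inverse matrix_left_invertible_ker .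
  then show ?thesis using that by blast
qed

lemma ex_invertible_2:
  fixes a :: "complex^2"
  assumes "a \<noteq> 0"
  obtains P :: "complex^2^2" where "det P \<noteq> 0" "P *v axis 1 1 = a"
proof -
  \<comment> \<open>The second column is orthogonal to \<open>a\<close> for the Hermitian product,
    so the determinant is the squared length of \<open>a\<close>.\<close>
  define P :: "complex^2^2" where "P = vector [vector [a$1, - cnj (a$2)], vector [a$2, cnj (a$1)]]"
  have "det P = a$1 * cnj (a$1) + a$2 * cnj (a$2)"
    by (simp add: det_2 P_def algebra_simps)
  also have "\<dots> = of_real ((cmod (a$1))\<^sup>2 + (cmod (a$2))\<^sup>2)"
    by (simp only: complex_norm_square of_real_add)
  also have "\<dots> \<noteq> 0"
    using assms by (subst of_real_eq_0_iff) (auto simp: vec_eq_iff forall_2 add_nonneg_eq_0_iff)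
  finally have "det P \<noteq> 0" .
  moreover have "P *v axis 1 1 = a"
    by (simp add: vec_eq_iff forall_2 P_def matrix_vector_mult_def sum_2 axis_def)
  ultimately show ?thesis by (rule that)
qed

text \<open>Choose bases such that a nonzero member of the space of singular matrices has
  its only nonzero entry in the lower right corner. Polarizing the determinant, all members then have
  a zero in the upper left corner, and one of the two other corners vanishes for all of them.\<close>

lemma singular_pencil:
  fixes D :: "'i \<Rightarrow> complex^2^2"
  assumes sing: "\<And>i j. det (D i + D j) = 0"
  shows "(\<exists>a. a \<noteq> 0 \<and> (\<forall>i. D i *v a = 0)) \<or> (\<exists>a. a \<noteq> 0 \<and> (\<forall>i. transpose (D i) *v a = 0))"
proof (cases "\<forall>i. D i = 0")
  case True
  have "axis 1 1 \<noteq> (0 :: complex^2)" by (simp add: axis_eq_0_iff)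
  then show ?thesis using True by (intro disjI1 exI[of _ "axis 1 1"]) simp
next
  case False
  then obtain l where l: "D l \<noteq> 0" by blast
  have det0: "det (D i) = 0" for i
  proof -
    have "det (D i + D i) = 4 * det (D i)" by (simp add: det_2 algebra_simps)
    then show ?thesis using sing[of i i] by simp
  qed
  obtain a where a: "a \<noteq> 0" "D l *v a = 0" using ex_ker_2[OF det0] by blast
  have "det (transpose (D l)) = 0" using det0 by simp
  then obtain c where c: "c \<noteq> 0" "transpose (D l) *v c = 0" using ex_ker_2 by blast
  obtain A where A: "det A \<noteq> 0" "A *v axis 1 1 = a" using ex_invertible_2[OF a(1)] by blast
  obtain P where P: "det P \<noteq> 0" "P *v axis 1 1 = c" using ex_invertible_2[OF c(1)] by blast
  define E where "E i = transpose P ** (D i ** A)" for i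
  have E_add: "E i + E j = transpose P ** ((D i + D j) ** A)" for i j
    by (simp add: E_def vec_eq_iff matrix_matrix_mult_def distrib_right distrib_left sum.distrib)
  have "det (E i + E j) = 0" "det (E i) = 0" for i j
    unfolding E_add by (simp_all add: E_def det_mul sing det0)
  then have pol: "E i $ 1 $ 1 * E j $ 2 $ 2 + E j $ 1 $ 1 * E i $ 2 $ 2 - E i $ 1 $ 2 * E j $ 2 $ 1 - E j $ 1 $ 2 * E i $ 2 $ 1 = 0" for i j
    using det_add_2[of "E i" "E j"] by simp
  have col1: "E i *v axis 1 1 = transpose P *v (D i *v a)" for i
    by (simp add: E_def matrix_vector_mul_assoc[symmetric] A(2))
  have row1: "transpose (E i) *v axis 1 1 = transpose A *v (transpose (D i) *v c)" for i
    by (simp only: E_def matrix_transpose_mul transpose_transpose matrix_vector_mul_assoc[symmetric] P(2))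
  have col_nth: "(F *v axis 1 1) $ k = F $ k $ 1" for F :: "complex^2^2" and k
    by (simp add: matrix_vector_mult_def axis_def if_distrib cong: if_cong)
  have Eo: "E l $ 1 $ 1 = 0" "E l $ 2 $ 1 = 0" "E l $ 1 $ 2 = 0"
    using col1[of l] row1[of l] a(2) c(2) col_nth[of "E l" 1] col_nth[of "E l" 2] col_nth[of "transpose (E l)" 2]
    by (simp_all add: transpose_def)
  have invP: "invertible (transpose P)" and invA: "invertible A" and invA': "invertible (transpose A)"
    using A P by (simp_all add: invertible_det_nz)
  have ker: "x = 0" if "invertible F" "F *v x = 0" for F :: "complex^2^2" and x
    using that by (simp only: invertible_left_inverse matrix_left_invertible_ker)
  have "E l \<noteq> 0"
  proof
    assume "E l = 0"
    then have "transpose P ** (D l ** A) = 0" by (simp add: E_def)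
    obtain P' where P': "P' ** transpose P = mat 1" using invP invertible_left_inverse by blast
    obtain A' where A': "A ** A' = mat 1" using invA invertible_right_inverse by blast
    have "P' ** (transpose P ** (D l ** A)) ** A' = (P' ** transpose P) ** D l ** (A ** A')"
      by (simp only: matrix_mul_assoc)
    then have "D l = 0"
      using \<open>transpose P ** (D l ** A) = 0\<close> by (simp add: P' A')
    then show False using l by contradiction
  qed
  then have e: "E l $ 2 $ 2 \<noteq> 0" using Eo by (auto simp: vec_eq_iff forall_2)
  \<comment> \<open>In the polarized relation with \<open>E l\<close>, only its lower right entry
    contributes.\<close>
  have E11: "E i $ 1 $ 1 = 0" for i using pol[of i l] Eo e by simp
  have "(\<forall>i. E i $ 2 $ 1 = 0) \<or> (\<forall>i. E i $ 1 $ 2 = 0)"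
  proof (rule ccontr)
    assume "\<not> ((\<forall>i. E i $ 2 $ 1 = 0) \<or> (\<forall>i. E i $ 1 $ 2 = 0))"
    then obtain i j where ij: "E i $ 2 $ 1 \<noteq> 0" "E j $ 1 $ 2 \<noteq> 0" by blast
    have "E i $ 1 $ 2 = 0" "E j $ 2 $ 1 = 0" using pol[of i i] pol[of j j] E11 ij by auto
    then show False using pol[of i j] E11 ij by auto
  qed
  then show ?thesis
  proof
    assume *: "\<forall>i. E i $ 2 $ 1 = 0"
    have "E i *v axis 1 1 = 0" for i
      unfolding vec_eq_iff forall_2 col_nth using * E11 by simp
    then have "D i *v a = 0" for i unfolding col1 by (rule ker[OF invP])
    then show ?thesis using a(1) by blast
  next
    assume *: "\<forall>i. E i $ 1 $ 2 = 0"
    have "transpose (E i) *v axis 1 1 = 0" for i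
      unfolding vec_eq_iff forall_2 col_nth using * E11 by (simp add: transpose_def)
    then have "transpose (D i) *v c = 0" for i unfolding row1 by (rule ker[OF invA'])
    then show ?thesis using c(1) by blast
  qed
qed

lemma dim_span_singleton: "a \<noteq> 0 \<Longrightarrow> vec.dim (vec.span {a}) = 1" for a :: "complex^'n"
  by (simp add: vec.dim_span vec.dim_singleton)

lemma dim_UNIV_2: "vec.dim (UNIV :: (complex^2) set) = 2"
  by (simp add: vec.dim_UNIV card_cart_basis)

context frame
begin

lemma ext_by_dual:
  assumes "\<And>\<xi>. \<xi> \<in> dual s \<Longrightarrow> \<xi> u = \<xi> v"
  shows "u = v"
proof -
  have "(\<Sum>a\<in>UNIV. s (crd a u) (b $ a)) = (\<Sum>a\<in>UNIV. s (crd a v) (b $ a))"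
    using assms[OF crd_dual] by simp
  then show ?thesis by (simp add: crd_expand)
qed

abbreviation slice :: "('v \<Rightarrow> complex) \<Rightarrow> 'v^2^2 \<Rightarrow> complex^2^2" where
  "slice \<xi> \<phi> \<equiv> (\<chi> i j. \<xi> (\<phi> $ i $ j))"

lemma dual_kron_apply:
  assumes "\<xi> \<in> dual s"
  shows "\<xi> (kron_apply s \<phi> a $ i) = (slice \<xi> \<phi> *v a) $ i"
  by (simp add: kron_apply_def dual_simps[OF assms] matrix_vector_mult_def mult.commute)

text \<open>Contracting the second tensor factor with a functional maps the subspace spanned by
  \<open>B\<close> back into \<open>B\<close>.\<close>

lemma tensor_subspace_slice:
  fixes B :: "(complex^2) set"
  assumes \<xi>: "\<xi> \<in> dual s" and B: "vec.subspace B" and u: "u \<in> tensor_subspace s B"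
  shows "(\<chi> i. \<xi> (u $ i)) \<in> B"
proof -
  interpret vs2: vector_space "vec_scale s :: complex \<Rightarrow> 'v^2 \<Rightarrow> _"
    by (rule vector_space_vec_scale[OF vector_space_s])
  show ?thesis
    using u unfolding tensor_subspace_def
  proof (rule vs2.span_induct)
    fix v assume "v \<in> {\<chi> i. s (c $ i) v |c v. c \<in> B}"
    then obtain c w where "v = (\<chi> i. s (c $ i) w)" "c \<in> B" by blast
    then have "(\<chi> i. \<xi> (v $ i)) = \<xi> w *s c"
      by (simp add: vec_eq_iff dual_simps[OF \<xi>] mult.commute)
    then show "(\<chi> i. \<xi> (v $ i)) \<in> B" using vec.subspace_scale[OF B \<open>c \<in> B\<close>] by simp
  next
    have lin: "(\<chi> i. \<xi> ((u + v) $ i)) = (\<chi> i. \<xi> (u $ i)) + (\<chi> i. \<xi> (v $ i))"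
      "(\<chi> i. \<xi> (vec_scale s c u $ i)) = c *s (\<chi> i. \<xi> (u $ i))" for u v :: "'v^2" and c
      by (simp_all add: vec_eq_iff dual_simps[OF \<xi>] vec_scale_def)
    have lin0: "(\<chi> i. \<xi> ((0 :: 'v^2) $ i)) = 0" by (simp add: vec_eq_iff dual_simps[OF \<xi>])
    show "vs2.subspace {u. (\<chi> i. \<xi> (u $ i)) \<in> B}"
      unfolding vs2.subspace_def mem_Collect_eq lin lin0
      using vec.subspace_0[OF B] vec.subspace_add[OF B] vec.subspace_scale[OF B] by blast
  qed
qed

text \<open>Some functional turns \<phi> into an invertible 2 by 2 matrix, and this matrix embeds
  \<open>A\<close> into \<open>B\<close>.\<close>

lemma semistable_if:
  fixes \<phi> :: "'v^2^2"
  assumes "kron_det s \<phi> \<noteq> 0"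
  shows "semistable s \<phi>"
  unfolding semistable_def
proof (intro allI impI)
  fix A B :: "(complex^2) set"
  assume AB: "vec.subspace A \<and> vec.subspace B \<and> kron_apply s \<phi> ` A \<subseteq> tensor_subspace s B \<and>
    (A, B) \<noteq> ({0}, {0}) \<and> (A, B) \<noteq> (UNIV, UNIV)"
  obtain \<xi> where "kron_det s \<phi> \<xi> \<noteq> 0" using assms by (auto simp: fun_eq_iff)
  then have \<xi>: "\<xi> \<in> dual s" "det (slice \<xi> \<phi>) \<noteq> 0"
    using kron_det_apply[of \<xi> \<phi>] by (metis, metis)
  have "(*v) (slice \<xi> \<phi>) ` A \<subseteq> B"
  proof (intro image_subsetI)
    fix a assume "a \<in> A"
    then have "(\<chi> i. \<xi> (kron_apply s \<phi> a $ i)) \<in> B"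
      using AB by (intro tensor_subspace_slice[OF \<xi>(1)]) auto
    then show "slice \<xi> \<phi> *v a \<in> B" unfolding dual_kron_apply[OF \<xi>(1)] by simp
  qed
  then have "vec.dim ((*v) (slice \<xi> \<phi>) ` A) \<le> vec.dim B" by (rule vec.dim_subset)
  moreover have "vec.dim ((*v) (slice \<xi> \<phi>) ` A) = vec.dim A"
  proof (rule vec.dim_image_eq)
    show "Vector_Spaces.linear (*s) (*s) ((*v) (slice \<xi> \<phi>))" by (rule matrix_vector_mul_linear_gen)
    show "inj_on ((*v) (slice \<xi> \<phi>)) (vec.span A)"
      using \<xi>(2) inj_on_subset[of "(*v) (slice \<xi> \<phi>)" UNIV]
      by (metis invertible_det_nz invertible_left_inverse matrix_left_invertible_injective subset_UNIV)
  qed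
  ultimately show "CARD(2) * vec.dim A \<le> CARD(2) * vec.dim B" by simp
qed

text \<open>If the determinant is 0, all slices are singular, and they are closed under addition. So
  they share a kernel vector, and a line is mapped to 0, or their transposes do, and the whole plane
  is mapped into a line tensored with \<open>V\<close>. Either pair of subspaces violates
  semistability.\<close>

lemma semistable_only_if:
  fixes \<phi> :: "'v^2^2"
  assumes ss: "semistable s \<phi>"
  shows "kron_det s \<phi> \<noteq> 0"
proof
  assume 0: "kron_det s \<phi> = 0"
  interpret vs2: vector_space "vec_scale s :: complex \<Rightarrow> 'v^2 \<Rightarrow> _"
    by (rule vector_space_vec_scale[OF vector_space_s])
  define D where "D t = slice (functional t) \<phi>" for t
  have "det (D t) = 0" for t
    unfolding D_def kron_det_apply(1)[OF functional_dual, symmetric] 0 by simp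
  moreover have "D t + D u = D (t + u)" for t u
    by (simp add: D_def functional_def vec_eq_iff distrib_right sum.distrib)
  ultimately have sing: "det (D t + D u) = 0" for t u by simp
  have "(\<exists>a. a \<noteq> 0 \<and> (\<forall>t. D t *v a = 0)) \<or> (\<exists>c. c \<noteq> 0 \<and> (\<forall>t. transpose (D t) *v c = 0))"
    by (rule singular_pencil) (rule sing)
  then show False
  proof (elim disjE exE conjE)
    fix a assume 1: "a \<noteq> 0" "\<forall>t. D t *v a = 0"
    have ker: "kron_apply s \<phi> x = 0" if "x \<in> vec.span {a}" for x
    proof -
      obtain r where x: "x = r *s a" using \<open>x \<in> _\<close> by (auto simp: vec.span_singleton)
      have Dx: "D t *v x = 0" for t using 1(2) by (simp add: x vector_scalar_commute)
      have "slice \<xi> \<phi> *v x = 0" if "\<xi> \<in> dual s" for \<xi>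
        using Dx[of "vals \<xi>"] unfolding D_def functional_vals[OF that] .
      then have "kron_apply s \<phi> x $ i = 0" for i
        by (intro ext_by_dual) (simp add: dual_kron_apply dual_simps)
      then show ?thesis by (simp add: vec_eq_iff)
    qed
    have "kron_apply s \<phi> ` vec.span {a} \<subseteq> tensor_subspace s {0}"
      using ker vs2.span_zero unfolding tensor_subspace_def by auto
    moreover have "vec.span {a} \<noteq> {0}" using vec.span_base[of a "{a}"] 1(1) by auto
    moreover have "{0} \<noteq> (UNIV :: (complex^2) set)" using 1(1) by (metis UNIV_I singletonD)
    ultimately have "CARD(2) * vec.dim (vec.span {a}) \<le> CARD(2) * vec.dim {0 :: complex^2}"
      using ss unfolding semistable_def by (metis Pair_inject vec.subspace_single_0 vec.subspace_span)
    from this[unfolded dim_span_singleton[OF 1(1)]] show False by simp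
  next
    fix c assume 2: "c \<noteq> 0" "\<forall>t. transpose (D t) *v c = 0"
    \<comment> \<open>In dimension two, \<open>d\<close> spans the vectors annihilated by
      \<open>c\<close>, and these contain the images of all slices.\<close>
    define d :: "complex^2" where "d = vector [- c $ 2, c $ 1]"
    have d: "d \<noteq> 0" using 2(1) by (auto simp: d_def vec_eq_iff forall_2)
    have rel: "s (c $ 1) (\<phi> $ 1 $ j) + s (c $ 2) (\<phi> $ 2 $ j) = 0" for j
    proof (rule ext_by_dual)
      fix \<xi> assume \<xi>: "\<xi> \<in> dual s"
      have "(transpose (D (vals \<xi>)) *v c) $ j = 0" using 2(2) by (simp only: zero_index)
      then have "\<xi> (\<phi> $ 1 $ j) * c $ 1 + \<xi> (\<phi> $ 2 $ j) * c $ 2 = 0"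
        by (simp add: D_def functional_vals[OF \<xi>] matrix_vector_mult_def transpose_def sum_2)
      then show "\<xi> (s (c $ 1) (\<phi> $ 1 $ j) + s (c $ 2) (\<phi> $ 2 $ j)) = \<xi> 0"
        by (simp add: dual_simps[OF \<xi>] mult.commute)
    qed
    have "kron_apply s \<phi> a \<in> tensor_subspace s (vec.span {d})" for a
    proof -
      define u where "u = kron_apply s \<phi> a"
      have "s (c $ 1) (u $ 1) + s (c $ 2) (u $ 2) =
          (\<Sum>j\<in>UNIV. s (a $ j) (s (c $ 1) (\<phi> $ 1 $ j) + s (c $ 2) (\<phi> $ 2 $ j)))"
        by (simp add: u_def kron_apply_def scale_sum_right scale_right_distrib sum.distrib mult.commute)
      then have u: "s (c $ 1) (u $ 1) + s (c $ 2) (u $ 2) = 0" by (simp add: rel)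
      have "\<exists>v. u = (\<chi> i. s (d $ i) v)"
      proof (cases "c $ 1 = 0")
        case True
        then have c2: "c $ 2 \<noteq> 0" using 2(1) by (auto simp: vec_eq_iff forall_2)
        then have "u $ 2 = 0" using u True by simp
        then show ?thesis
          using c2 True by (intro exI[of _ "s (- 1 / c $ 2) (u $ 1)"]) (simp add: vec_eq_iff forall_2 d_def)
      next
        case False
        have "s (c $ 1) (u $ 1) = s (- c $ 2) (u $ 2)" using u by (simp add: eq_neg_iff_add_eq_0)
        then have "s (1 / c $ 1) (s (c $ 1) (u $ 1)) = s (1 / c $ 1) (s (- c $ 2) (u $ 2))" by simp
        then have "u $ 1 = s (- c $ 2) (s (1 / c $ 1) (u $ 2))" using False by (simp add: mult.commute)
        then show ?thesis
          using False by (intro exI[of _ "s (1 / c $ 1) (u $ 2)"]) (simp add: vec_eq_iff forall_2 d_def)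
      qed
      then obtain v where "u = (\<chi> i. s (d $ i) v)" by blast
      then show ?thesis
        unfolding u_def[symmetric] tensor_subspace_def using vec.span_base[of d "{d}"]
        by (intro vs2.span_base) auto
    qed
    then have "kron_apply s \<phi> ` UNIV \<subseteq> tensor_subspace s (vec.span {d})" by blast
    moreover have "vec.span {d} \<noteq> UNIV"
    proof
      assume "vec.span {d} = UNIV"
      from dim_span_singleton[OF d, unfolded this dim_UNIV_2] show False by simp
    qed
    moreover have "vec.span {d} \<noteq> {0}" using vec.span_base[of d "{d}"] d by auto
    ultimately have "CARD(2) * vec.dim (UNIV :: (complex^2) set) \<le> CARD(2) * vec.dim (vec.span {d})"
      using ss unfolding semistable_def by (metis Pair_inject vec.subspace_UNIV vec.subspace_span)
    from this[unfolded dim_UNIV_2 dim_span_singleton[OF d]] show False by simp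
  qed
qed

lemma semistable_iff: "semistable s \<phi> \<longleftrightarrow> kron_det s \<phi> \<noteq> 0" for \<phi> :: "'v^2^2"
  using semistable_if semistable_only_if by blast

section \<open>The cone over the hypersurface and the group action on it\<close>

definition cone :: "'v sym_wedge set" where
  "cone = Sym2 s \<times> Lambda4 s - {0}"

lemma as_polynomial_quad: "as_polynomial s b (quad Q) t = bil Q t t"
proof -
  have "(THE \<xi>. \<xi> \<in> dual s \<and> (\<forall>i. \<xi> (b $ i) = t $ i)) = functional t"
  proof (rule the_equality)
    show "functional t \<in> dual s \<and> (\<forall>i. functional t (b $ i) = t $ i)"
      by (simp add: functional_dual functional_basis)
    fix \<xi> assume \<xi>: "\<xi> \<in> dual s \<and> (\<forall>i. \<xi> (b $ i) = t $ i)"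
    then have "vals \<xi> = t" by (simp add: vals_def vec_eq_iff)
    then show "\<xi> = functional t" using functional_vals[of \<xi>] \<xi> by simp
  qed
  then show ?thesis by (simp add: as_polynomial_def quad_def functional_dual vals_functional)
qed

text \<open>The matrix of second derivatives is twice \<open>Q\<close>, which gives the factor
  \<open>2\<^sup>4\<close>. It matches the square of the factor 4 in \<open>kron_e_phi\<close>, so
  the equation of the hypersurface becomes the determinant of the Gram identity.\<close>

lemma res_quad:
  assumes sym: "\<And>a c. Q $ a $ c = Q $ c $ a"
  shows "res s b (quad Q) = 16 * det Q"
proof -
  have comm: "bil Q x y = bil Q y x" for x y by (rule bil_commute[OF sym])
  have ax: "axis i c = c *s axis i 1" for i :: 4 and c :: complex
    by (simp add: vec_eq_iff axis_def)
  have d1: "partial_deriv j (as_polynomial s b (quad Q)) t = 2 * bil Q (axis j 1) t" for j t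
  proof -
    have "as_polynomial s b (quad Q) (t + axis j c) = bil Q t t + c * (2 * bil Q (axis j 1) t) + c * c * bil Q (axis j 1) (axis j 1)" for c
      unfolding as_polynomial_quad ax[of j c] bil_simps comm[of t "axis j 1"] by (simp add: algebra_simps)
    then show ?thesis
      unfolding partial_deriv_def by (auto intro!: DERIV_imp_deriv derivative_eq_intros)
  qed
  have d2: "partial_deriv i (partial_deriv j (as_polynomial s b (quad Q))) 0 = 2 * Q $ i $ j" for i j
  proof -
    have "partial_deriv j (as_polynomial s b (quad Q)) (0 + axis i c) = c * (2 * bil Q (axis j 1) (axis i 1))" for c
      unfolding d1 ax[of i c] add_0 bil_simps by simp
    then have "partial_deriv i (partial_deriv j (as_polynomial s b (quad Q))) 0 = 2 * bil Q (axis j 1) (axis i 1)"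
      unfolding partial_deriv_def[of i] by (auto intro!: DERIV_imp_deriv derivative_eq_intros)
    then show ?thesis by (simp add: bil_axis sym[of i j])
  qed
  have "res s b (quad Q) = det (\<chi> i j. 2 * Q $ i $ j)" unfolding res_def d2 ..
  also have "\<dots> = 16 * det Q"
    unfolding det_4 by (simp add: algebra_simps)
  finally show ?thesis .
qed

lemma Sym2_quad:
  assumes "q \<in> Sym2 s"
  obtains Q where "q = quad Q" "\<And>a c. Q $ a $ c = Q $ c $ a"
proof -
  interpret fs: vector_space "fun_scale :: complex \<Rightarrow> (('v \<Rightarrow> complex) \<Rightarrow> complex) \<Rightarrow> _" by (rule vector_space_fun_scale)
  have "\<exists>Q. q = quad Q \<and> (\<forall>a c. Q $ a $ c = Q $ c $ a)"
    using assms unfolding Sym2_def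
  proof (rule fs.span_induct)
    fix q assume "q \<in> {sym_mult s u v |u v. True}"
    then obtain u v where q: "q = sym_mult s u v" by blast
    define Q :: "complex^4^4" where "Q = (\<chi> a c. (crd a u * crd c v + crd c u * crd a v) / 2)"
    have "quad Q \<xi> = q \<xi>" for \<xi>
    proof (cases "\<xi> \<in> dual s")
      case True
      have "bil Q (vals \<xi>) (vals \<xi>) = (\<Sum>a\<in>UNIV. \<Sum>c\<in>UNIV. (crd a u * \<xi> (b $ a)) * (crd c v * \<xi> (b $ c)) / 2)
          + (\<Sum>a\<in>UNIV. \<Sum>c\<in>UNIV. (crd c u * \<xi> (b $ c)) * (crd a v * \<xi> (b $ a)) / 2)"
        unfolding bil_def sum.distrib[symmetric] by (intro sum.cong refl) (simp add: Q_def vals_def field_simps)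
      also have "(\<Sum>a\<in>UNIV. \<Sum>c\<in>UNIV. (crd c u * \<xi> (b $ c)) * (crd a v * \<xi> (b $ a)) / 2)
          = (\<Sum>a\<in>UNIV. \<Sum>c\<in>UNIV. (crd a u * \<xi> (b $ a)) * (crd c v * \<xi> (b $ c)) / 2)"
        by (rule sum.swap)
      also have "(\<Sum>a\<in>UNIV. \<Sum>c\<in>UNIV. (crd a u * \<xi> (b $ a)) * (crd c v * \<xi> (b $ c)) / 2) = \<xi> u * \<xi> v / 2"
        by (simp only: dual_expand[OF True, of u] dual_expand[OF True, of v] sum_product sum_divide_distrib)
      finally show ?thesis using True by (simp add: quad_def q sym_mult_def)
    qed (simp add: quad_def q sym_mult_def)
    then have "q = quad Q" by (simp add: fun_eq_iff)
    moreover have "Q $ a $ c = Q $ c $ a" for a c by (simp add: Q_def)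
    ultimately show "\<exists>Q. q = quad Q \<and> (\<forall>a c. Q $ a $ c = Q $ c $ a)" by blast
  next
    have 0: "0 = quad 0" by (auto simp: quad_def bil_def)
    have add: "quad Q + quad R = quad (Q + R)" for Q R
      by (auto simp: quad_def bil_def algebra_simps sum.distrib)
    have scale: "fun_scale r (quad Q) = quad (\<chi> a c. r * Q $ a $ c)" for r Q
      by (auto simp: quad_def bil_def fun_scale_def sum_distrib_left mult.left_commute mult.assoc)
    show "fs.subspace {q. \<exists>Q. q = quad Q \<and> (\<forall>a c. Q $ a $ c = Q $ c $ a)}"
      unfolding fs.subspace_def mem_Collect_eq
    proof (intro conjI ballI allI)
      show "\<exists>Q. 0 = quad Q \<and> (\<forall>a c. Q $ a $ c = Q $ c $ a)" using 0 by (intro exI[of _ 0]) simp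
    next
      fix q r
      assume "q \<in> {q. \<exists>Q. q = quad Q \<and> (\<forall>a c. Q $ a $ c = Q $ c $ a)}" "r \<in> {q. \<exists>Q. q = quad Q \<and> (\<forall>a c. Q $ a $ c = Q $ c $ a)}"
      then obtain Q R where QR: "q = quad Q" "\<forall>a c. Q $ a $ c = Q $ c $ a" "r = quad R" "\<forall>a c. R $ a $ c = R $ c $ a" by blast
      then have "\<forall>a c. (Q + R) $ a $ c = (Q + R) $ c $ a" by (simp only: vector_add_component) metis
      then show "\<exists>Q. q + r = quad Q \<and> (\<forall>a c. Q $ a $ c = Q $ c $ a)"
        unfolding QR(1,3) add by blast
    next
      fix r q
      assume "q \<in> {q. \<exists>Q. q = quad Q \<and> (\<forall>a c. Q $ a $ c = Q $ c $ a)}"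
      then obtain Q where Q: "q = quad Q" "\<forall>a c. Q $ a $ c = Q $ c $ a" by blast
      have "\<forall>a c. (\<chi> a c. r * Q $ a $ c) $ a $ c = (\<chi> a c. r * Q $ a $ c) $ c $ a"
        unfolding vec_lambda_beta using Q(2) by metis
      then show "\<exists>Q. fun_scale r q = quad Q \<and> (\<forall>a c. Q $ a $ c = Q $ c $ a)"
        unfolding Q(1) scale by blast
    qed
  qed
  then show ?thesis using that by blast
qed

lemma mu_in_Sym2_Lambda4: "mu \<phi> \<in> Sym2 s \<times> Lambda4 s"
proof -
  interpret f1: vector_space "fun_scale :: complex \<Rightarrow> (('v \<Rightarrow> complex) \<Rightarrow> complex) \<Rightarrow> _" by (rule vector_space_fun_scale)
  interpret f2: vector_space "fun_scale :: complex \<Rightarrow> (('v \<Rightarrow> complex)^4 \<Rightarrow> complex) \<Rightarrow> _" by (rule vector_space_fun_scale)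
  have "kron_det s \<phi> \<in> Sym2 s"
    unfolding kron_det_def Sym2_def by (intro f1.span_diff f1.span_base) blast+
  moreover have "kron_e s \<phi> \<in> Lambda4 s"
    unfolding kron_e_def Lambda4_def by (intro f2.span_base) blast
  ultimately show ?thesis by (simp add: mu_def)
qed

definition hyper_cone :: "'v sym_wedge set" where
  "hyper_cone = {(q, p). (q, p) \<in> cone \<and> (\<exists>c. p = fun_scale c (wedge4 s b) \<and> res s b q = c\<^sup>2)}"

lemma mu_in_cone:
  assumes "semistable s \<phi>"
  shows "mu \<phi> \<in> cone"
  using assms mu_in_Sym2_Lambda4[of \<phi>]
  by (auto simp: cone_def semistable_iff mu_def zero_prod_def)

lemma mu_in_hyper_cone:
  assumes "semistable s \<phi>"
  shows "mu \<phi> \<in> hyper_cone"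
proof -
  obtain M where M: "\<phi> = phi M" using phi_phi_inv[of \<phi>] by metis
  have "res s b (quad (gram M)) = (4 * det M)\<^sup>2"
    unfolding res_quad[OF gram_sym] det_gram by (simp add: power2_eq_square)
  then have "\<exists>c. fun_scale (4 * det M) (wedge4 s b) = fun_scale c (wedge4 s b) \<and> res s b (quad (gram M)) = c\<^sup>2" by blast
  then show ?thesis
    using mu_in_cone[OF assms] unfolding hyper_cone_def M mu_phi by blast
qed

text \<open>A point of the hypersurface with \<open>q = 0\<close> would have \<open>p = 0\<close> as
  well, so every matrix over it is semistable. The Gram matrix fixes the determinant up to sign
  only, and this sign has to be matched with \<open>p\<close>.\<close>

lemma ex_minimal_over:
  assumes "y \<in> hyper_cone"
  obtains M B :: "complex^4^4" where "mu (phi M) = y" "cnj_mat M = M ** B" "semistable s (phi M)"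
proof -
  obtain q p c where y: "y = (q, p)" "(q, p) \<in> cone" and c: "p = fun_scale c (wedge4 s b)" "res s b q = c\<^sup>2"
    using assms unfolding hyper_cone_def by blast
  obtain Q where Q: "q = quad Q" "\<And>a c. Q $ a $ c = Q $ c $ a"
    using Sym2_quad[of q] y(2) unfolding cone_def by blast
  have q0: "q \<noteq> 0"
  proof
    assume 0: "q = 0"
    have "q = quad 0" unfolding 0 by (auto simp: quad_def bil_def)
    then have "res s b q = 0" using res_quad[of 0] by (simp add: det_4)
    then have "p = 0" using c by (auto simp: fun_scale_def)
    then show False using y(2) 0 by (simp add: cone_def zero_prod_def)
  qed
  obtain M B :: "complex^4^4" where M: "gram M = Q" "cnj_mat M = M ** B" by (rule ex_minimal_gram[OF Q(2)])
  have "16 * det Q = c\<^sup>2" using c(2) unfolding Q(1) res_quad[OF Q(2)] .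
  moreover have "det Q = (det M)\<^sup>2" using det_gram[of M] M(1) by simp
  ultimately have "(4 * det M)\<^sup>2 = c\<^sup>2" by (simp add: power_mult_distrib)
  then have "4 * det M = c \<or> - (4 * det M) = c" unfolding power2_eq_iff by auto
  then obtain N :: "complex^4^4" where N: "gram N = Q" "cnj_mat N = N ** B" "4 * det N = c"
  proof
    assume "4 * det M = c"
    then show ?thesis using M that by blast
  next
    assume *: "- (4 * det M) = c"
    \<comment> \<open>A real reflection reverses the sign of the determinant, keeps the Gram matrix,
      and commutes with complex conjugation, so the same \<open>B\<close> works.\<close>
    define N where "N = mat_of_real (reflect (axis 1 1) (mat 1)) ** M"
    have R: "transpose (mat_of_real (reflect (axis 1 1) (mat 1))) ** mat_of_real (reflect (axis 1 1) (mat 1 :: real^4^4)) = mat 1"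
      by (simp only: mat_of_real_gram) (simp add: gram_reflect axis_eq_0_iff transpose_mat mat_of_real_mat_1)
    have "gram N = transpose M ** (gram (mat_of_real (reflect (axis 1 1) (mat 1 :: real^4^4))) ** M)"
      by (simp only: N_def matrix_transpose_mul matrix_mul_assoc)
    then have "gram N = Q" unfolding R by (simp add: M(1))
    moreover have "cnj_mat N = N ** B" by (simp add: N_def cnj_mat_mult M(2) matrix_mul_assoc)
    moreover have "det N = - det M"
      by (simp add: N_def det_mul det_mat_of_real reflect_eq_stretch det_stretch axis_eq_0_iff)
    ultimately show ?thesis using * that by simp
  qed
  show ?thesis
  proof (rule that)
    show mu: "mu (phi N) = y" by (simp only: mu_phi N y(1) Q(1) c(1))
    from mu show "semistable s (phi N)" using q0 by (simp add: semistable_iff mu_def y(1))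
  qed (rule N(2))
qed

lemma lmat_mult: "lmat x *v m = qmul x m" for x m :: "complex^4"
  by (simp add: quat_simps)

lemma rmat_mult: "rmat y *v m = qmul m y" for y m :: "complex^4"
  by (simp add: quat_simps algebra_simps)

text \<open>Since \<open>pack\<close> is multiplicative and surjective, the action by arbitrary
  pairs of 2 by 2 matrices becomes left and right multiplication of the columns by
  quaternions.\<close>

lemma kron_mult_pack: "kron_mult s (pack x) (phi M) (pack y) = phi (rmat y ** (lmat x ** M))"
proof -
  have "kron_mult s (pack x) (phi M) (pack y) $ i $ j = phi (rmat y ** (lmat x ** M)) $ i $ j" for i j
  proof (rule ext_by_dual)
    fix \<xi> assume \<xi>: "\<xi> \<in> dual s"
    have "\<xi> (kron_mult s (pack x) (phi M) (pack y) $ i $ j) = (pack x ** (pack (M *v vals \<xi>) ** pack y)) $ i $ j"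
      by (simp add: kron_mult_def dual_simps[OF \<xi>] dual_phi[OF \<xi>] matrix_matrix_mult_def sum_distrib_left ac_simps)
    also have "\<dots> = pack (rmat y *v (lmat x *v (M *v vals \<xi>))) $ i $ j"
      by (simp only: lmat_mult rmat_mult pack_qmul matrix_mul_assoc)
    finally show "\<xi> (kron_mult s (pack x) (phi M) (pack y) $ i $ j) = \<xi> (phi (rmat y ** (lmat x ** M)) $ i $ j)"
      by (simp only: dual_phi[OF \<xi>] matrix_vector_mul_assoc matrix_mul_assoc)
  qed
  then show ?thesis by (simp add: vec_eq_iff)
qed

text \<open>Multiplication by a quaternion is a similitude: its matrix has a scalar Gram matrix,
  with the norm of the quaternion as the scalar.\<close>

lemma gram_lmat_rmat:
  fixes x y :: "complex^4"
  shows "gram (lmat x ** M) = (\<chi> i j. det (pack x) * gram M $ i $ j)"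
    "gram (rmat y ** M) = (\<chi> i j. det (pack y) * gram M $ i $ j)"
    "det (lmat x) = (det (pack x))\<^sup>2" "det (rmat y) = (det (pack y))\<^sup>2"
proof -
  have scal: "transpose M ** ((\<chi> i j. r * mat 1 $ i $ j) ** M) = (\<chi> i j. r * gram M $ i $ j)" for r and M :: "complex^'a^4"
  proof -
    have "((\<chi> i j. r * mat 1 $ i $ j) ** M) $ i $ j = r * M $ i $ j" for i j
      by (simp add: matrix_matrix_mult_def mat_def if_distrib if_distribR cong: if_cong)
    then have "(\<chi> i j. r * mat 1 $ i $ j) ** M = (\<chi> i j. r * M $ i $ j)" by (simp add: vec_eq_iff)
    then show ?thesis by (simp add: vec_eq_iff matrix_matrix_mult_def sum_distrib_left mult.left_commute)
  qed
  have "gram (lmat x) = (\<chi> i j. det (pack x) * mat 1 $ i $ j)" "gram (rmat y) = (\<chi> i j. det (pack y) * mat 1 $ i $ j)"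
    unfolding det_pack by (simp_all add: quat_simps transpose_def mat_def power2_eq_square)
  moreover have "gram (A ** M) = transpose M ** (gram A ** M)" for A :: "complex^4^4"
    by (simp only: matrix_transpose_mul matrix_mul_assoc)
  ultimately show "gram (lmat x ** M) = (\<chi> i j. det (pack x) * gram M $ i $ j)"
    "gram (rmat y ** M) = (\<chi> i j. det (pack y) * gram M $ i $ j)" by (simp_all only: scal)
  show "det (lmat x) = (det (pack x))\<^sup>2" "det (rmat y) = (det (pack y))\<^sup>2"
    unfolding det_pack by (simp_all add: det_4 lmat_def rmat_def vector_4 sum_4 power2_eq_square algebra_simps)
qed

text \<open>The source of the weights: the Gram matrix scales by \<open>det h * det k\<close>, and
  the determinant of \<open>M\<close> by the square of that number.\<close>

lemma mu_kron_mult: "mu (kron_mult s h \<phi> k) = wt (det h * det k) (mu \<phi>)"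
proof -
  obtain M where M: "\<phi> = phi M" using phi_phi_inv[of \<phi>] by metis
  define x y where "x = unpack h" and "y = unpack k"
  have hk: "h = pack x" "k = pack y" by (simp_all add: x_def y_def pack_unpack)
  have "quad (\<chi> i j. r * Q $ i $ j) = fun_scale r (quad Q)" for r Q
    by (auto simp: quad_def bil_def fun_scale_def sum_distrib_left mult.left_commute mult.assoc)
  moreover have "gram (rmat y ** (lmat x ** M)) = (\<chi> i j. (det h * det k) * gram M $ i $ j)"
    by (simp add: gram_lmat_rmat hk mult.left_commute mult.assoc)
  moreover have "det (rmat y ** (lmat x ** M)) = (det h * det k)\<^sup>2 * det M"
    by (simp add: det_mul gram_lmat_rmat hk power_mult_distrib)
  ultimately show ?thesis
    unfolding M hk(1) hk(2) kron_mult_pack mu_phi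
    by (simp add: wt_def hk[symmetric]) (simp add: fun_scale_def mult.left_commute mult.assoc)
qed

end

text \<open>The column space of \<open>M\<close> is stable under complex conjugation, so the conjugate of \<open>b\<close> agrees with a
  polynomial \<open>\<gamma>\<close> on the orbit of \<open>M\<close> under the real quaternions. The average of \<open>b \<gamma>\<close> at \<open>M\<close> is then an
  integral of \<open>|b|\<^sup>2\<close>.\<close>

theorem ex_reynolds:
  fixes b :: "complex^4^4 \<Rightarrow> complex"
  assumes b: "b \<in> gen_algebra entries" and nz: "b M \<noteq> 0" and min: "cnj_mat M = M ** B"
  shows "\<exists>R. (\<forall>a\<in>gen_algebra entries. R a \<in> gen_algebra entries \<and> quat_invariant (R a)) \<and> R b M \<noteq> 0 \<and>
    (\<forall>a\<in>gen_algebra entries. \<forall>a'\<in>gen_algebra entries. \<forall>N c.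
       (\<forall>x y. a (mat_of_real (rmat y ** lmat x) ** N) = c * a' (mat_of_real (rmat y ** lmat x) ** N)) \<longrightarrow>
       R a N = c * R a' N)"
proof -
  define \<gamma> where "\<gamma> N = cnj (b (cnj_mat (N ** B)))" for N
  have \<gamma>: "\<gamma> \<in> gen_algebra entries"
    unfolding \<gamma>_def by (rule compose_mult_right_in_gen_algebra[OF cnj_conjugate_in_gen_algebra[OF b]])
  have \<gamma>_eq: "\<gamma> (mat_of_real k ** M) = cnj (b (mat_of_real k ** M))" for k
  proof -
    have "cnj_mat (mat_of_real k ** M ** B) = cnj_mat (mat_of_real k ** cnj_mat M)"
      by (simp add: min matrix_mul_assoc)
    also have "\<dots> = mat_of_real k ** M" by (simp add: cnj_mat_mult)
    finally show ?thesis by (simp add: \<gamma>_def)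
  qed
  have mult: "(\<lambda>N. a N * \<gamma> N) \<in> gen_algebra entries" if "a \<in> gen_algebra entries" for a
    by (intro gen_algebra.mult that \<gamma>)
  define R where "R a = quat_average (\<lambda>N. a N * \<gamma> N)" for a
  have "R b M \<noteq> 0"
    unfolding R_def
  proof (rule quat_average_ne_0[OF mult[OF b]])
    show "b M * \<gamma> M \<noteq> 0" using nz \<gamma>_eq[of "mat 1"] by (simp add: mat_of_real_mat_1)
    show "b (mat_of_real k ** M) * \<gamma> (mat_of_real k ** M) = of_real ((cmod (b (mat_of_real k ** M)))\<^sup>2)" for k
      unfolding \<gamma>_eq by (rule complex_norm_square[symmetric])
  qed simp
  moreover have "R a \<in> gen_algebra entries \<and> quat_invariant (R a)" if "a \<in> gen_algebra entries" for a
    unfolding R_def using quat_average_in_gen_algebra[OF mult[OF that]] quat_invariant_quat_average[OF mult[OF that]] ..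
  moreover have "R a N = c * R a' N"
    if "a' \<in> gen_algebra entries" and
      "\<forall>x y. a (mat_of_real (rmat y ** lmat x) ** N) = c * a' (mat_of_real (rmat y ** lmat x) ** N)" for a a' N c
    unfolding R_def by (rule quat_average_eq_cmult[OF mult[OF that(1)]]) (simp add: that(2))
  ultimately show ?thesis by (intro exI[of _ R]) blast
qed

section \<open>From invariant quotients of polynomials to the cone\<close>

text \<open>The balls used for averaging contain the quaternion 0, which does not act through the
  group. The value there is the constant term of a polynomial in \<open>t\<close> that vanishes for
  \<open>t > 0\<close>, by scaling the identity.\<close>

lemma quat_vanish_extend:
  assumes f: "f \<in> gen_algebra entries"
    and van: "\<And>x y. x \<noteq> 0 \<Longrightarrow> y \<noteq> 0 \<Longrightarrow> f (mat_of_real (rmat y ** lmat x) ** N) = 0"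
  shows "f (mat_of_real (rmat y ** lmat x) ** N) = 0"
proof (cases "x \<noteq> 0 \<and> y \<noteq> 0")
  case False
  have "lmat (0 :: real^4) = 0" "rmat (0 :: real^4) = 0" by (simp_all add: quat_simps)
  then have "lmat x = 0 \<or> rmat y = 0" using False by auto
  then have "mat_of_real (rmat y ** lmat x) ** N = 0"
    by (auto simp: vec_eq_iff matrix_matrix_mult_def)
  moreover
  obtain D where "\<And>A B. \<exists>p. degree p \<le> D \<and> (\<forall>c. f (\<chi> i j. A $ i $ j + c * B $ i $ j) = poly p c)"
    by (rule gen_algebra_entries_affine_line[OF f]) blast
  then obtain p where p: "\<And>c. f (\<chi> i j. (0 :: complex^'a^4) $ i $ j + c * N $ i $ j) = poly p c" by metis
  have "poly p (of_real t) = 0" if t: "t > 0" for t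
  proof -
    have "(\<chi> i j. (0 :: complex^'a^4) $ i $ j + of_real t * N $ i $ j)
        = mat_of_real (rmat (axis 1 1) ** lmat (t *\<^sub>R axis 1 1)) ** N"
    proof -
      have eq: "rmat (axis 1 1) ** lmat (t *\<^sub>R axis 1 1) = (\<chi> i j. if i = j then t else 0 :: real^4^4)"
        by (simp add: quat_simps axis_def)
      show ?thesis
        unfolding eq by (simp add: vec_eq_iff matrix_matrix_mult_def if_distrib if_distribR cong: if_cong)
    qed
    moreover have "axis 1 1 \<noteq> (0 :: real^4)" by (simp add: axis_eq_0_iff)
    ultimately show ?thesis using van[of "t *\<^sub>R axis 1 1" "axis 1 1"] t p[of "of_real t"] by simp
  qed
  then have "p = 0"
    by (intro poly_eq_0_if_vanishes_infinite[OF infinite_of_real_image[OF zero_less_one]]) auto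
  then have "f 0 = 0" using p[of 0] by (simp add: zero_vec_def)
  ultimately show ?thesis by simp
qed (use van in blast)

lemma matrix_inv_matrix_inv:
  fixes A :: "complex^'n^'n"
  assumes "invertible A"
  shows "matrix_inv (matrix_inv A) = A"
proof -
  have A: "A ** matrix_inv A = mat 1" "matrix_inv A ** A = mat 1"
    using someI_ex[OF assms[unfolded invertible_def]] unfolding matrix_inv_def by auto
  then have "invertible (matrix_inv A)" unfolding invertible_def by blast
  then have B: "matrix_inv A ** matrix_inv (matrix_inv A) = mat 1"
    using someI_ex[of "\<lambda>B. matrix_inv A ** B = mat 1 \<and> B ** matrix_inv A = mat 1"]
    unfolding matrix_inv_def[of "matrix_inv A"] invertible_def by auto
  have "matrix_inv (matrix_inv A) = (A ** matrix_inv A) ** matrix_inv (matrix_inv A)" by (simp add: A)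
  also have "\<dots> = A" by (simp only: matrix_mul_assoc[symmetric] B matrix_mul_rid)
  finally show ?thesis .
qed

lemma det_matrix_inv_ne_0:
  fixes A :: "complex^'n^'n"
  assumes "invertible A"
  shows "det (matrix_inv A) \<noteq> 0"
proof -
  have "A ** matrix_inv A = mat 1"
    using someI_ex[OF assms[unfolded invertible_def]] unfolding matrix_inv_def by auto
  then have "det A * det (matrix_inv A) = 1" by (metis det_I det_mul)
  then show ?thesis by auto
qed

context frame
begin

abbreviation "SS \<equiv> {\<phi> :: 'v^2^2. semistable s \<phi>}"
abbreviation "TT \<equiv> (kron_group s :: ('v^2^2 \<Rightarrow> 'v^2^2) set)"

lemma kron_mult_in_group:
  assumes "det h \<noteq> 0" "det k \<noteq> 0"
  shows "(\<lambda>\<phi>. kron_mult s h \<phi> k) \<in> TT"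
proof -
  have k: "invertible k" and h: "invertible h" using assms by (simp_all add: invertible_det_nz)
  have "invertible (matrix_inv k)" using det_matrix_inv_ne_0[OF k] by (simp add: invertible_det_nz)
  then have "(\<lambda>\<phi>. kron_mult s h \<phi> (matrix_inv (matrix_inv k))) \<in> TT"
    unfolding kron_group_def using h by blast
  then show ?thesis by (simp only: matrix_inv_matrix_inv[OF k])
qed

lemma group_mu:
  assumes "t \<in> TT"
  obtains r where "r \<noteq> 0" "\<And>\<phi>. mu (t \<phi>) = wt r (mu \<phi>)"
proof -
  obtain g h :: "complex^2^2" where t: "t = (\<lambda>\<phi>. kron_mult s h \<phi> (matrix_inv g))" "invertible g" "invertible h"
    using assms unfolding kron_group_def by blast
  have "det h * det (matrix_inv g) \<noteq> 0"
    using t(3) det_matrix_inv_ne_0[OF t(2)] by (simp add: invertible_det_nz)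
  then show ?thesis by (rule that) (simp add: t(1) mu_kron_mult)
qed

lemma ex_group_wt:
  assumes "r \<noteq> 0"
  obtains t where "t \<in> TT" "\<And>\<phi>. mu (t \<phi>) = wt r (mu \<phi>)"
proof -
  define h :: "complex^2^2" where "h = vector [vector [r, 0], vector [0, 1]]"
  have "det h = r" by (simp add: h_def det_2)
  then have "(\<lambda>\<phi>. kron_mult s h \<phi> (mat 1)) \<in> TT" using assms by (intro kron_mult_in_group) simp_all
  then show ?thesis by (rule that) (simp add: mu_kron_mult \<open>det h = r\<close>)
qed

lemma semistable_mu: "semistable s \<phi> \<longleftrightarrow> fst (mu \<phi>) \<noteq> 0"
  by (simp add: semistable_iff mu_def)

lemma fun_scale_eq_0_iff: "c \<noteq> 0 \<Longrightarrow> fun_scale c f = 0 \<longleftrightarrow> f = 0"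
  by (auto simp: fun_scale_def fun_eq_iff)

lemma semistable_group: "t \<in> TT \<Longrightarrow> semistable s (t \<phi>) \<longleftrightarrow> semistable s \<phi>"
  by (rule group_mu) (auto simp: semistable_mu wt_def fun_scale_eq_0_iff)

definition psi :: "'v^2^2 \<Rightarrow> 'v sym_wedge set" where
  "psi \<phi> = weighted_class (mu \<phi>)"

lemma psi_group: "t \<in> TT \<Longrightarrow> psi (t \<phi>) = psi \<phi>"
  unfolding psi_def by (rule group_mu[of t], assumption, rule sym, subst weighted_class_eq_iff) blast

text \<open>A single averaging operator, built for \<open>den\<close> at \<open>M\<close>, is
  applied to numerator and denominator alike, so an invariant ratio survives. The averages are
  polynomials in \<open>mu\<close>, of which one weight component is kept; \<open>A\<close> and
  \<open>C\<close> have equal weight, so that \<open>A / C\<close> is a function on the weighted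
  projective space. The last two conclusions serve two purposes: one transports an invariant
  function \<open>g\<close>, the other makes \<open>C\<close> vanish on invariant sets where
  \<open>den\<close> does.\<close>

lemma descend:
  assumes num: "num \<in> poly_funs mat_scale" and den: "den \<in> poly_funs mat_scale"
    and nz: "den (phi M) \<noteq> 0" and min: "cnj_mat M = M ** B"
  obtains A C i where "A \<in> poly_funs pair_scale" "C \<in> poly_funs pair_scale"
    "\<And>t y. A (wt t y) = t ^ i * A y" "\<And>t y. C (wt t y) = t ^ i * C y" "C (mu (phi M)) \<noteq> 0"
    "\<And>U g \<phi>. (\<And>\<phi> t. \<phi> \<in> U \<Longrightarrow> t \<in> TT \<Longrightarrow> t \<phi> \<in> U) \<Longrightarrow> (\<And>\<phi> t. \<phi> \<in> U \<Longrightarrow> t \<in> TT \<Longrightarrow> g (t \<phi>) = g \<phi>) \<Longrightarrow>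
       (\<And>\<phi>. \<phi> \<in> U \<Longrightarrow> num \<phi> = g \<phi> * den \<phi>) \<Longrightarrow> \<phi> \<in> U \<Longrightarrow> A (mu \<phi>) = g \<phi> * C (mu \<phi>)"
    "\<And>U \<phi>. (\<And>\<phi> t. \<phi> \<in> U \<Longrightarrow> t \<in> TT \<Longrightarrow> t \<phi> \<in> U) \<Longrightarrow> (\<And>\<phi>. \<phi> \<in> U \<Longrightarrow> den \<phi> = 0) \<Longrightarrow> \<phi> \<in> U \<Longrightarrow> C (mu \<phi>) = 0"
proof -
  define a1 b1 where "a1 = (\<lambda>N. num (phi N))" and "b1 = (\<lambda>N. den (phi N))"
  have a1: "a1 \<in> gen_algebra entries" and b1: "b1 \<in> gen_algebra entries"
    unfolding a1_def b1_def by (intro phi_poly num den)+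
  have "b1 M \<noteq> 0" using nz by (simp add: b1_def)
  from ex_reynolds[OF b1 this min] obtain R where
    R0: "\<forall>a\<in>gen_algebra entries. R a \<in> gen_algebra entries \<and> quat_invariant (R a)"
    and Rnz: "R b1 M \<noteq> 0"
    and Rrel: "\<forall>a\<in>gen_algebra entries. \<forall>a'\<in>gen_algebra entries. \<forall>N c.
       (\<forall>x y. a (mat_of_real (rmat y ** lmat x) ** N) = c * a' (mat_of_real (rmat y ** lmat x) ** N)) \<longrightarrow>
       R a N = c * R a' N" by (elim exE conjE)
  have R: "R a \<in> gen_algebra entries" "quat_invariant (R a)" if "a \<in> gen_algebra entries" for a
    using R0 that by simp_all
  have lift: "\<exists>H\<in>poly_funs pair_scale. \<forall>N. R f N = H (mu (phi N))" if f: "f \<in> gen_algebra entries" for f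
  proof -
    obtain F G where FG: "F \<in> gen_algebra entries" "G \<in> gen_algebra entries" "\<And>N. R f N = F (gram N) + det N * G (gram N)"
      using quat_invariant_polynomial[OF R(1)[OF f] R(2)[OF f]] by blast
    from lift_invariant[OF FG(1,2)] show ?thesis unfolding FG(3) .
  qed
  obtain A0 where A0: "A0 \<in> poly_funs pair_scale" "\<And>N. R a1 N = A0 (mu (phi N))" using lift[OF a1] by blast
  obtain C0 where C0: "C0 \<in> poly_funs pair_scale" "\<And>N. R b1 N = C0 (mu (phi N))" using lift[OF b1] by blast
  have rel: "R f N = c * R f' N"
    if f: "f \<in> gen_algebra entries" "f' \<in> gen_algebra entries"
      and *: "\<And>t M'. t \<in> TT \<Longrightarrow> phi M' = t (phi N) \<Longrightarrow> f M' = c * f' M'" for f f' N c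
  proof -
    have z: "(\<lambda>N. f N - c * f' N) \<in> gen_algebra entries" by (intro gen_algebra_diff gen_algebra_cmult f)
    have "f (mat_of_real (rmat y ** lmat x) ** N) - c * f' (mat_of_real (rmat y ** lmat x) ** N) = 0" for x y
    proof (rule quat_vanish_extend[OF z])
      \<comment> \<open>Nonzero real quaternions have positive norm, so they act through invertible
        matrices and the relation on the orbit applies.\<close>
      fix x y :: "real^4" assume xy: "x \<noteq> 0" "y \<noteq> 0"
      define X Y :: "complex^4" where "X = (\<chi> i. of_real (x $ i))" and "Y = (\<chi> i. of_real (y $ i))"
      have m: "mat_of_real (rmat y ** lmat x) ** N = rmat Y ** (lmat X ** N)"
      proof -
        have "mat_of_real (rmat y) = rmat Y" "mat_of_real (lmat x) = lmat X"
          by (simp_all add: X_def Y_def quat_simps)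
        then show ?thesis by (simp add: mat_of_real_mult matrix_mul_assoc)
      qed
      have "det (pack X) = of_real (x \<bullet> x)" "det (pack Y) = of_real (y \<bullet> y)"
        by (simp_all add: det_pack X_def Y_def inner_vec_def power2_eq_square)
      then have "(\<lambda>\<phi>. kron_mult s (pack X) \<phi> (pack Y)) \<in> TT" using xy by (intro kron_mult_in_group) simp_all
      from *[OF this] show "f (mat_of_real (rmat y ** lmat x) ** N) - c * f' (mat_of_real (rmat y ** lmat x) ** N) = 0"
        unfolding m by (simp add: kron_mult_pack)
    qed
    then have "\<forall>x y. f (mat_of_real (rmat y ** lmat x) ** N) = c * f' (mat_of_real (rmat y ** lmat x) ** N)"
      by (simp only: right_minus_eq simp_thms)
    with Rrel f show ?thesis by simp
  qed
  obtain A C where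
    A: "\<And>i. (\<lambda>y. coeff (A y) i) \<in> poly_funs pair_scale" "\<And>t y. A0 (wt t y) = poly (A y) t"
      "\<And>i t y. coeff (A (wt t y)) i = t ^ i * coeff (A y) i" and
    C: "\<And>i. (\<lambda>y. coeff (C y) i) \<in> poly_funs pair_scale" "\<And>t y. C0 (wt t y) = poly (C y) t"
      "\<And>i t y. coeff (C (wt t y)) i = t ^ i * coeff (C y) i"
    using weight_polynomial[OF A0(1)] weight_polynomial[OF C0(1)] by metis
  have "poly (C (mu (phi M))) 1 \<noteq> 0" using Rnz C0(2)[of M] C(2)[of 1 "mu (phi M)"] by simp
  then have "C (mu (phi M)) \<noteq> 0" by auto
  \<comment> \<open>The weight is selected by the denominator; the numerator then has to be taken in
    the same weight.\<close>
  then obtain i where i: "coeff (C (mu (phi M))) i \<noteq> 0" by (auto simp: poly_eq_iff)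
  have poly_rel: "p = smult c q" if "\<And>t. t \<noteq> 0 \<Longrightarrow> poly p t = c * poly q t" for p q :: "complex poly" and c
  proof -
    have "p - smult c q = 0"
      by (rule poly_eq_0_if_vanishes_infinite[OF infinite_of_real_image[OF zero_less_one]]) (use that in auto)
    then show ?thesis by simp
  qed
  show ?thesis
  proof (rule that[of "\<lambda>y. coeff (A y) i" "\<lambda>y. coeff (C y) i" i])
    show "(\<lambda>y. coeff (A y) i) \<in> poly_funs pair_scale" by (rule A(1))
    show "(\<lambda>y. coeff (C y) i) \<in> poly_funs pair_scale" by (rule C(1))
    show "coeff (A (wt t y)) i = t ^ i * coeff (A y) i" for t y by (rule A(3))
    show "coeff (C (wt t y)) i = t ^ i * coeff (C y) i" for t y by (rule C(3))
    show "coeff (C (mu (phi M))) i \<noteq> 0" by (rule i)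
  next
    fix U g \<phi>
    assume U: "\<And>\<phi> t. \<phi> \<in> U \<Longrightarrow> t \<in> TT \<Longrightarrow> t \<phi> \<in> U" and g: "\<And>\<phi> t. \<phi> \<in> U \<Longrightarrow> t \<in> TT \<Longrightarrow> g (t \<phi>) = g \<phi>"
      and ab: "\<And>\<phi>. \<phi> \<in> U \<Longrightarrow> num \<phi> = g \<phi> * den \<phi>" and \<phi>: "\<phi> \<in> U"
    have *: "A0 (mu \<phi>') = g \<phi>' * C0 (mu \<phi>')" if \<phi>': "\<phi>' \<in> U" for \<phi>'
    proof -
      define N where "N = phi_inv \<phi>'"
      have N: "phi N = \<phi>'" by (simp add: N_def phi_phi_inv)
      have "R a1 N = g \<phi>' * R b1 N"
      proof (rule rel[OF a1 b1])
        fix t M' assume t: "t \<in> TT" "phi M' = t (phi N)"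
        show "a1 M' = g \<phi>' * b1 M'"
          unfolding a1_def b1_def t(2) N using ab[OF U[OF \<phi>' t(1)]] g[OF \<phi>' t(1)] by simp
      qed
      then show ?thesis by (simp add: A0(2) C0(2) N)
    qed
    \<comment> \<open>The group realises every nonzero scaling \<open>r\<close>, along which
      \<open>g\<close> is constant. So the relation is an identity of polynomials in
      \<open>r\<close> and holds coefficient by coefficient.\<close>
    have "A (mu \<phi>) = smult (g \<phi>) (C (mu \<phi>))"
    proof (rule poly_rel)
      fix r :: complex assume "r \<noteq> 0"
      then obtain t where t: "t \<in> TT" "\<And>\<phi>. mu (t \<phi>) = wt r (mu \<phi>)" by (rule ex_group_wt) blast
      from *[OF U[OF \<phi> t(1)]] show "poly (A (mu \<phi>)) r = g \<phi> * poly (C (mu \<phi>)) r"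
        unfolding t(2) g[OF \<phi> t(1)] A(2) C(2) .
    qed
    then show "coeff (A (mu \<phi>)) i = g \<phi> * coeff (C (mu \<phi>)) i" by simp
  next
    fix U \<phi>
    assume U: "\<And>\<phi> t. \<phi> \<in> U \<Longrightarrow> t \<in> TT \<Longrightarrow> t \<phi> \<in> U" and b0: "\<And>\<phi>. \<phi> \<in> U \<Longrightarrow> den \<phi> = 0" and \<phi>: "\<phi> \<in> U"
    have *: "C0 (mu \<phi>') = 0" if \<phi>': "\<phi>' \<in> U" for \<phi>'
    proof -
      define N where "N = phi_inv \<phi>'"
      have N: "phi N = \<phi>'" by (simp add: N_def phi_phi_inv)
      have "R b1 N = 0 * R b1 N"
      proof (rule rel[OF b1 b1])
        fix t M' assume t: "t \<in> TT" "phi M' = t (phi N)"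
        show "b1 M' = 0 * b1 M'" unfolding b1_def t(2) N using b0[OF U[OF \<phi>' t(1)]] by simp
      qed
      then show ?thesis by (simp add: C0(2) N)
    qed
    have "C (mu \<phi>) = smult 0 0"
    proof (rule poly_rel)
      fix r :: complex assume "r \<noteq> 0"
      then obtain t where t: "t \<in> TT" "\<And>\<phi>. mu (t \<phi>) = wt r (mu \<phi>)" by (rule ex_group_wt) blast
      from *[OF U[OF \<phi> t(1)]] show "poly (C (mu \<phi>)) r = 0 * poly 0 r"
        unfolding t(2) C(2) by simp
    qed
    then show "coeff (C (mu \<phi>)) i = 0" by simp
  qed
qed

section \<open>Open sets and regular functions on the hypersurface\<close>

abbreviation "HH \<equiv> hypersurface s b"
abbreviation "PP \<equiv> (weighted_projective_space s :: 'v sym_wedge set fun_space)"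

lemma points_PP: "points PP = weighted_class ` cone"
  by (simp add: weighted_projective_space_def points_orbit_space weighted_class_def cone_def)

lemma openin_PP:
  "openin (zariski PP) U \<longleftrightarrow> U \<subseteq> weighted_class ` cone \<and>
     openin (zariski_top pair_scale cone) {y \<in> cone. weighted_class y \<in> U}"
  by (simp add: weighted_projective_space_def openin_orbit_space weighted_class_def cone_def)

lemma regular_PP:
  "regular PP U f \<longleftrightarrow>
     regular (zariski_space pair_scale cone) {y \<in> cone. weighted_class y \<in> U} (\<lambda>y. f (weighted_class y))"
  by (simp add: weighted_projective_space_def orbit_space_def weighted_class_def cone_def)

lemma hypersurface_eq: "HH = induced PP (weighted_class ` hyper_cone)"
proof -
  have "{weighted_class (q, p) |q p. (q, p) \<in> Sym2 s \<times> Lambda4 s - {0} \<and>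
          (\<exists>c. p = fun_scale c (wedge4 s b) \<and> res s b q = c\<^sup>2)} = weighted_class ` hyper_cone"
    unfolding hyper_cone_def cone_def by auto
  then show ?thesis unfolding hypersurface_def by simp
qed

lemma hyper_cone_subset: "hyper_cone \<subseteq> cone"
  by (auto simp: hyper_cone_def)

lemma points_HH: "points HH = psi ` SS"
proof -
  have "points HH = weighted_class ` hyper_cone"
    using points_PP hyper_cone_subset by (auto simp: hypersurface_eq induced_def)
  also have "hyper_cone = mu ` SS"
  proof (intro equalityI subsetI)
    fix y assume "y \<in> hyper_cone"
    then obtain M B where "mu (phi M) = y" "cnj_mat M = M ** B" "semistable s (phi M)" by (rule ex_minimal_over)
    then show "y \<in> mu ` SS" by blast
  qed (auto intro: mu_in_hyper_cone)
  finally show ?thesis by (simp add: image_image psi_def)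
qed

lemma openin_HH:
  "openin (zariski HH) U \<longleftrightarrow> (\<exists>W. openin (zariski PP) W \<and> U = W \<inter> points HH)"
proof -
  have eq: "zariski HH = subtopology (zariski PP) (points HH)"
  proof -
    have "zariski HH = subtopology (zariski PP) (weighted_class ` hyper_cone)"
      by (simp add: hypersurface_eq induced_def)
    also have "weighted_class ` hyper_cone = points HH"
      using points_PP hyper_cone_subset by (auto simp: hypersurface_eq induced_def)
    finally show ?thesis .
  qed
  show ?thesis by (subst eq) (rule openin_subtopology)
qed

lemma regular_HH:
  "regular HH U f \<longleftrightarrow> (\<forall>x\<in>U. \<exists>W g. openin (zariski PP) W \<and> x \<in> W \<and> regular PP W g \<and> (\<forall>y\<in>W \<inter> U. f y = g y))"
  by (simp add: hypersurface_eq induced_def)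

lemma openin_mu_preimage:
  assumes "openin (zariski_top pair_scale cone) V"
  shows "openin (zariski_top mat_scale SS) {\<phi> \<in> SS. mu \<phi> \<in> V}"
  unfolding openin_zariski_top_iff
proof (intro conjI ballI)
  fix \<phi> assume \<phi>: "\<phi> \<in> {\<phi> \<in> SS. mu \<phi> \<in> V}"
  then obtain p where p: "p \<in> poly_funs pair_scale" "p (mu \<phi>) \<noteq> 0" "{y \<in> cone. p y \<noteq> 0} \<subseteq> V"
    using assms unfolding openin_zariski_top_iff by blast
  show "\<exists>p\<in>poly_funs mat_scale. p \<phi> \<noteq> 0 \<and> {v \<in> SS. p v \<noteq> 0} \<subseteq> {\<phi> \<in> SS. mu \<phi> \<in> V}"
    using p mu_in_cone by (intro bexI[OF _ mu_poly[OF p(1)]]) auto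
qed auto

lemma openin_psi_preimage:
  assumes "openin (zariski HH) U"
  shows "openin (zariski_top mat_scale SS) {\<phi> \<in> SS. psi \<phi> \<in> U}"
proof -
  obtain W where W: "openin (zariski PP) W" "U = W \<inter> points HH" using assms unfolding openin_HH by blast
  have "openin (zariski_top mat_scale SS) {\<phi> \<in> SS. mu \<phi> \<in> {y \<in> cone. weighted_class y \<in> W}}"
    using W(1) unfolding openin_PP by (intro openin_mu_preimage) blast
  moreover have "{\<phi> \<in> SS. mu \<phi> \<in> {y \<in> cone. weighted_class y \<in> W}} = {\<phi> \<in> SS. psi \<phi> \<in> U}"
    using mu_in_cone by (auto simp: psi_def W(2) points_HH)
  ultimately show ?thesis by simp
qed

lemma regular_compose_psi:
  assumes U: "openin (zariski HH) U" and g: "regular HH U g"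
  shows "regular (semistable_locus s) {\<phi> \<in> SS. psi \<phi> \<in> U} (\<lambda>\<phi>. g (psi \<phi>))"
  unfolding semistable_locus_def regular_zariski_space
proof
  fix \<phi> assume \<phi>: "\<phi> \<in> {\<phi> \<in> SS. psi \<phi> \<in> U}"
  then have "psi \<phi> \<in> U" by simp
  from g[unfolded regular_HH, rule_format, OF this] obtain W h where
    W: "openin (zariski PP) W" "psi \<phi> \<in> W" "regular PP W h" "\<forall>y\<in>W \<inter> U. g y = h y" by (elim exE conjE)
  define V where "V = {y \<in> cone. weighted_class y \<in> W}"
  have V: "openin (zariski_top pair_scale cone) V" using W(1) unfolding openin_PP V_def by blast
  have "mu \<phi> \<in> V" using \<phi> W(2) mu_in_cone by (auto simp: V_def psi_def)
  from W(3)[unfolded regular_PP regular_zariski_space V_def[symmetric], rule_format, OF this]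
  obtain W' num den where W': "num \<in> poly_funs pair_scale" "den \<in> poly_funs pair_scale"
    "openin (zariski_top pair_scale cone) W'" "mu \<phi> \<in> W'"
    "\<forall>u\<in>W' \<inter> V. den u \<noteq> 0 \<and> h (weighted_class u) = num u / den u" by (elim exE bexE conjE)
  define Z where "Z = {\<phi> \<in> SS. mu \<phi> \<in> W' \<inter> V}"
  have Z: "openin (zariski_top mat_scale SS) Z"
    unfolding Z_def by (intro openin_mu_preimage openin_Int W'(3) V)
  show "\<exists>W. \<exists>a\<in>poly_funs mat_scale. \<exists>b\<in>poly_funs mat_scale. openin (zariski_top mat_scale SS) W \<and> \<phi> \<in> W \<and>
      (\<forall>u\<in>W \<inter> {\<phi> \<in> SS. psi \<phi> \<in> U}. b u \<noteq> 0 \<and> g (psi u) = a u / b u)"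
  proof (rule exI[of _ Z], rule bexI[OF _ mu_poly[OF W'(1)]], rule bexI[OF _ mu_poly[OF W'(2)]], intro conjI ballI Z)
    show "\<phi> \<in> Z" using \<phi> \<open>mu \<phi> \<in> V\<close> W'(4) by (simp add: Z_def)
  next
    fix u assume u: "u \<in> Z \<inter> {\<phi> \<in> SS. psi \<phi> \<in> U}"
    then show "den (mu u) \<noteq> 0" using W'(5) by (simp add: Z_def)
    have "psi u \<in> W \<inter> U" using u by (simp add: Z_def V_def psi_def)
    then show "g (psi u) = num (mu u) / den (mu u)" using W(4) W'(5) u by (simp add: Z_def psi_def)
  qed
qed

text \<open>With \<open>q \<xi>0 \<noteq> 0\<close>, the only possible scaling factor is the
  quotient of the values of the two forms at \<open>\<xi>0\<close>. Clearing denominators turns the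
  condition on \<open>q\<close> into the equations \<open>e\<close> and the condition on
  \<open>p\<close> into \<open>e'\<close>. Semistability keeps the factor nonzero.\<close>

lemma closedin_psi_fibre:
  assumes "\<phi> \<in> SS"
  shows "closedin (zariski_top mat_scale SS) {\<phi>' \<in> SS. psi \<phi>' = psi \<phi>}"
proof -
  define q where "q = fst (mu \<phi>)"
  define p where "p = snd (mu \<phi>)"
  obtain \<xi>0 where \<xi>0: "q \<xi>0 \<noteq> 0" using assms by (auto simp: semistable_mu q_def fun_eq_iff)
  have ev: "(\<lambda>y::'v sym_wedge. fst y \<xi>) \<in> gen_algebra (dual pair_scale)" for \<xi>
    by (rule gen_algebra.gen)
      (simp add: dual_iff vector_space_pair_scale, simp add: pair_scale_def case_prod_unfold fun_scale_def)
  have ev': "(\<lambda>y::'v sym_wedge. snd y \<xi>) \<in> gen_algebra (dual pair_scale)" for \<xi>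
    by (rule gen_algebra.gen)
      (simp add: dual_iff vector_space_pair_scale, simp add: pair_scale_def case_prod_unfold fun_scale_def)
  define e where "e \<xi> y = q \<xi>0 * fst y \<xi> - q \<xi> * fst y \<xi>0" for \<xi> and y :: "'v sym_wedge"
  define e' where "e' \<zeta> y = (q \<xi>0)\<^sup>2 * snd y \<zeta> - p \<zeta> * (fst y \<xi>0)\<^sup>2" for \<zeta> and y :: "'v sym_wedge"
  have e: "(\<lambda>\<phi>'. e \<xi> (mu \<phi>')) \<in> poly_funs mat_scale" for \<xi>
    unfolding e_def by (rule mu_poly) (unfold poly_funs_eq_gen_algebra, intro gen_algebra_diff gen_algebra_cmult ev)
  have e': "(\<lambda>\<phi>'. e' \<zeta> (mu \<phi>')) \<in> poly_funs mat_scale" for \<zeta>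
    unfolding e'_def
    by (rule mu_poly) (unfold poly_funs_eq_gen_algebra, intro gen_algebra_diff gen_algebra_cmult gen_algebra_power ev ev')
  have "{\<phi>' \<in> SS. psi \<phi>' = psi \<phi>} = {\<phi>' \<in> SS. \<forall>\<xi>\<in>UNIV. e \<xi> (mu \<phi>') = 0} \<inter> {\<phi>' \<in> SS. \<forall>\<zeta>\<in>UNIV. e' \<zeta> (mu \<phi>') = 0}"
  proof (intro equalityI subsetI)
    fix \<phi>' assume \<phi>': "\<phi>' \<in> {\<phi>' \<in> SS. psi \<phi>' = psi \<phi>}"
    then have "weighted_class (mu \<phi>) = weighted_class (mu \<phi>')" by (simp add: psi_def)
    then obtain t where "mu \<phi>' = wt t (mu \<phi>)" unfolding weighted_class_eq_iff by blast
    then show "\<phi>' \<in> {\<phi>' \<in> SS. \<forall>\<xi>\<in>UNIV. e \<xi> (mu \<phi>') = 0} \<inter> {\<phi>' \<in> SS. \<forall>\<zeta>\<in>UNIV. e' \<zeta> (mu \<phi>') = 0}"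
      using \<phi>' by (simp add: e_def e'_def wt_def fun_scale_def q_def p_def power2_eq_square)
  next
    fix \<phi>' assume \<phi>': "\<phi>' \<in> {\<phi>' \<in> SS. \<forall>\<xi>\<in>UNIV. e \<xi> (mu \<phi>') = 0} \<inter> {\<phi>' \<in> SS. \<forall>\<zeta>\<in>UNIV. e' \<zeta> (mu \<phi>') = 0}"
    define t where "t = fst (mu \<phi>') \<xi>0 / q \<xi>0"
    have 1: "fst (mu \<phi>') \<xi> = t * q \<xi>" for \<xi>
    proof -
      have "q \<xi>0 * fst (mu \<phi>') \<xi> = q \<xi> * fst (mu \<phi>') \<xi>0" using \<phi>' by (simp add: e_def)
      then show ?thesis using \<xi>0 by (simp add: t_def field_simps)
    qed
    have 2: "snd (mu \<phi>') \<zeta> = t\<^sup>2 * p \<zeta>" for \<zeta>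
    proof -
      have "(q \<xi>0)\<^sup>2 * snd (mu \<phi>') \<zeta> = p \<zeta> * (fst (mu \<phi>') \<xi>0)\<^sup>2" using \<phi>' by (simp add: e'_def)
      then show ?thesis using \<xi>0 by (simp add: t_def field_simps power2_eq_square)
    qed
    have "fst (mu \<phi>') \<noteq> 0" using \<phi>' by (simp add: semistable_mu)
    then have "t \<noteq> 0" using 1 by (auto simp: fun_eq_iff)
    moreover have "mu \<phi>' = wt t (mu \<phi>)"
      by (simp add: prod_eq_iff wt_def fun_scale_def fun_eq_iff 1 2 q_def p_def)
    ultimately have "weighted_class (mu \<phi>) = weighted_class (mu \<phi>')" unfolding weighted_class_eq_iff by blast
    then show "\<phi>' \<in> {\<phi>' \<in> SS. psi \<phi>' = psi \<phi>}" using \<phi>' by (simp add: psi_def)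
  qed
  then show ?thesis by (simp only:) (intro closedin_Int closedin_zariski_top_eqs e e')
qed

lemma zariski_semistable_locus: "zariski (semistable_locus s) = zariski_top mat_scale SS"
  by (simp add: semistable_locus_def)

lemma group_SS: "t \<in> TT \<Longrightarrow> \<phi> \<in> SS \<Longrightarrow> t \<phi> \<in> SS"
  using semistable_group by blast

definition nonvanishing :: "('v sym_wedge \<Rightarrow> complex) \<Rightarrow> 'v sym_wedge set set" where
  "nonvanishing C = weighted_class ` {y \<in> cone. C y \<noteq> 0}"

lemma weighted_class_in_nonvanishing:
  assumes "y \<in> cone" and hom: "\<And>t y. C (wt t y) = t ^ i * C y"
  shows "weighted_class y \<in> nonvanishing C \<longleftrightarrow> C y \<noteq> 0"
proof
  assume "weighted_class y \<in> nonvanishing C"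
  then obtain y' where "weighted_class y' = weighted_class y" "C y' \<noteq> 0" unfolding nonvanishing_def by auto
  then obtain t where "t \<noteq> 0" "y = wt t y'" unfolding weighted_class_eq_iff by blast
  then show "C y \<noteq> 0" using \<open>C y' \<noteq> 0\<close> by (simp add: hom)
qed (use assms(1) in \<open>auto simp: nonvanishing_def\<close>)

lemma openin_nonvanishing:
  assumes "C \<in> poly_funs pair_scale" and hom: "\<And>t y. C (wt t y) = t ^ i * C y"
  shows "openin (zariski PP) (nonvanishing C)"
proof -
  have "{y \<in> cone. weighted_class y \<in> nonvanishing C} = {y \<in> cone. C y \<noteq> 0}"
    using weighted_class_in_nonvanishing[OF _ hom] by blast
  then show ?thesis
    unfolding openin_PP using openin_zariski_top_principal[OF assms(1)] by (auto simp: nonvanishing_def)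
qed

lemma minimal_rep:
  assumes "h \<in> points HH"
  obtains M and B :: "complex^4^4" where "h = psi (phi M)" "semistable s (phi M)" "cnj_mat M = M ** B"
proof -
  obtain \<phi> where \<phi>: "semistable s \<phi>" "h = psi \<phi>" using assms unfolding points_HH by blast
  obtain M and B :: "complex^4^4" where M: "mu (phi M) = mu \<phi>" "cnj_mat M = M ** B" "semistable s (phi M)"
    by (rule ex_minimal_over[OF mu_in_hyper_cone[OF \<phi>(1)]])
  have "h = psi (phi M)" by (simp add: \<phi>(2) psi_def M(1))
  then show ?thesis using M(3,2) by (rule that)
qed

end

section \<open>Comparison of the good quotient with the hypersurface\<close>

locale moduli = frame s b crd for s :: "complex \<Rightarrow> 'v::ab_group_add \<Rightarrow> 'v" and b crd +
  fixes N :: "'p fun_space" and \<pi> :: "'v^2^2 \<Rightarrow> 'p"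
  assumes gq: "good_quotient (kron_group s) (semistable_locus s) N \<pi>"
begin

lemmas gq_unfolded = gq[unfolded good_quotient_def zariski_semistable_locus topspace_zariski_top]

lemma variety_N: "variety N" and surj: "\<pi> ` SS = points N"
  and morphism_pi: "morphism (semistable_locus s) N \<pi>"
  by (rule gq_unfolded[THEN conjunct1] gq_unfolded[THEN conjunct2, THEN conjunct2, THEN conjunct1]
      gq_unfolded[THEN conjunct2, THEN conjunct1])+

lemmas gq_rest = gq_unfolded[THEN conjunct2, THEN conjunct2, THEN conjunct2, THEN conjunct2]

lemma pi_group: "t \<in> TT \<Longrightarrow> \<phi> \<in> SS \<Longrightarrow> \<pi> (t \<phi>) = \<pi> \<phi>"
  using gq_rest[THEN conjunct1] by simp

lemma regular_invariant:
  assumes "openin (zariski N) U"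
  shows "regular (semistable_locus s) {x \<in> SS. \<pi> x \<in> U} g \<and> (\<forall>t\<in>TT. \<forall>x\<in>SS. \<pi> x \<in> U \<longrightarrow> g (t x) = g x)
    \<longleftrightarrow> (\<exists>f. regular N U f \<and> (\<forall>x\<in>SS. \<pi> x \<in> U \<longrightarrow> g x = f (\<pi> x)))"
  by (rule gq_rest[THEN conjunct2, THEN conjunct1, THEN spec, THEN spec, THEN mp, OF assms])

lemma closed_image:
  assumes "closedin (zariski_top mat_scale SS) Z" "invariant_set TT Z"
  shows "closedin (zariski N) (\<pi> ` Z)"
  by (rule gq_rest[THEN conjunct2, THEN conjunct2, THEN conjunct1, THEN spec, THEN mp, OF conjI[OF assms]])

lemma disjoint_images:
  assumes "closedin (zariski_top mat_scale SS) Z" "closedin (zariski_top mat_scale SS) Z'"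
    "invariant_set TT Z" "invariant_set TT Z'" "Z \<inter> Z' = {}"
  shows "\<pi> ` Z \<inter> \<pi> ` Z' = {}"
  using gq_rest[THEN conjunct2, THEN conjunct2, THEN conjunct2, THEN spec, THEN spec, of Z Z', THEN mp] assms by simp

lemma openin_pi_preimage:
  assumes "openin (zariski N) W"
  shows "openin (zariski_top mat_scale SS) {\<phi> \<in> SS. \<pi> \<phi> \<in> W}"
proof -
  have "continuous_map (zariski_top mat_scale SS) (zariski N) \<pi>"
    using morphism_pi unfolding morphism_def zariski_semistable_locus by (rule conjunct1)
  from openin_continuous_map_preimage[OF this assms] show ?thesis by simp
qed

text \<open>Distinct fibres of \<open>psi\<close> are disjoint closed invariant sets, whose images
  in a good quotient are disjoint.\<close>

lemma psi_eq_if_pi_eq: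
  assumes \<phi>: "\<phi> \<in> SS" "\<phi>' \<in> SS" and eq: "\<pi> \<phi> = \<pi> \<phi>'"
  shows "psi \<phi> = psi \<phi>'"
proof (rule ccontr)
  assume ne: "psi \<phi> \<noteq> psi \<phi>'"
  define F where "F \<phi> = {\<phi>' \<in> SS. psi \<phi>' = psi \<phi>}" for \<phi>
  have "invariant_set TT (F \<phi>)" for \<phi>
    unfolding invariant_set_def F_def using group_SS psi_group by auto
  moreover have "F \<phi> \<inter> F \<phi>' = {}" using ne by (auto simp: F_def)
  ultimately have "\<pi> ` F \<phi> \<inter> \<pi> ` F \<phi>' = {}"
    using closedin_psi_fibre \<phi> unfolding F_def by (intro disjoint_images) auto
  moreover have "\<pi> \<phi> \<in> \<pi> ` F \<phi>" "\<pi> \<phi>' \<in> \<pi> ` F \<phi>'" using \<phi> by (auto simp: F_def)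
  ultimately show False using eq by auto
qed

text \<open>Invariant functions separate the orbit of a minimal vector from closed invariant sets.\<close>

lemma separate:
  assumes min: "cnj_mat M = M ** B" and M: "semistable s (phi M)" "\<pi> (phi M) \<in> W" and W: "openin (zariski N) W"
  obtains C i where "C \<in> poly_funs pair_scale" "\<And>t y. C (wt t y) = t ^ i * C y" "C (mu (phi M)) \<noteq> 0"
    "\<And>\<phi>. \<phi> \<in> SS \<Longrightarrow> C (mu \<phi>) \<noteq> 0 \<Longrightarrow> \<pi> \<phi> \<in> W"
proof -
  obtain den where den: "den \<in> poly_funs mat_scale" "den (phi M) \<noteq> 0" "{\<phi> \<in> SS. den \<phi> \<noteq> 0} \<subseteq> {\<phi> \<in> SS. \<pi> \<phi> \<in> W}"
    using openin_pi_preimage[OF W] M unfolding openin_zariski_top_iff by blast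
  define Z where "Z = {\<phi> \<in> SS. \<pi> \<phi> \<notin> W}"
  have Z: "t \<phi> \<in> Z" if "\<phi> \<in> Z" "t \<in> TT" for \<phi> t using that pi_group group_SS by (auto simp: Z_def)
  have den0: "den \<phi> = 0" if "\<phi> \<in> Z" for \<phi> using den(3) that by (auto simp: Z_def)
  show ?thesis
  proof (rule descend[OF den(1) den(1) den(2) min])
    fix A C i
    assume C: "C \<in> poly_funs pair_scale" "\<And>t y. C (wt t y) = t ^ i * C y" "C (mu (phi M)) \<noteq> 0"
      and *: "\<And>U \<phi>. (\<And>\<phi> t. \<phi> \<in> U \<Longrightarrow> t \<in> TT \<Longrightarrow> t \<phi> \<in> U) \<Longrightarrow> (\<And>\<phi>. \<phi> \<in> U \<Longrightarrow> den \<phi> = 0) \<Longrightarrow> \<phi> \<in> U \<Longrightarrow> C (mu \<phi>) = 0"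
    have "C (mu \<phi>) = 0" if "\<phi> \<in> Z" for \<phi>
      by (rule *[of Z], rule Z, assumption, assumption, rule den0, assumption, rule that)
    then have "\<pi> \<phi> \<in> W" if "\<phi> \<in> SS" "C (mu \<phi>) \<noteq> 0" for \<phi> using that by (auto simp: Z_def)
    with C show thesis by (rule that)
  qed
qed

text \<open>If the images differed, some open \<open>W\<close> would contain the first and miss the
  second. The separating polynomial depends only on \<open>mu\<close>, which agrees on both
  matrices, so it would be nonzero at \<phi> and force its image into \<open>W\<close>.\<close>

lemma pi_minimal:
  assumes \<phi>: "\<phi> \<in> SS" and M: "mu (phi M) = mu \<phi>" "cnj_mat M = M ** B"
  shows "\<pi> (phi M) = \<pi> \<phi>"
proof (rule ccontr)
  assume ne: "\<pi> (phi M) \<noteq> \<pi> \<phi>"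
  have ss: "semistable s (phi M)" using \<phi> by (simp add: semistable_mu M(1))
  have "\<pi> \<phi> \<in> points N" "\<pi> (phi M) \<in> points N" using surj \<phi> ss by auto
  then obtain W where W: "openin (zariski N) W" "\<pi> (phi M) \<in> W" "\<pi> \<phi> \<notin> W"
    using t1_space_variety[OF variety_N] ne unfolding t1_space_def by metis
  show False
    by (rule separate[OF M(2) ss W(2,1)]) (use \<phi> W(3) M(1) in auto)
qed

text \<open>Both matrices are compared with one special matrix over \<open>mu \<phi>'\<close>, after
  a group element has brought \<phi> to the same value of \<open>mu\<close>.\<close>

lemma pi_eq_if_psi_eq:
  assumes \<phi>: "\<phi> \<in> SS" "\<phi>' \<in> SS" and eq: "psi \<phi> = psi \<phi>'"
  shows "\<pi> \<phi> = \<pi> \<phi>'"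
proof -
  obtain r where r: "r \<noteq> 0" "mu \<phi>' = wt r (mu \<phi>)"
    using eq unfolding psi_def weighted_class_eq_iff by blast
  obtain t where t: "t \<in> TT" "\<And>\<phi>. mu (t \<phi>) = wt r (mu \<phi>)" by (rule ex_group_wt[OF r(1)]) blast
  have "semistable s \<phi>'" using \<phi>(2) by simp
  then obtain M B where M: "mu (phi M) = mu \<phi>'" "cnj_mat M = M ** B" "semistable s (phi M)"
    by (rule ex_minimal_over[OF mu_in_hyper_cone])
  have "\<pi> (phi M) = \<pi> \<phi>'" by (rule pi_minimal[OF \<phi>(2) M(1,2)])
  moreover have "\<pi> (phi M) = \<pi> (t \<phi>)"
    by (rule pi_minimal[OF group_SS[OF t(1) \<phi>(1)] _ M(2)]) (simp add: M(1) t(2) r(2))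
  ultimately show ?thesis using pi_group[OF t(1) \<phi>(1)] by simp
qed

definition eta :: "'p \<Rightarrow> 'v sym_wedge set" where
  "eta n = psi (SOME \<phi>. \<phi> \<in> SS \<and> \<pi> \<phi> = n)"

definition theta :: "'v sym_wedge set \<Rightarrow> 'p" where
  "theta h = \<pi> (SOME \<phi>. \<phi> \<in> SS \<and> psi \<phi> = h)"

lemma eta_pi:
  assumes "\<phi> \<in> SS"
  shows "eta (\<pi> \<phi>) = psi \<phi>"
proof -
  have "(SOME \<phi>'. \<phi>' \<in> SS \<and> \<pi> \<phi>' = \<pi> \<phi>) \<in> SS \<and> \<pi> (SOME \<phi>'. \<phi>' \<in> SS \<and> \<pi> \<phi>' = \<pi> \<phi>) = \<pi> \<phi>"
    by (rule someI[where x = \<phi>]) (use assms in simp)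
  then show ?thesis unfolding eta_def using assms psi_eq_if_pi_eq by blast
qed

lemma theta_psi:
  assumes "\<phi> \<in> SS"
  shows "theta (psi \<phi>) = \<pi> \<phi>"
proof -
  have "(SOME \<phi>'. \<phi>' \<in> SS \<and> psi \<phi>' = psi \<phi>) \<in> SS \<and> psi (SOME \<phi>'. \<phi>' \<in> SS \<and> psi \<phi>' = psi \<phi>) = psi \<phi>"
    by (rule someI[where x = \<phi>]) (use assms in simp)
  then show ?thesis unfolding theta_def using assms pi_eq_if_psi_eq by blast
qed

lemma openin_eta_preimage:
  assumes U: "openin (zariski HH) U"
  shows "openin (zariski N) {n \<in> points N. eta n \<in> U}"
proof -
  define Z where "Z = {\<phi> \<in> SS. psi \<phi> \<notin> U}"
  have Z: "Z = topspace (zariski_top mat_scale SS) - {\<phi> \<in> SS. psi \<phi> \<in> U}" by (auto simp: Z_def)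
  have "closedin (zariski_top mat_scale SS) Z"
    unfolding Z by (rule closedin_diff[OF closedin_topspace openin_psi_preimage[OF U]])
  moreover have "invariant_set TT Z"
    unfolding invariant_set_def Z_def using group_SS psi_group by auto
  ultimately have Z': "closedin (zariski N) (\<pi> ` Z)" by (rule closed_image)
  have eq: "{n \<in> points N. eta n \<in> U} = points N - \<pi> ` Z"
  proof (intro equalityI subsetI)
    fix n assume "n \<in> {n \<in> points N. eta n \<in> U}"
    then show "n \<in> points N - \<pi> ` Z" using eta_pi by (auto simp: Z_def)
  next
    fix n assume n: "n \<in> points N - \<pi> ` Z"
    then obtain \<phi> where "\<phi> \<in> SS" "n = \<pi> \<phi>" using surj by blast
    then show "n \<in> {n \<in> points N. eta n \<in> U}" using n eta_pi[of \<phi>] by (auto simp: Z_def)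
  qed
  show ?thesis unfolding eq by (rule openin_diff[OF openin_topspace Z'])
qed

lemma morphism_eta: "morphism N HH eta"
  unfolding morphism_def
proof (intro conjI allI impI)
  show "continuous_map (zariski N) (zariski HH) eta"
    unfolding continuous_map_def Pi_iff
    using openin_eta_preimage eta_pi unfolding points_HH by (auto simp: surj[symmetric])
  fix U g assume Ug: "openin (zariski HH) U \<and> regular HH U g"
  define U' where "U' = {n \<in> points N. eta n \<in> U}"
  have U': "openin (zariski N) U'" unfolding U'_def using Ug openin_eta_preimage by blast
  have eq: "{x \<in> SS. \<pi> x \<in> U'} = {\<phi> \<in> SS. psi \<phi> \<in> U}"
    using eta_pi surj by (auto simp: U'_def)
  have "regular (semistable_locus s) {x \<in> SS. \<pi> x \<in> U'} (\<lambda>\<phi>. g (psi \<phi>))"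
    unfolding eq using regular_compose_psi Ug by blast
  moreover have "\<forall>t\<in>TT. \<forall>x\<in>SS. \<pi> x \<in> U' \<longrightarrow> g (psi (t x)) = g (psi x)" using psi_group by simp
  ultimately obtain f where f: "regular N U' f" "\<And>x. x \<in> SS \<Longrightarrow> \<pi> x \<in> U' \<Longrightarrow> g (psi x) = f (\<pi> x)"
    using regular_invariant[OF U', of "\<lambda>\<phi>. g (psi \<phi>)"] by blast
  have same: "g (eta n) = f n" if "n \<in> U'" for n
  proof -
    have "n \<in> \<pi> ` SS" using that unfolding surj U'_def by simp
    then obtain \<phi> where \<phi>: "n = \<pi> \<phi>" "\<phi> \<in> SS" by (rule imageE)
    have "\<pi> \<phi> \<in> U'" using that unfolding \<phi>(1) .
    from f(2)[OF \<phi>(2) this] show ?thesis unfolding \<phi>(1) eta_pi[OF \<phi>(2)] .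
  qed
  \<comment> \<open>The invariant function descends to some \<open>f\<close> that agrees with the
    composite only on \<open>U'\<close>; the sheaf property transfers regularity to the
    composite.\<close>
  have "function_sheaf N" using variety_N unfolding variety_def by blast
  then have "regular N U' (\<lambda>n. g (eta n)) \<longleftrightarrow>
      (\<forall>x\<in>U'. \<exists>W h. openin (zariski N) W \<and> x \<in> W \<and> W \<subseteq> U' \<and> regular N W h \<and> (\<forall>y\<in>W. g (eta y) = h y))"
    using U' unfolding function_sheaf_def by blast
  moreover have "\<forall>x\<in>U'. \<exists>W h. openin (zariski N) W \<and> x \<in> W \<and> W \<subseteq> U' \<and> regular N W h \<and> (\<forall>y\<in>W. g (eta y) = h y)"
    by (intro ballI exI[of _ U'] exI[of _ f] conjI U' f(1) same) simp_all
  ultimately have "regular N U' (\<lambda>n. g (eta n))" by (rule iffD2)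
  then show "regular N {x \<in> points N. eta x \<in> U} (\<lambda>x. g (eta x))" unfolding U'_def .
qed

text \<open>Each point of the preimage is represented by a special matrix, and the nonvanishing
  locus of its separating polynomial is a neighbourhood inside the preimage.\<close>

lemma openin_theta_preimage:
  assumes W: "openin (zariski N) W"
  shows "openin (zariski HH) {h \<in> points HH. theta h \<in> W}"
proof (subst openin_subopen, intro ballI)
  fix h assume h: "h \<in> {h \<in> points HH. theta h \<in> W}"
  then have "h \<in> points HH" by simp
  then obtain M and B :: "complex^4^4" where
    M: "h = psi (phi M)" "semistable s (phi M)" "cnj_mat M = M ** B" by (rule minimal_rep)
  have piW: "\<pi> (phi M) \<in> W" using h theta_psi[of "phi M"] M by simp
  obtain C i where C: "C \<in> poly_funs pair_scale" "\<And>t y. C (wt t y) = t ^ i * C y"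
    "C (mu (phi M)) \<noteq> 0" "\<And>\<phi>. \<phi> \<in> SS \<Longrightarrow> C (mu \<phi>) \<noteq> 0 \<Longrightarrow> \<pi> \<phi> \<in> W"
    by (rule separate[OF M(3,2) piW W]) (rule that)
  show "\<exists>T. openin (zariski HH) T \<and> h \<in> T \<and> T \<subseteq> {h \<in> points HH. theta h \<in> W}"
  proof (intro exI[of _ "nonvanishing C \<inter> points HH"] conjI)
    show "openin (zariski HH) (nonvanishing C \<inter> points HH)" unfolding openin_HH using openin_nonvanishing[OF C(1,2)] by blast
    show "h \<in> nonvanishing C \<inter> points HH"
      using h C(3) weighted_class_in_nonvanishing[OF mu_in_cone[OF M(2)] C(2)] by (simp add: M(1) psi_def)
    show "nonvanishing C \<inter> points HH \<subseteq> {h \<in> points HH. theta h \<in> W}"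
    proof
      fix h' assume h': "h' \<in> nonvanishing C \<inter> points HH"
      then obtain \<phi> where \<phi>: "semistable s \<phi>" "h' = psi \<phi>" unfolding points_HH by blast
      have "C (mu \<phi>) \<noteq> 0" using h' weighted_class_in_nonvanishing[OF mu_in_cone[OF \<phi>(1)] C(2)] by (simp add: \<phi>(2) psi_def)
      then show "h' \<in> {h \<in> points HH. theta h \<in> W}" using C(4) \<phi> theta_psi[of \<phi>] h' by simp
    qed
  qed
qed

lemma morphism_theta: "morphism HH N theta"
  unfolding morphism_def
proof (intro conjI allI impI)
  show "continuous_map (zariski HH) (zariski N) theta"
    unfolding continuous_map_def Pi_iff
    using openin_theta_preimage theta_psi surj unfolding points_HH by auto
  fix W f assume Wf: "openin (zariski N) W \<and> regular N W f"
  define V where "V = {\<phi> \<in> SS. \<pi> \<phi> \<in> W}"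
  have V: "t \<phi> \<in> V" if "\<phi> \<in> V" "t \<in> TT" for \<phi> t using that pi_group group_SS by (auto simp: V_def)
  have freg: "regular (semistable_locus s) V (\<lambda>\<phi>. f (\<pi> \<phi>))"
    using regular_invariant[of W "\<lambda>\<phi>. f (\<pi> \<phi>)"] Wf unfolding V_def by blast
  show "regular HH {x \<in> points HH. theta x \<in> W} (\<lambda>x. f (theta x))"
    unfolding regular_HH
  proof
    fix h assume h: "h \<in> {x \<in> points HH. theta x \<in> W}"
    then have "h \<in> points HH" by simp
    then obtain M and B :: "complex^4^4" where
      M: "h = psi (phi M)" "semistable s (phi M)" "cnj_mat M = M ** B" by (rule minimal_rep)
    have MV: "phi M \<in> V" using h theta_psi[of "phi M"] M by (simp add: V_def)
    from freg[unfolded semistable_locus_def regular_zariski_space, rule_format, OF this]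
    obtain W2 num0 den0 where W2: "openin (zariski_top mat_scale SS) W2" "phi M \<in> W2"
      "num0 \<in> poly_funs mat_scale" "den0 \<in> poly_funs mat_scale"
      "\<forall>u\<in>W2 \<inter> V. den0 u \<noteq> 0 \<and> f (\<pi> u) = num0 u / den0 u"
      by (elim exE bexE conjE)
    obtain c where c: "c \<in> poly_funs mat_scale" "c (phi M) \<noteq> 0" "{v \<in> SS. c v \<noteq> 0} \<subseteq> W2"
      using W2(1,2) unfolding openin_zariski_top_iff by blast
    \<comment> \<open>The fraction is valid only on \<open>W2\<close>, which need not be invariant.
      The factor \<open>c\<close> vanishes on the semistable matrices outside \<open>W2\<close>, so
      after multiplication the relation holds on the whole invariant set \<open>V\<close>.\<close>
    have num: "(\<lambda>\<phi>. num0 \<phi> * c \<phi>) \<in> poly_funs mat_scale" and den: "(\<lambda>\<phi>. den0 \<phi> * c \<phi>) \<in> poly_funs mat_scale"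
      by (intro poly_funs.mult W2 c)+
    have nz: "den0 (phi M) * c (phi M) \<noteq> 0" using W2(2,5) MV c(2) by auto
    have rel: "num0 \<phi> * c \<phi> = f (\<pi> \<phi>) * (den0 \<phi> * c \<phi>)" if "\<phi> \<in> V" for \<phi>
    proof (cases "c \<phi> = 0")
      case False
      then have "\<phi> \<in> W2 \<inter> V" using that c(3) by (auto simp: V_def)
      then show ?thesis using W2(5) by (auto simp: field_simps)
    qed simp
    have invf: "f (\<pi> (t \<phi>)) = f (\<pi> \<phi>)" if "\<phi> \<in> V" "t \<in> TT" for \<phi> t using that pi_group by (simp add: V_def)
    obtain A C i where AC: "A \<in> poly_funs pair_scale" "C \<in> poly_funs pair_scale"
      "\<And>t y. A (wt t y) = t ^ i * A y" "\<And>t y. C (wt t y) = t ^ i * C y" "C (mu (phi M)) \<noteq> 0"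
      "\<And>\<phi>. \<phi> \<in> V \<Longrightarrow> A (mu \<phi>) = f (\<pi> \<phi>) * C (mu \<phi>)"
    proof (rule descend[OF num den nz M(3)])
      fix A C i
      assume AC: "A \<in> poly_funs pair_scale" "C \<in> poly_funs pair_scale"
        "\<And>t y. A (wt t y) = t ^ i * A y" "\<And>t y. C (wt t y) = t ^ i * C y" "C (mu (phi M)) \<noteq> 0"
        and *: "\<And>U g \<phi>. (\<And>\<phi> t. \<phi> \<in> U \<Longrightarrow> t \<in> TT \<Longrightarrow> t \<phi> \<in> U) \<Longrightarrow> (\<And>\<phi> t. \<phi> \<in> U \<Longrightarrow> t \<in> TT \<Longrightarrow> g (t \<phi>) = g \<phi>) \<Longrightarrow>
          (\<And>\<phi>. \<phi> \<in> U \<Longrightarrow> num0 \<phi> * c \<phi> = g \<phi> * (den0 \<phi> * c \<phi>)) \<Longrightarrow> \<phi> \<in> U \<Longrightarrow> A (mu \<phi>) = g \<phi> * C (mu \<phi>)"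
      have "A (mu \<phi>) = f (\<pi> \<phi>) * C (mu \<phi>)" if "\<phi> \<in> V" for \<phi>
        by (rule *[of V "\<lambda>\<phi>. f (\<pi> \<phi>)"], rule V, assumption, assumption, rule invf, assumption, assumption,
            rule rel, assumption, rule that)
      with AC show thesis by (rule that)
    qed
    \<comment> \<open>Equal weights make the quotient independent of the representative. Where
      \<open>C\<close> vanishes it takes the default value of division by 0, outside the open set
      considered.\<close>
    define G where "G h = (let y = SOME y. y \<in> cone \<and> weighted_class y = h in A y / C y)" for h
    have G: "G (weighted_class y) = A y / C y" if y: "y \<in> cone" for y
    proof -
      define y' where "y' = (SOME y'. y' \<in> cone \<and> weighted_class y' = weighted_class y)"
      have "y' \<in> cone \<and> weighted_class y' = weighted_class y"
        unfolding y'_def by (rule someI[where x = y]) (use y in simp)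
      then obtain t where t: "t \<noteq> 0" "y = wt t y'" unfolding weighted_class_eq_iff by blast
      have "G (weighted_class y) = A y' / C y'" unfolding G_def y'_def Let_def ..
      also have "\<dots> = A y / C y" unfolding t(2) AC(3,4) using t(1) by simp
      finally show ?thesis .
    qed
    show "\<exists>W' g. openin (zariski PP) W' \<and> h \<in> W' \<and> regular PP W' g \<and>
        (\<forall>y\<in>W' \<inter> {x \<in> points HH. theta x \<in> W}. f (theta y) = g y)"
    proof (intro exI[of _ "nonvanishing C"] exI[of _ G] conjI ballI)
      show D: "openin (zariski PP) (nonvanishing C)" by (rule openin_nonvanishing[OF AC(2,4)])
      show "h \<in> nonvanishing C" using AC(5) weighted_class_in_nonvanishing[OF mu_in_cone[OF M(2)] AC(4)] by (simp add: M(1) psi_def)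
      show "regular PP (nonvanishing C) G"
        unfolding regular_PP regular_zariski_space
      proof
        fix v assume v: "v \<in> {y \<in> cone. weighted_class y \<in> nonvanishing C}"
        show "\<exists>W. \<exists>a\<in>poly_funs pair_scale. \<exists>b\<in>poly_funs pair_scale. openin (zariski_top pair_scale cone) W \<and> v \<in> W \<and>
            (\<forall>u\<in>W \<inter> {y \<in> cone. weighted_class y \<in> nonvanishing C}. b u \<noteq> 0 \<and> G (weighted_class u) = a u / b u)"
        proof (rule exI[of _ "{y \<in> cone. weighted_class y \<in> nonvanishing C}"], rule bexI[OF _ AC(1)], rule bexI[OF _ AC(2)], intro conjI ballI v)
          show "openin (zariski_top pair_scale cone) {y \<in> cone. weighted_class y \<in> nonvanishing C}"
            using D unfolding openin_PP by blast
          fix u assume "u \<in> {y \<in> cone. weighted_class y \<in> nonvanishing C} \<inter> {y \<in> cone. weighted_class y \<in> nonvanishing C}"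
          then have u: "u \<in> cone" "weighted_class u \<in> nonvanishing C" by simp_all
          show "C u \<noteq> 0" using weighted_class_in_nonvanishing[OF u(1) AC(4)] u(2) by (rule iffD1)
          show "G (weighted_class u) = A u / C u" by (rule G[OF u(1)])
        qed
      qed
      fix h' assume h': "h' \<in> nonvanishing C \<inter> {x \<in> points HH. theta x \<in> W}"
      then obtain \<phi> where \<phi>: "semistable s \<phi>" "h' = psi \<phi>" unfolding points_HH by blast
      have "C (mu \<phi>) \<noteq> 0" using h' weighted_class_in_nonvanishing[OF mu_in_cone[OF \<phi>(1)] AC(4)] by (simp add: \<phi>(2) psi_def)
      moreover have "\<phi> \<in> V" using h' \<phi> theta_psi[of \<phi>] by (simp add: V_def)
      ultimately show "f (theta h') = G h'"
        using AC(6)[of \<phi>] theta_psi[of \<phi>] G[OF mu_in_cone[OF \<phi>(1)]] \<phi> by (simp add: psi_def)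
    qed
  qed
qed

theorem isomorphism_eta: "isomorphism N HH eta"
proof -
  have "\<forall>n\<in>points N. theta (eta n) = n" unfolding surj[symmetric] using eta_pi theta_psi by auto
  moreover have "\<forall>h\<in>points HH. eta (theta h) = h" unfolding points_HH using eta_pi theta_psi by auto
  ultimately show ?thesis unfolding isomorphism_def using morphism_eta morphism_theta by blast
qed

end

text \<open>Here \<open>N\<close> is any good quotient. As \<pi> maps the semistable matrices onto
  its points, the formula determines \<eta> on them.\<close>

theorem proposition6:
  fixes s :: "complex \<Rightarrow> 'v::ab_group_add \<Rightarrow> 'v"
    and x y z w :: 'v
    and N :: "'p fun_space"
    and \<pi> :: "'v^2^2 \<Rightarrow> 'p"
  assumes "vector_space s"
    and "distinct [x, y, z, w]"
    and "\<not> module.dependent s {x, y, z, w}"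
    and "module.span s {x, y, z, w} = UNIV"
    and "kronecker_moduli_space s N \<pi>"
  shows "\<exists>\<eta>. (\<forall>\<phi>. semistable s \<phi> \<longrightarrow> \<eta> (\<pi> \<phi>) = weighted_class (kron_det s \<phi>, kron_e s \<phi>)) \<and>
             isomorphism N (hypersurface s (vector [x, y, z, w])) \<eta>"
proof -
  interpret vector_space s by fact
  define b :: "'v^4" where "b = vector [x, y, z, w]"
  have b: "b $ 1 = x" "b $ 2 = y" "b $ 3 = z" "b $ 4 = w" by (simp_all add: b_def vector_4)
  have inj: "b $ a = b $ c \<longleftrightarrow> a = c" for a c
  proof -
    have "\<forall>a c. b $ a = b $ c \<longleftrightarrow> a = c" using assms(2) by (auto simp: forall_4 b)
    then show ?thesis by blast
  qed
  have ran: "{x, y, z, w} = range (\<lambda>a. b $ a)" by (auto simp: UNIV_4 b)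
  define crd where "crd a v = representation {x, y, z, w} v (b $ a)" for a v
  interpret frame s b crd
  proof
    fix a c v
    show "crd a \<in> dual s"
      unfolding dual_iff crd_def
      using assms(1) assms(3,4) representation_add[of "{x, y, z, w}"] representation_scale[of "{x, y, z, w}"] by auto
    show "crd a (b $ c) = of_bool (a = c)"
    proof -
      have "b $ c \<in> {x, y, z, w}" unfolding ran by blast
      then show ?thesis
        unfolding crd_def using representation_basis[OF assms(3)] inj by auto
    qed
    have "(\<Sum>e\<in>{x, y, z, w}. s (representation {x, y, z, w} v e) e) = v"
      using assms(3,4) by (intro sum_representation_eq) auto
    moreover have "(\<Sum>a\<in>UNIV. s (crd a v) (b $ a)) = (\<Sum>e\<in>range (\<lambda>a. b $ a). s (representation {x, y, z, w} v e) e)"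
      unfolding crd_def by (subst sum.reindex) (auto simp: inj_on_def inj)
    ultimately show "(\<Sum>a\<in>UNIV. s (crd a v) (b $ a)) = v" unfolding ran by simp
  qed
  interpret moduli s b crd N \<pi>
    by unfold_locales (use assms(5) in \<open>simp only: kronecker_moduli_space_def\<close>)
  have "\<forall>\<phi>. semistable s \<phi> \<longrightarrow> eta (\<pi> \<phi>) = weighted_class (kron_det s \<phi>, kron_e s \<phi>)"
    using eta_pi unfolding psi_def mu_def by simp
  then show ?thesis using isomorphism_eta unfolding b_def by blast
qed

end
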